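(* The quantum subgroup $C(U(n))$ of $A_u(n)$, given by the canonical surjection $\rho:A_u(n)\to C(U(n))$, is not normal in $A_u(n)$.
   Context: $A_u(n)$ is the universal $C^*$-algebra generated by $u_{ij}$, $1\le i,j\le n$, such that both $u=((u_{ij}))$ and $\overline u=((u_{ij}^* ))$ are unitary; it is a compact quantum group with comultiplication $\Phi(u_{ij})=\sum_k u_{ik}\otimes u_{kj}$. $C(U(n))$ is the algebra of continuous complex-valued functions on the unitary group $U(n)$ of $n\times n$ unitary matrices, with the comultiplication induced by the group multiplication. The surjection $\rho:A_u(n)\to C(U(n))$ sends $u_{ij}$ to the $(i,j)$ coordinate function on $U(n)$ and intertwines the comultiplications. A quantum subgroup $N=(B,\Psi)$ of a compact quantum group $G=(A,\Phi)$, with surjective $*$-homomorphism $\rho:A\to B$ satisfying $(\rho\otimes\rho)\Phi=\Psi\circ\rho$, is normal if $A_{G/N}=A_{N\backslash G}$, where $A_{G/N}=\{a\in A:(\mathrm{id}\otimes\rho)\Phi(a)=a\otimes1\}$ and $A_{N\backslash G}=\{a\in A:(\rho\otimes\mathrm{id})\Phi(a)=1\otimes a\}$.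
   Formalization: The formal theorem assumes n ≥ 2; for n = 1 the map ρ from A_u(1) to C(U(1)) is an isomorphism, both coset algebras are the scalars, and the subgroup is normal, so the claim fails there. *)

theory Defs
  imports "HOL-Analysis.Analysis" "HOL-Algebra.QuotRing" "HOL-Algebra.Module"
begin

section \<open>Unital *-algebras and C*-algebras as carrier-based structures\<close>

record 'a star_algebra = "(complex, 'a) module" +
  star :: "'a \<Rightarrow> 'a"

record 'a cstar_algebra = "'a star_algebra" +
  nrm :: "'a \<Rightarrow> real"

definition star_hom ::
    "('a, 'x) star_algebra_scheme \<Rightarrow> ('b, 'y) star_algebra_scheme \<Rightarrow> ('a \<Rightarrow> 'b) \<Rightarrow> bool" where
  "star_hom A B f \<longleftrightarrow> f \<in> ring_hom A B \<and>
     (\<forall>c. \<forall>a\<in>carrier A. f (c \<odot>\<^bsub>A\<^esub> a) = c \<odot>\<^bsub>B\<^esub> f a) \<and>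
     (\<forall>a\<in>carrier A. f (star A a) = star B (f a))"

definition cstar_seminorm :: "('a, 'x) star_algebra_scheme \<Rightarrow> ('a \<Rightarrow> real) \<Rightarrow> bool" where
  "cstar_seminorm A s \<longleftrightarrow>
     (\<forall>a\<in>carrier A. 0 \<le> s a) \<and>
     (\<forall>a\<in>carrier A. \<forall>b\<in>carrier A. s (a \<oplus>\<^bsub>A\<^esub> b) \<le> s a + s b) \<and>
     (\<forall>c. \<forall>a\<in>carrier A. s (c \<odot>\<^bsub>A\<^esub> a) = cmod c * s a) \<and>
     (\<forall>a\<in>carrier A. \<forall>b\<in>carrier A. s (a \<otimes>\<^bsub>A\<^esub> b) \<le> s a * s b) \<and>
     (\<forall>a\<in>carrier A. s (star A a) = s a) \<and>
     (\<forall>a\<in>carrier A. s (star A a \<otimes>\<^bsub>A\<^esub> a) = (s a)\<^sup>2)"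


section \<open>Separated completion with respect to a seminorm\<close>

text \<open>The ring of Cauchy sequences modulo the ideal of null sequences, with the induced
  scalar multiplication, involution and norm.\<close>

definition cauchy_seq_ring ::
    "('a, 'x) star_algebra_scheme \<Rightarrow> ('a \<Rightarrow> real) \<Rightarrow> (nat \<Rightarrow> 'a) ring" where
  "cauchy_seq_ring F s =
    \<lparr>carrier = {X. (\<forall>n. X n \<in> carrier F) \<and>
        (\<forall>e>0. \<exists>N. \<forall>m\<ge>N. \<forall>n\<ge>N. s (X m \<ominus>\<^bsub>F\<^esub> X n) < e)},
     mult = (\<lambda>X Y n. X n \<otimes>\<^bsub>F\<^esub> Y n), one = (\<lambda>n. \<one>\<^bsub>F\<^esub>),
     zero = (\<lambda>n. \<zero>\<^bsub>F\<^esub>), add = (\<lambda>X Y n. X n \<oplus>\<^bsub>F\<^esub> Y n)\<rparr>"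

definition null_seqs ::
    "('a, 'x) star_algebra_scheme \<Rightarrow> ('a \<Rightarrow> real) \<Rightarrow> (nat \<Rightarrow> 'a) set" where
  "null_seqs F s = {X \<in> carrier (cauchy_seq_ring F s). (\<lambda>n. s (X n)) \<longlonglongrightarrow> 0}"

definition seq_class ::
    "('a, 'x) star_algebra_scheme \<Rightarrow> ('a \<Rightarrow> real) \<Rightarrow> (nat \<Rightarrow> 'a) \<Rightarrow> (nat \<Rightarrow> 'a) set" where
  "seq_class F s X = null_seqs F s +>\<^bsub>cauchy_seq_ring F s\<^esub> X"

definition completion ::
    "('a, 'x) star_algebra_scheme \<Rightarrow> ('a \<Rightarrow> real) \<Rightarrow> (nat \<Rightarrow> 'a) set cstar_algebra" where
  "completion F s = (let Q = cauchy_seq_ring F s Quot null_seqs F s in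
    \<lparr>carrier = carrier Q, mult = mult Q, one = one Q, zero = zero Q, add = add Q,
     smult = (\<lambda>c C. \<Union>X\<in>C. seq_class F s (\<lambda>n. c \<odot>\<^bsub>F\<^esub> X n)),
     star = (\<lambda>C. \<Union>X\<in>C. seq_class F s (\<lambda>n. star F (X n))),
     nrm = (\<lambda>C. THE r. \<exists>X\<in>C. (\<lambda>n. s (X n)) \<longlonglongrightarrow> r)\<rparr>)"


section \<open>The *-algebra of a monoid with involution\<close>

text \<open>Finitely supported functions on a monoid \<open>M\<close> with convolution product; \<open>adj\<close> is an
  involutive anti-automorphism of \<open>M\<close>. It gives both the free *-algebra and, below, a
  *-algebra that maps onto the algebraic tensor product of two C*-algebras.\<close>

definition monoid_star_algebra ::
    "('m, 'x) monoid_scheme \<Rightarrow> ('m \<Rightarrow> 'm) \<Rightarrow> ('m \<Rightarrow> complex) star_algebra" where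
  "monoid_star_algebra M adj =
    \<lparr>carrier = {p. finite {m. p m \<noteq> 0} \<and> {m. p m \<noteq> 0} \<subseteq> carrier M},
     mult = (\<lambda>p q m. \<Sum>(x, y)\<in>{(x, y). p x \<noteq> 0 \<and> q y \<noteq> 0 \<and> x \<otimes>\<^bsub>M\<^esub> y = m}. p x * q y),
     one = (\<lambda>m. if m = \<one>\<^bsub>M\<^esub> then 1 else 0),
     zero = (\<lambda>m. 0),
     add = (\<lambda>p q m. p m + q m),
     smult = (\<lambda>c p m. c * p m),
     star = (\<lambda>p m. if m \<in> carrier M then cnj (p (adj m)) else 0)\<rparr>"

definition monomial :: "'m \<Rightarrow> 'm \<Rightarrow> complex" where
  "monomial x = (\<lambda>m. if m = x then 1 else 0)"


section \<open>Universal C*-algebras\<close>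

text \<open>A letter \<open>(x, False)\<close> is the generator \<open>x\<close> and \<open>(x, True)\<close> is its adjoint.\<close>

definition free_star_algebra :: "(('x \<times> bool) list \<Rightarrow> complex) star_algebra" where
  "free_star_algebra = monoid_star_algebra \<lparr>carrier = UNIV, mult = (@), one = []\<rparr>
     (\<lambda>w. rev (map (\<lambda>(x, b). (x, \<not> b)) w))"

definition gen :: "'x \<Rightarrow> ('x \<times> bool) list \<Rightarrow> complex" where
  "gen x = monomial [(x, False)]"

text \<open>The largest C*-seminorm that kills the relators \<open>R\<close>, for generators of norm at most one.
  For \<open>A\<^sub>u(n)\<close> the bound on the generators excludes nothing: in a unital C*-algebra the entries
  of a unitary matrix have norm at most one. It only makes the supremum visibly finite.\<close>

definition universal_seminorm ::
    "(('x \<times> bool) list \<Rightarrow> complex) set \<Rightarrow> (('x \<times> bool) list \<Rightarrow> complex) \<Rightarrow> real" where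
  "universal_seminorm R p = Sup {s p |s. cstar_seminorm free_star_algebra s \<and>
     (\<forall>x. s (gen x) \<le> 1) \<and> (\<forall>r\<in>R. s r = 0)}"

definition universal_cstar_algebra ::
    "(('x \<times> bool) list \<Rightarrow> complex) set \<Rightarrow>
     (nat \<Rightarrow> ('x \<times> bool) list \<Rightarrow> complex) set cstar_algebra" where
  "universal_cstar_algebra R = completion free_star_algebra (universal_seminorm R)"


section \<open>The quantum group \<open>A\<^sub>u(n)\<close>\<close>

text \<open>The relators saying that \<open>v v\<^sup>* = 1\<close> and \<open>v\<^sup>* v = 1\<close> for a square matrix \<open>v\<close> over \<open>A\<close>.
  The size \<open>n\<close> is the cardinality of the index type.\<close>

definition unitary_relators ::
    "('a, 'x) star_algebra_scheme \<Rightarrow> ('n::finite \<Rightarrow> 'n \<Rightarrow> 'a) \<Rightarrow> 'a set" where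
  "unitary_relators A v =
     {(\<Oplus>\<^bsub>A\<^esub>k\<in>UNIV. v i k \<otimes>\<^bsub>A\<^esub> star A (v j k)) \<ominus>\<^bsub>A\<^esub> (if i = j then \<one>\<^bsub>A\<^esub> else \<zero>\<^bsub>A\<^esub>) |i j. True} \<union>
     {(\<Oplus>\<^bsub>A\<^esub>k\<in>UNIV. star A (v k i) \<otimes>\<^bsub>A\<^esub> v k j) \<ominus>\<^bsub>A\<^esub> (if i = j then \<one>\<^bsub>A\<^esub> else \<zero>\<^bsub>A\<^esub>) |i j. True}"

definition Au_relators :: "((('n::finite \<times> 'n) \<times> bool) list \<Rightarrow> complex) set" where
  "Au_relators =
     unitary_relators free_star_algebra (\<lambda>i j. gen (i, j)) \<union>
     unitary_relators free_star_algebra (\<lambda>i j. star free_star_algebra (gen (i, j)))"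

type_synonym 'n au = "(nat \<Rightarrow> (('n \<times> 'n) \<times> bool) list \<Rightarrow> complex) set"

definition Au :: "'n::finite au cstar_algebra" where
  "Au = universal_cstar_algebra Au_relators"

definition Au_gen :: "'n::finite \<Rightarrow> 'n \<Rightarrow> 'n au" where
  "Au_gen i j = seq_class free_star_algebra (universal_seminorm Au_relators) (\<lambda>_. gen (i, j))"


section \<open>The algebra of continuous functions on \<open>U(n)\<close>\<close>

definition unitary_group :: "(complex ^ 'n ^ 'n) set" where
  "unitary_group = {g. g ** (\<chi> i j. cnj (g $ j $ i)) = mat 1 \<and> (\<chi> i j. cnj (g $ j $ i)) ** g = mat 1}"

type_synonym 'n cu = "complex ^ 'n ^ 'n \<Rightarrow> complex"

definition CU :: "'n::finite cu cstar_algebra" where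
  "CU =
    \<lparr>carrier = {f \<in> extensional unitary_group. continuous_on unitary_group f},
     mult = (\<lambda>f h. \<lambda>g\<in>unitary_group. f g * h g),
     one = (\<lambda>g\<in>unitary_group. 1),
     zero = (\<lambda>g\<in>unitary_group. 0),
     add = (\<lambda>f h. \<lambda>g\<in>unitary_group. f g + h g),
     smult = (\<lambda>c f. \<lambda>g\<in>unitary_group. c * f g),
     star = (\<lambda>f. \<lambda>g\<in>unitary_group. cnj (f g)),
     nrm = (\<lambda>f. SUP g\<in>unitary_group. cmod (f g))\<rparr>"

definition coord :: "'n::finite \<Rightarrow> 'n \<Rightarrow> 'n cu" where
  "coord i j = (\<lambda>g\<in>unitary_group. g $ i $ j)"


section \<open>The spatial tensor product\<close>

definition is_state :: "('a, 'x) cstar_algebra_scheme \<Rightarrow> ('a \<Rightarrow> complex) \<Rightarrow> bool" where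
  "is_state A \<phi> \<longleftrightarrow>
     (\<forall>a\<in>carrier A. \<forall>b\<in>carrier A. \<phi> (a \<oplus>\<^bsub>A\<^esub> b) = \<phi> a + \<phi> b) \<and>
     (\<forall>c. \<forall>a\<in>carrier A. \<phi> (c \<odot>\<^bsub>A\<^esub> a) = c * \<phi> a) \<and>
     (\<forall>a\<in>carrier A. \<phi> (star A a \<otimes>\<^bsub>A\<^esub> a) \<in> \<real>\<^sub>\<ge>\<^sub>0) \<and>
     (\<forall>a\<in>carrier A. cmod (\<phi> a) \<le> nrm A a) \<and>
     \<phi> \<one>\<^bsub>A\<^esub> = 1"

text \<open>Formal finite combinations of pairs \<open>(a, b)\<close> with
  \<open>(a, b) (a', b') = (a a', b b')\<close> and \<open>(a, b)\<^sup>* = (a\<^sup>*, b\<^sup>*)\<close>. Bilinearity is not imposed here;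
  the bilinearity relations are among the elements of spatial seminorm zero, and these
  disappear in the separated completion.\<close>

definition formal_tensors ::
    "('a, 'x) cstar_algebra_scheme \<Rightarrow> ('b, 'y) cstar_algebra_scheme \<Rightarrow>
     ('a \<times> 'b \<Rightarrow> complex) star_algebra" where
  "formal_tensors A B = monoid_star_algebra (A \<times>\<times> B) (map_prod (star A) (star B))"

text \<open>The functional \<open>\<phi> \<otimes> \<psi>\<close> on formal combinations.\<close>

definition product_functional ::
    "('a \<Rightarrow> complex) \<Rightarrow> ('b \<Rightarrow> complex) \<Rightarrow> ('a \<times> 'b \<Rightarrow> complex) \<Rightarrow> complex" where
  "product_functional \<phi> \<psi> t = (\<Sum>(a, b)\<in>{z. t z \<noteq> 0}. t (a, b) * \<phi> a * \<psi> b)"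

text \<open>The spatial norm is the supremum of \<open>\<parallel>(\<pi>\<^sub>\<phi> \<otimes> \<pi>\<^sub>\<psi>)(t)\<parallel>\<close> over the GNS representations of
  states \<open>\<phi>\<close> of \<open>A\<close> and \<open>\<psi>\<close> of \<open>B\<close>. The operator norm is written out on the dense
  subspace of vectors \<open>(\<pi>\<^sub>\<phi> \<otimes> \<pi>\<^sub>\<psi>)(y) (\<xi>\<^sub>\<phi> \<otimes> \<xi>\<^sub>\<psi>)\<close>, where \<open>\<xi>\<^sub>\<phi>\<close> and \<open>\<xi>\<^sub>\<psi>\<close> are the cyclic vectors.\<close>

definition spatial_seminorm ::
    "('a, 'x) cstar_algebra_scheme \<Rightarrow> ('b, 'y) cstar_algebra_scheme \<Rightarrow>
     ('a \<times> 'b \<Rightarrow> complex) \<Rightarrow> real" where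
  "spatial_seminorm A B t = (let F = formal_tensors A B in
     sqrt (Sup {Re (product_functional \<phi> \<psi>
                   (star F (t \<otimes>\<^bsub>F\<^esub> y) \<otimes>\<^bsub>F\<^esub> (t \<otimes>\<^bsub>F\<^esub> y))) |\<phi> \<psi> y.
        is_state A \<phi> \<and> is_state B \<psi> \<and> y \<in> carrier F \<and>
        product_functional \<phi> \<psi> (star F y \<otimes>\<^bsub>F\<^esub> y) = 1}))"

type_synonym ('a, 'b) tensor = "(nat \<Rightarrow> 'a \<times> 'b \<Rightarrow> complex) set"

definition spatial_tensor ::
    "('a, 'x) cstar_algebra_scheme \<Rightarrow> ('b, 'y) cstar_algebra_scheme \<Rightarrow>
     ('a, 'b) tensor cstar_algebra" where
  "spatial_tensor A B = completion (formal_tensors A B) (spatial_seminorm A B)"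

definition tensor_class ::
    "('a, 'x) cstar_algebra_scheme \<Rightarrow> ('b, 'y) cstar_algebra_scheme \<Rightarrow>
     (nat \<Rightarrow> 'a \<times> 'b \<Rightarrow> complex) \<Rightarrow> ('a, 'b) tensor" where
  "tensor_class A B = seq_class (formal_tensors A B) (spatial_seminorm A B)"

definition elem_tensor ::
    "('a, 'x) cstar_algebra_scheme \<Rightarrow> ('b, 'y) cstar_algebra_scheme \<Rightarrow>
     'a \<Rightarrow> 'b \<Rightarrow> ('a, 'b) tensor" where
  "elem_tensor A B a b = tensor_class A B (\<lambda>_. monomial (a, b))"

text \<open>\<open>f \<otimes> g\<close> for *-homomorphisms \<open>f\<close> and \<open>g\<close> with values in \<open>C\<close> and \<open>D\<close>: the linear
  extension of \<open>(a, b) \<mapsto> (f a, g b)\<close>, followed by extension by continuity.\<close>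

definition formal_map ::
    "('a \<Rightarrow> 'c) \<Rightarrow> ('b \<Rightarrow> 'd) \<Rightarrow> ('a \<times> 'b \<Rightarrow> complex) \<Rightarrow> 'c \<times> 'd \<Rightarrow> complex" where
  "formal_map f g t = (\<lambda>z. \<Sum>w\<in>{w. t w \<noteq> 0 \<and> map_prod f g w = z}. t w)"

definition tensor_map ::
    "('c, 'x) cstar_algebra_scheme \<Rightarrow> ('d, 'y) cstar_algebra_scheme \<Rightarrow>
     ('a \<Rightarrow> 'c) \<Rightarrow> ('b \<Rightarrow> 'd) \<Rightarrow> ('a, 'b) tensor \<Rightarrow> ('c, 'd) tensor" where
  "tensor_map C D f g T = (\<Union>X\<in>T. tensor_class C D (\<lambda>n. formal_map f g (X n)))"

text \<open>\<open>\<phi> \<otimes> \<psi>\<close> for states \<open>\<phi>\<close> and \<open>\<psi>\<close>, extended by continuity to the completion.\<close>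

definition tensor_functional ::
    "('a \<Rightarrow> complex) \<Rightarrow> ('b \<Rightarrow> complex) \<Rightarrow> ('a, 'b) tensor \<Rightarrow> complex" where
  "tensor_functional \<phi> \<psi> T = (THE c. \<exists>X\<in>T. (\<lambda>n. product_functional \<phi> \<psi> (X n)) \<longlonglongrightarrow> c)"


section \<open>Comultiplications, quantum subgroups, normality\<close>

text \<open>Both comultiplications are determined uniquely by these conditions.\<close>

definition Au_comult :: "('n::finite au \<Rightarrow> ('n au, 'n au) tensor) \<Rightarrow> bool" where
  "Au_comult \<Phi> \<longleftrightarrow> star_hom Au (spatial_tensor Au Au) \<Phi> \<and>
     (\<forall>i j. \<Phi> (Au_gen i j) =
        (\<Oplus>\<^bsub>spatial_tensor Au Au\<^esub>k\<in>UNIV. elem_tensor Au Au (Au_gen i k) (Au_gen k j)))"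

text \<open>Under \<open>C(U(n)) \<otimes> C(U(n)) = C(U(n) \<times> U(n))\<close> the value at \<open>(g, h)\<close> is the product of the
  two point evaluations, so the second condition says that \<open>\<Psi> f\<close> is \<open>(g, h) \<mapsto> f (g h)\<close>.\<close>

definition CU_comult :: "('n::finite cu \<Rightarrow> ('n cu, 'n cu) tensor) \<Rightarrow> bool" where
  "CU_comult \<Psi> \<longleftrightarrow> star_hom CU (spatial_tensor CU CU) \<Psi> \<and>
     (\<forall>f\<in>carrier CU. \<forall>g\<in>unitary_group. \<forall>h\<in>unitary_group.
        tensor_functional (\<lambda>k. k g) (\<lambda>k. k h) (\<Psi> f) = f (g ** h))"

definition quantum_subgroup ::
    "('a, 'x) cstar_algebra_scheme \<Rightarrow> ('a \<Rightarrow> ('a, 'a) tensor) \<Rightarrow>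
     ('b, 'y) cstar_algebra_scheme \<Rightarrow> ('b \<Rightarrow> ('b, 'b) tensor) \<Rightarrow> ('a \<Rightarrow> 'b) \<Rightarrow> bool" where
  "quantum_subgroup A \<Phi> B \<Psi> \<rho> \<longleftrightarrow>
     star_hom A B \<rho> \<and> \<rho> ` carrier A = carrier B \<and>
     (\<forall>a\<in>carrier A. tensor_map B B \<rho> \<rho> (\<Phi> a) = \<Psi> (\<rho> a))"

text \<open>\<open>A\<^bsub>G/N\<^esub>\<close> and \<open>A\<^bsub>N\G\<^esub>\<close>.\<close>

definition left_coset_algebra ::
    "('a, 'x) cstar_algebra_scheme \<Rightarrow> ('a \<Rightarrow> ('a, 'a) tensor) \<Rightarrow>
     ('b, 'y) cstar_algebra_scheme \<Rightarrow> ('a \<Rightarrow> 'b) \<Rightarrow> 'a set" where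
  "left_coset_algebra A \<Phi> B \<rho> =
     {a \<in> carrier A. tensor_map A B id \<rho> (\<Phi> a) = elem_tensor A B a \<one>\<^bsub>B\<^esub>}"

definition right_coset_algebra ::
    "('a, 'x) cstar_algebra_scheme \<Rightarrow> ('a \<Rightarrow> ('a, 'a) tensor) \<Rightarrow>
     ('b, 'y) cstar_algebra_scheme \<Rightarrow> ('a \<Rightarrow> 'b) \<Rightarrow> 'a set" where
  "right_coset_algebra A \<Phi> B \<rho> =
     {a \<in> carrier A. tensor_map B A \<rho> id (\<Phi> a) = elem_tensor B A \<one>\<^bsub>B\<^esub> a}"

text \<open>To be applied to quantum subgroups only; the comultiplication of the subgroup does not
  enter.\<close>

definition normal_quantum_subgroup ::
    "('a, 'x) cstar_algebra_scheme \<Rightarrow> ('a \<Rightarrow> ('a, 'a) tensor) \<Rightarrow>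
     ('b, 'y) cstar_algebra_scheme \<Rightarrow> ('a \<Rightarrow> 'b) \<Rightarrow> bool" where
  "normal_quantum_subgroup A \<Phi> B \<rho> \<longleftrightarrow> left_coset_algebra A \<Phi> B \<rho> = right_coset_algebra A \<Phi> B \<rho>"

end

theory Submission
  imports Defs
begin

text \<open>For \<open>p \<noteq> q\<close> consider the crossing sum
  \<open>a = \<Sum>\<^sub>k\<^sub>l u\<^sub>p\<^sub>k u\<^sub>p\<^sub>l u\<^sub>p\<^sub>k\<^sup>* u\<^sub>q\<^sub>l\<^sup>*\<close>. Since coordinate functions on \<open>U(n)\<close> commute, the rows of a
  unitary matrix being orthonormal gives \<open>(id \<otimes> \<rho>)\<Phi>(a) = a \<otimes> 1\<close>, so \<open>a\<close> lies in \<open>A\<^bsub>G/N\<^esub>\<close>.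
  If \<open>a\<close> were in \<open>A\<^bsub>N\G\<^esub>\<close>, evaluating \<open>(\<rho> \<otimes> id)\<Phi>(a) = 1 \<otimes> a\<close> at the diagonal matrix with entry
  \<open>-1\<close> at \<open>q\<close> and \<open>1\<close> elsewhere would give \<open>-a = a\<close>, hence \<open>a = 0\<close>. But the matrices
  \<open>u\<^sub>i\<^sub>j = v\<^sub>i\<^sub>j e\<^sub>j\<close> with \<open>v\<close> real orthogonal and \<open>e\<^sub>j\<close> unitary define a representation of \<open>A\<^sub>u(n)\<close>,
  and for suitable \<open>v\<close> and anticommuting \<open>e\<^sub>p\<close>, \<open>e\<^sub>q\<close> it maps \<open>a\<close> to a nonzero scalar.\<close>


section \<open>Complex star algebras and C*-seminorms\<close>

text \<open>The order of the factors in \<open>a\<close> is essential. The sums over k and l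
  interleave, so in a noncommutative algebra neither row relation applies; in the nested order
  \<open>u_pk u_pl u_ql^* u_pk^*\<close> the sum over l alone would give 0 by the relations of
  \<open>Au\<close>. All algebras in sight are completions of formal algebras for seminorms given by
  suprema, and no Hilbert space is built. Representations enter through positive functionals only:
  an operator norm is a supremum of GNS lengths (\<open>functional_family\<close>). Positivity of
  \<phi> \<otimes> \<psi> rests on the Schur product theorem. Two points need work. Left
  multiplication must be bounded in GNS lengths although the formal algebras carry no norm
  beforehand. And \<rho> must be contractive, or else id \<otimes> \<rho> would not be well defined
  on classes; since \<rho> takes values in functions, this reduces to characters and a Neumann
  series. That \<open>a\<close> is nonzero is detected by a state: a vector functional of the
  representation is bounded by the universal seminorm, extends to \<open>Au\<close> and has the
  value 168/625 at \<open>a\<close>.\<close>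

text \<open>Purely algebraic axioms without a norm: the formal algebras satisfy them before any
  seminorm is constructed, and completions satisfy them again.\<close>

locale complex_star_algebra = ring A for A :: "('a, 'x) star_algebra_scheme" (structure) +
  assumes smult_closed [simp, intro]: "a \<in> carrier A \<Longrightarrow> c \<odot> a \<in> carrier A"
    and smult_l_distr: "a \<in> carrier A \<Longrightarrow> (c + d) \<odot> a = c \<odot> a \<oplus> d \<odot> a"
    and smult_r_distr: "a \<in> carrier A \<Longrightarrow> b \<in> carrier A \<Longrightarrow> c \<odot> (a \<oplus> b) = c \<odot> a \<oplus> c \<odot> b"
    and smult_assoc: "a \<in> carrier A \<Longrightarrow> c \<odot> (d \<odot> a) = (c * d) \<odot> a"
    and smult_one [simp]: "a \<in> carrier A \<Longrightarrow> 1 \<odot> a = a"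
    and smult_mult_left: "a \<in> carrier A \<Longrightarrow> b \<in> carrier A \<Longrightarrow> (c \<odot> a) \<otimes> b = c \<odot> (a \<otimes> b)"
    and smult_mult_right: "a \<in> carrier A \<Longrightarrow> b \<in> carrier A \<Longrightarrow> a \<otimes> (c \<odot> b) = c \<odot> (a \<otimes> b)"
    and star_closed [simp, intro]: "a \<in> carrier A \<Longrightarrow> star A a \<in> carrier A"
    and star_add: "a \<in> carrier A \<Longrightarrow> b \<in> carrier A \<Longrightarrow> star A (a \<oplus> b) = star A a \<oplus> star A b"
    and star_mult: "a \<in> carrier A \<Longrightarrow> b \<in> carrier A \<Longrightarrow> star A (a \<otimes> b) = star A b \<otimes> star A a"
    and star_smult: "a \<in> carrier A \<Longrightarrow> star A (c \<odot> a) = cnj c \<odot> star A a"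
    and star_star [simp]: "a \<in> carrier A \<Longrightarrow> star A (star A a) = a"
begin

lemma smult_zero [simp]: "a \<in> carrier A \<Longrightarrow> 0 \<odot> a = \<zero>"
  using smult_l_distr[of a 0 0] by (metis add.r_cancel_one' add_0 smult_closed)

lemma minus_eq_smult: "a \<in> carrier A \<Longrightarrow> \<ominus> a = (-1) \<odot> a"
  using smult_l_distr[of a 1 "-1"]
  by (metis add.inv_solve_left' add.m_closed minus_unique smult_closed smult_one smult_zero add.right_inverse
      add.r_one add.inv_closed add.right_cancel right_minus a_comm zero_closed)

lemma star_zero [simp]: "star A \<zero> = \<zero>"
  using star_smult[of \<zero> 0] by simp

lemma star_minus: "a \<in> carrier A \<Longrightarrow> star A (\<ominus> a) = \<ominus> star A a"
  by (simp add: minus_eq_smult star_smult)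

lemma star_one [simp]: "star A \<one> = \<one>"
proof -
  have "star A (\<one> \<otimes> star A \<one>) = star A (star A \<one>) \<otimes> star A \<one>"
    by (rule star_mult) auto
  then show ?thesis by simp
qed

lemma add_minus_swap:
  assumes "a \<in> carrier A" "b \<in> carrier A" "c \<in> carrier A" "d \<in> carrier A"
  shows "(a \<oplus> b) \<ominus> (c \<oplus> d) = (a \<ominus> c) \<oplus> (b \<ominus> d)"
  using assms by (simp add: a_minus_def minus_add a_ac)

lemma mult_minus_split:
  assumes "a \<in> carrier A" "b \<in> carrier A" "c \<in> carrier A" "d \<in> carrier A"
  shows "a \<otimes> b \<ominus> c \<otimes> d = a \<otimes> (b \<ominus> d) \<oplus> (a \<ominus> c) \<otimes> d"
  using assms
  by (simp add: a_minus_def r_distr l_distr r_minus l_minus a_assoc)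
     (simp add: a_assoc[symmetric] l_neg)

lemma smult_minus: "a \<in> carrier A \<Longrightarrow> b \<in> carrier A \<Longrightarrow> c \<odot> (a \<ominus> b) = c \<odot> a \<ominus> c \<odot> b"
  by (simp add: a_minus_def minus_eq_smult smult_r_distr smult_assoc mult.commute)

text \<open>Suprema yield inequalities only, and these suffice. Homogeneity follows by applying the
  inequality to the inverse scalar. From \<open>(s a)\<^sup>2 \<le> s (star A a \<otimes> a) \<le> s
  (star A a) * s a\<close> follow invariance under the involution and then the C*-identity.\<close>

lemma cstar_seminormI:
  assumes nn: "\<And>a. a \<in> carrier A \<Longrightarrow> 0 \<le> s a"
    and add: "\<And>a b. a \<in> carrier A \<Longrightarrow> b \<in> carrier A \<Longrightarrow> s (a \<oplus> b) \<le> s a + s b"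
    and smult_le: "\<And>c a. a \<in> carrier A \<Longrightarrow> s (c \<odot> a) \<le> cmod c * s a"
    and mult: "\<And>a b. a \<in> carrier A \<Longrightarrow> b \<in> carrier A \<Longrightarrow> s (a \<otimes> b) \<le> s a * s b"
    and sq_le: "\<And>a. a \<in> carrier A \<Longrightarrow> (s a)\<^sup>2 \<le> s (star A a \<otimes> a)"
  shows "cstar_seminorm A s"
proof -
  have smult: "s (c \<odot> a) = cmod c * s a" if a: "a \<in> carrier A" for a c
  proof (cases "c = 0")
    case True
    then show ?thesis using smult_le[OF a, of 0] nn[of "0 \<odot> a"] a by simp
  next
    case False
    have "cmod c * s a = cmod c * s (inverse c \<odot> (c \<odot> a))"
      using a False by (simp add: smult_assoc)
    also have "\<dots> \<le> cmod c * (cmod (inverse c) * s (c \<odot> a))"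
      using a by (intro mult_left_mono smult_le) auto
    also have "\<dots> = s (c \<odot> a)" using False by (simp add: norm_inverse)
    finally show ?thesis using smult_le[OF a, of c] by simp
  qed
  have star_ge: "s a \<le> s (star A a)" if a: "a \<in> carrier A" for a
  proof -
    have "s a * s a \<le> s (star A a) * s a"
      using sq_le[OF a] mult[of "star A a" a] a by (simp add: power2_eq_square)
    then show ?thesis
      using nn[OF a] nn[of "star A a"] a by (cases "s a = 0") (auto simp: mult_le_cancel_right)
  qed
  have star: "s (star A a) = s a" if a: "a \<in> carrier A" for a
    using star_ge[OF a] star_ge[of "star A a"] a by simp
  have cs: "s (star A a \<otimes> a) = (s a)\<^sup>2" if a: "a \<in> carrier A" for a
    using sq_le[OF a] mult[of "star A a" a] star[OF a] a by (simp add: power2_eq_square)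
  show ?thesis
    unfolding cstar_seminorm_def by (auto simp: nn smult star cs intro: add mult)
qed

end

locale seminormed_star_algebra = complex_star_algebra A
  for A :: "('a, 'x) star_algebra_scheme" (structure) and s :: "'a \<Rightarrow> real" +
  assumes cstar: "cstar_seminorm A s"
begin

lemma s_nonneg [simp]: "a \<in> carrier A \<Longrightarrow> 0 \<le> s a"
  and s_triangle: "a \<in> carrier A \<Longrightarrow> b \<in> carrier A \<Longrightarrow> s (a \<oplus> b) \<le> s a + s b"
  and s_smult: "a \<in> carrier A \<Longrightarrow> s (c \<odot> a) = cmod c * s a"
  and s_mult: "a \<in> carrier A \<Longrightarrow> b \<in> carrier A \<Longrightarrow> s (a \<otimes> b) \<le> s a * s b"
  and s_star: "a \<in> carrier A \<Longrightarrow> s (star A a) = s a"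
  and s_cstar: "a \<in> carrier A \<Longrightarrow> s (star A a \<otimes> a) = (s a)\<^sup>2"
  using cstar unfolding cstar_seminorm_def by auto

lemma s_zero [simp]: "s \<zero> = 0"
  using s_smult[of \<zero> 0] by simp

lemma s_one: "s \<one> \<le> 1"
proof -
  have "s \<one> = (s \<one>)\<^sup>2" using s_cstar[of \<one>] by simp
  then show ?thesis by (cases "s \<one> = 0") (auto simp: power2_eq_square)
qed

lemma s_minus: "a \<in> carrier A \<Longrightarrow> s (\<ominus> a) = s a"
  by (simp add: minus_eq_smult s_smult)

lemma s_minus_commute: "a \<in> carrier A \<Longrightarrow> b \<in> carrier A \<Longrightarrow> s (a \<ominus> b) = s (b \<ominus> a)"
  by (metis minus_closed minus_minus a_minus_def add.inv_closed minus_add a_comm s_minus)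

lemma s_diff: "a \<in> carrier A \<Longrightarrow> b \<in> carrier A \<Longrightarrow> s (a \<ominus> b) \<le> s a + s b"
  using s_triangle[of a "\<ominus> b"] by (simp add: a_minus_def s_minus)

lemma s_abs_diff:
  assumes "a \<in> carrier A" "b \<in> carrier A"
  shows "\<bar>s a - s b\<bar> \<le> s (a \<ominus> b)"
proof -
  have 1: "s x \<le> s (x \<ominus> y) + s y" if "x \<in> carrier A" "y \<in> carrier A" for x y
  proof -
    have "(x \<ominus> y) \<oplus> y = x" using that by (simp add: a_minus_def a_assoc l_neg)
    then show ?thesis using s_triangle[of "x \<ominus> y" y] that by simp
  qed
  show ?thesis using 1[of a b] 1[of b a] assms s_minus_commute[of a b] by simp
qed

end


section \<open>The separated completion\<close>

context seminormed_star_algebra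
begin

text \<open>The double limit is a limit along a product filter, so that limit rules replace epsilon
  arguments; \<open>carrier_cauchy_seq_ring\<close> translates.\<close>

definition cauchy :: "(nat \<Rightarrow> 'a) \<Rightarrow> bool" where
  "cauchy X \<longleftrightarrow> (\<forall>n. X n \<in> carrier A) \<and>
     ((\<lambda>(m, n). s (X m \<ominus> X n)) \<longlongrightarrow> 0) (sequentially \<times>\<^sub>F sequentially)"

abbreviation null :: "(nat \<Rightarrow> 'a) \<Rightarrow> bool" where
  "null X \<equiv> (\<forall>n. X n \<in> carrier A) \<and> (\<lambda>n. s (X n)) \<longlonglongrightarrow> 0"

abbreviation cls :: "(nat \<Rightarrow> 'a) \<Rightarrow> (nat \<Rightarrow> 'a) set" where
  "cls \<equiv> seq_class A s"

lemma cauchy_closed [simp]: "cauchy X \<Longrightarrow> X n \<in> carrier A"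
  by (simp add: cauchy_def)

lemma carrier_cauchy_seq_ring: "carrier (cauchy_seq_ring A s) = Collect cauchy"
proof -
  have "((\<lambda>(m, n). s (X m \<ominus> X n)) \<longlongrightarrow> 0) (sequentially \<times>\<^sub>F sequentially) \<longleftrightarrow>
     (\<forall>e>0. \<exists>N. \<forall>m\<ge>N. \<forall>n\<ge>N. s (X m \<ominus> X n) < e)" if X: "\<forall>n. X n \<in> carrier A" for X
  proof -
    have [simp]: "\<bar>s (X m \<ominus> X n)\<bar> = s (X m \<ominus> X n)" for m n using X by simp
    show ?thesis
      unfolding tendsto_iff eventually_prod_sequentially by (auto simp: dist_real_def)
        (use X s_minus_commute in metis)+
  qed
  then show ?thesis unfolding cauchy_seq_ring_def cauchy_def by auto
qed

lemma cauchyI: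
  assumes "\<And>n. X n \<in> carrier A" "\<And>m n. s (X m \<ominus> X n) \<le> b m n"
    and "((\<lambda>(m, n). b m n) \<longlongrightarrow> 0) (sequentially \<times>\<^sub>F sequentially)"
  shows "cauchy X"
  unfolding cauchy_def
proof (intro conjI allI)
  show "((\<lambda>(m, n). s (X m \<ominus> X n)) \<longlongrightarrow> 0) (sequentially \<times>\<^sub>F sequentially)"
    by (rule tendsto_sandwich[OF _ _ tendsto_const assms(3)]) (use assms in \<open>auto simp: split_def\<close>)
qed (use assms in auto)

lemma cauchy_tendsto:
  "cauchy X \<Longrightarrow> ((\<lambda>(m, n). s (X m \<ominus> X n)) \<longlongrightarrow> 0) (sequentially \<times>\<^sub>F sequentially)"
  by (simp add: cauchy_def)

text \<open>Serves for the seminorm itself and for bounded functionals, both of which are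
  1-Lipschitz for \<open>s\<close>.\<close>

lemma cauchy_convergent:
  assumes "cauchy X" "\<And>x y. x \<in> carrier A \<Longrightarrow> y \<in> carrier A \<Longrightarrow> dist (h x) (h y) \<le> s (x \<ominus> y)"
  shows "convergent (\<lambda>n. h (X n) :: 'z :: complete_space)"
proof -
  have "Cauchy (\<lambda>n. h (X n))"
    unfolding Cauchy_def
  proof (intro allI impI)
    fix e :: real assume "e > 0"
    then obtain N where "\<forall>m\<ge>N. \<forall>n\<ge>N. s (X m \<ominus> X n) < e"
      using assms(1) unfolding mem_Collect_eq[of X cauchy, symmetric] carrier_cauchy_seq_ring[symmetric]
      by (auto simp: cauchy_seq_ring_def)
    then show "\<exists>N. \<forall>m\<ge>N. \<forall>n\<ge>N. dist (h (X m)) (h (X n)) < e"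
      using assms by (meson cauchy_closed order_le_less_trans)
  qed
  then show ?thesis by (simp add: Cauchy_convergent_iff)
qed

lemma cauchy_norm_convergent: "cauchy X \<Longrightarrow> convergent (\<lambda>n. s (X n))"
  by (rule cauchy_convergent) (auto simp: dist_real_def s_abs_diff)

lemma cauchy_bounded: assumes "cauchy X" obtains B where "B \<ge> 0" "\<And>n. s (X n) \<le> B"
proof -
  have "Bseq (\<lambda>n. s (X n))"
    by (rule convergent_imp_Bseq[OF cauchy_norm_convergent[OF assms]])
  then obtain B where B: "B > 0" "\<forall>n. norm (s (X n)) \<le> B" by (rule BseqE)
  show ?thesis
    by (rule that[of B]) (use B in \<open>auto dest: spec[of _ n for n] intro: order_trans[OF abs_ge_self]\<close>)
qed

lemma cauchy_const [simp]: "a \<in> carrier A \<Longrightarrow> cauchy (\<lambda>_. a)"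
  by (rule cauchyI[of _ "\<lambda>_ _. 0"]) (auto simp: a_minus_def r_neg split_def)

lemma cauchy_add: assumes "cauchy X" "cauchy Y" shows "cauchy (\<lambda>n. X n \<oplus> Y n)"
proof (rule cauchyI)
  fix m n
  show "s ((X m \<oplus> Y m) \<ominus> (X n \<oplus> Y n)) \<le> s (X m \<ominus> X n) + s (Y m \<ominus> Y n)"
    using assms by (simp add: add_minus_swap s_triangle)
  show "((\<lambda>(m, n). s (X m \<ominus> X n) + s (Y m \<ominus> Y n)) \<longlongrightarrow> 0) (sequentially \<times>\<^sub>F sequentially)"
    using tendsto_add[OF assms[THEN cauchy_tendsto]] by (simp add: split_def)
qed (use assms in auto)

lemma cauchy_smult: assumes "cauchy X" shows "cauchy (\<lambda>n. c \<odot> X n)"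
proof (rule cauchyI)
  fix m n
  show "s (c \<odot> X m \<ominus> c \<odot> X n) \<le> cmod c * s (X m \<ominus> X n)"
    using assms by (simp add: smult_minus[symmetric] s_smult)
  show "((\<lambda>(m, n). cmod c * s (X m \<ominus> X n)) \<longlongrightarrow> 0) (sequentially \<times>\<^sub>F sequentially)"
    using tendsto_mult_right_zero[OF assms[THEN cauchy_tendsto]] by (simp add: split_def)
qed (use assms in auto)

lemma cauchy_minus: "cauchy X \<Longrightarrow> cauchy (\<lambda>n. \<ominus> X n)"
  using cauchy_smult[of X "-1"] by (simp add: minus_eq_smult)

lemma cauchy_star: assumes "cauchy X" shows "cauchy (\<lambda>n. star A (X n))"
proof (rule cauchyI)
  fix m n
  have "star A (X m) \<ominus> star A (X n) = star A (X m \<ominus> X n)"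
    using assms by (simp add: a_minus_def star_add star_minus)
  then show "s (star A (X m) \<ominus> star A (X n)) \<le> s (X m \<ominus> X n)"
    using assms by (simp add: s_star)
qed (use assms cauchy_tendsto in auto)

lemma cauchy_mult: assumes "cauchy X" "cauchy Y" shows "cauchy (\<lambda>n. X n \<otimes> Y n)"
proof -
  obtain B where B: "B \<ge> 0" "\<And>n. s (X n) \<le> B" using cauchy_bounded assms(1) by blast
  obtain C where C: "C \<ge> 0" "\<And>n. s (Y n) \<le> C" using cauchy_bounded assms(2) by blast
  show ?thesis
  proof (rule cauchyI)
    fix m n
    have "s (X m \<otimes> Y m \<ominus> X n \<otimes> Y n) \<le> s (X m) * s (Y m \<ominus> Y n) + s (X m \<ominus> X n) * s (Y n)"
      using assms by (simp add: mult_minus_split)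
        (meson add_mono cauchy_closed m_closed minus_closed order_trans s_mult s_triangle)
    also have "\<dots> \<le> B * s (Y m \<ominus> Y n) + s (X m \<ominus> X n) * C"
      using assms B C by (intro add_mono mult_mono) auto
    finally show "s (X m \<otimes> Y m \<ominus> X n \<otimes> Y n) \<le> B * s (Y m \<ominus> Y n) + s (X m \<ominus> X n) * C" .
    show "((\<lambda>(m, n). B * s (Y m \<ominus> Y n) + s (X m \<ominus> X n) * C) \<longlongrightarrow> 0) (sequentially \<times>\<^sub>F sequentially)"
      using tendsto_add[OF tendsto_mult_right_zero[OF cauchy_tendsto[OF assms(2)]]
          tendsto_mult_left_zero[OF cauchy_tendsto[OF assms(1)]]] by (simp add: split_def)
  qed (use assms in auto)
qed

section \<open>Null sequences as an ideal in the ring of Cauchy sequences\<close>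

lemma null_cauchy: assumes "null X" shows "cauchy X"
proof (rule cauchyI)
  fix m n
  show "s (X m \<ominus> X n) \<le> s (X m) + s (X n)" using assms by (simp add: s_diff)
  have "(\<lambda>n. s (X n)) \<longlonglongrightarrow> 0" using assms by simp
  then have "((\<lambda>z. s (X (fst z)) + s (X (snd z))) \<longlongrightarrow> 0 + 0) (sequentially \<times>\<^sub>F sequentially)"
    by (intro tendsto_add filterlim_compose[OF _ filterlim_fst] filterlim_compose[OF _ filterlim_snd])
  then show "((\<lambda>(m, n). s (X m) + s (X n)) \<longlongrightarrow> 0) (sequentially \<times>\<^sub>F sequentially)"
    by (simp add: split_def)
qed (use assms in auto)

lemma null_seqs_eq: "null_seqs A s = Collect null"
  unfolding null_seqs_def carrier_cauchy_seq_ring using null_cauchy by auto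

lemma nullI:
  assumes "\<And>n. X n \<in> carrier A" "\<And>n. s (X n) \<le> b n" "b \<longlonglongrightarrow> 0"
  shows "null X"
  using assms tendsto_sandwich[OF _ _ tendsto_const assms(3), of "\<lambda>n. s (X n)"] by auto

lemma null_add: "null X \<Longrightarrow> null Y \<Longrightarrow> null (\<lambda>n. X n \<oplus> Y n)"
  by (rule nullI[of _ "\<lambda>n. s (X n) + s (Y n)"])
     (auto simp: s_triangle intro: tendsto_add_zero)

lemma null_mult_left: assumes "null X" "cauchy Y" shows "null (\<lambda>n. X n \<otimes> Y n)"
proof -
  obtain B where B: "B \<ge> 0" "\<And>n. s (Y n) \<le> B" using cauchy_bounded assms(2) by blast
  have "s (X n \<otimes> Y n) \<le> s (X n) * B" for n
    using assms B by (meson cauchy_closed mult_left_mono order_trans s_mult s_nonneg)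
  then show ?thesis
    using assms by (intro nullI[of _ "\<lambda>n. s (X n) * B"]) (auto intro: tendsto_mult_left_zero)
qed

lemma null_mult_right: assumes "null X" "cauchy Y" shows "null (\<lambda>n. Y n \<otimes> X n)"
proof -
  obtain B where B: "B \<ge> 0" "\<And>n. s (Y n) \<le> B" using cauchy_bounded assms(2) by blast
  have "s (Y n \<otimes> X n) \<le> B * s (X n)" for n
    using assms B by (meson cauchy_closed mult_right_mono order_trans s_mult s_nonneg)
  then show ?thesis
    using assms by (intro nullI[of _ "\<lambda>n. B * s (X n)"]) (auto intro: tendsto_mult_right_zero)
qed

lemma ring_cauchy_seq_ring: "ring (cauchy_seq_ring A s)"
proof -
  have c: "carrier (cauchy_seq_ring A s) = Collect cauchy" by (rule carrier_cauchy_seq_ring)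
  have o: "mult (cauchy_seq_ring A s) = (\<lambda>X Y n. X n \<otimes> Y n)"
    "one (cauchy_seq_ring A s) = (\<lambda>n. \<one>)" "zero (cauchy_seq_ring A s) = (\<lambda>n. \<zero>)"
    "add (cauchy_seq_ring A s) = (\<lambda>X Y n. X n \<oplus> Y n)"
    by (auto simp: cauchy_seq_ring_def)
  show ?thesis
  proof (intro ringI abelian_groupI monoidI, unfold c o mem_Collect_eq)
    fix X assume "cauchy X"
    then show "\<exists>Y\<in>Collect cauchy. (\<lambda>n. Y n \<oplus> X n) = (\<lambda>n. \<zero>)"
      by (intro bexI[of _ "\<lambda>n. \<ominus> X n"]) (auto simp: cauchy_minus l_neg)
  qed (auto simp: cauchy_add cauchy_mult a_ac m_assoc l_distr r_distr)
qed

sublocale cs: ring "cauchy_seq_ring A s"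
  by (rule ring_cauchy_seq_ring)

lemma cauchy_seq_ring_ops:
  "mult (cauchy_seq_ring A s) = (\<lambda>X Y n. X n \<otimes> Y n)"
  "one (cauchy_seq_ring A s) = (\<lambda>n. \<one>)"
  "zero (cauchy_seq_ring A s) = (\<lambda>n. \<zero>)"
  "add (cauchy_seq_ring A s) = (\<lambda>X Y n. X n \<oplus> Y n)"
  by (auto simp: cauchy_seq_ring_def)

lemma cauchy_seq_ring_minus:
  assumes "cauchy X" shows "a_inv (cauchy_seq_ring A s) X = (\<lambda>n. \<ominus> X n)"
proof (rule cs.minus_equality)
  show "(\<lambda>n. \<ominus> X n) \<oplus>\<^bsub>cauchy_seq_ring A s\<^esub> X = \<zero>\<^bsub>cauchy_seq_ring A s\<^esub>"
    using assms by (simp add: cauchy_seq_ring_ops l_neg)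
  show "X \<in> carrier (cauchy_seq_ring A s)" using assms by (simp add: carrier_cauchy_seq_ring)
  show "(\<lambda>n. \<ominus> X n) \<in> carrier (cauchy_seq_ring A s)"
    using assms by (simp add: carrier_cauchy_seq_ring cauchy_minus)
qed

lemma ideal_null_seqs: "ideal (null_seqs A s) (cauchy_seq_ring A s)"
proof (rule idealI[OF ring_cauchy_seq_ring])
  show "subgroup (null_seqs A s) (add_monoid (cauchy_seq_ring A s))"
  proof (rule cs.add.subgroupI)
    show "null_seqs A s \<subseteq> carrier (cauchy_seq_ring A s)" by (auto simp: null_seqs_def)
    have "(\<lambda>_. \<zero>) \<in> null_seqs A s" by (simp add: null_seqs_eq)
    then show "null_seqs A s \<noteq> {}" by auto
  next
    fix X assume X: "X \<in> null_seqs A s"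
    then show "a_inv (cauchy_seq_ring A s) X \<in> null_seqs A s"
      by (simp add: null_seqs_eq cauchy_seq_ring_minus null_cauchy s_minus)
    fix Y assume "Y \<in> null_seqs A s"
    with X show "X \<oplus>\<^bsub>cauchy_seq_ring A s\<^esub> Y \<in> null_seqs A s"
      using null_add by (auto simp: null_seqs_eq cauchy_seq_ring_ops)
  qed
qed (use null_mult_left null_mult_right in \<open>auto simp: null_seqs_eq cauchy_seq_ring_ops carrier_cauchy_seq_ring\<close>)

section \<open>Classes modulo null sequences and the operations on them\<close>

lemma cls_def': "cls X = (\<lambda>Y n. Y n \<oplus> X n) ` Collect null"
  unfolding seq_class_def a_r_coset_def' null_seqs_eq cauchy_seq_ring_ops by auto

lemma mem_cls_iff: assumes "cauchy X"
  shows "Y \<in> cls X \<longleftrightarrow> (\<forall>n. Y n \<in> carrier A) \<and> (\<lambda>n. s (Y n \<ominus> X n)) \<longlonglongrightarrow> 0"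
proof
  assume "Y \<in> cls X"
  then obtain Z where "null Z" "Y = (\<lambda>n. Z n \<oplus> X n)" by (auto simp: cls_def')
  then show "(\<forall>n. Y n \<in> carrier A) \<and> (\<lambda>n. s (Y n \<ominus> X n)) \<longlonglongrightarrow> 0"
    using assms by (simp add: a_minus_def a_assoc r_neg)
next
  assume Y: "(\<forall>n. Y n \<in> carrier A) \<and> (\<lambda>n. s (Y n \<ominus> X n)) \<longlonglongrightarrow> 0"
  then have "Y = (\<lambda>n. (Y n \<ominus> X n) \<oplus> X n)"
    using assms by (auto simp: a_minus_def a_assoc l_neg)
  moreover have "null (\<lambda>n. Y n \<ominus> X n)" using assms Y by auto
  ultimately show "Y \<in> cls X" unfolding cls_def'
    by (intro image_eqI[of _ _ "\<lambda>n. Y n \<ominus> X n"]) auto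
qed

lemma self_mem_cls: "cauchy X \<Longrightarrow> X \<in> cls X"
  by (simp add: mem_cls_iff a_minus_def r_neg)

lemma cls_eqI:
  assumes "cauchy X" "Y \<in> cls X" shows "cls Y = cls X"
proof -
  interpret ns: ideal "null_seqs A s" "cauchy_seq_ring A s" by (rule ideal_null_seqs)
  show ?thesis
    unfolding seq_class_def
    by (rule ns.a_repr_independence'[symmetric])
       (use assms in \<open>auto simp: seq_class_def carrier_cauchy_seq_ring\<close>)
qed

lemma mem_cls_cauchy: assumes "cauchy X" "Y \<in> cls X" shows "cauchy Y"
proof -
  obtain Z where "null Z" "Y = (\<lambda>n. Z n \<oplus> X n)" using assms by (auto simp: cls_def')
  then show ?thesis using assms(1) cauchy_add null_cauchy by simp
qed

lemma cls_eq_iff: assumes "cauchy X" "cauchy Y"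
  shows "cls X = cls Y \<longleftrightarrow> (\<lambda>n. s (X n \<ominus> Y n)) \<longlonglongrightarrow> 0"
  using assms cls_eqI self_mem_cls mem_cls_iff by (metis cauchy_closed)

lemma carrier_completion: "carrier (completion A s) = cls ` Collect cauchy"
  unfolding completion_def Let_def FactRing_def A_RCOSETS_def' seq_class_def carrier_cauchy_seq_ring
  by auto

lemma completion_mem [simp, intro]: "cauchy X \<Longrightarrow> cls X \<in> carrier (completion A s)"
  by (simp add: carrier_completion)

lemma completionE:
  assumes "C \<in> carrier (completion A s)" obtains X where "cauchy X" "C = cls X"
  using assms by (auto simp: carrier_completion)

lemma completion_add: "cauchy X \<Longrightarrow> cauchy Y \<Longrightarrow>
    cls X \<oplus>\<^bsub>completion A s\<^esub> cls Y = cls (\<lambda>n. X n \<oplus> Y n)"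
  using ideal.a_rcos_sum[OF ideal_null_seqs, of X Y]
  by (simp add: completion_def FactRing_def seq_class_def carrier_cauchy_seq_ring cauchy_seq_ring_ops)

lemma completion_mult: "cauchy X \<Longrightarrow> cauchy Y \<Longrightarrow>
    cls X \<otimes>\<^bsub>completion A s\<^esub> cls Y = cls (\<lambda>n. X n \<otimes> Y n)"
  using ideal.rcoset_mult_add[OF ideal_null_seqs, of X Y]
  by (simp add: completion_def FactRing_def seq_class_def carrier_cauchy_seq_ring cauchy_seq_ring_ops)

lemma completion_one: "\<one>\<^bsub>completion A s\<^esub> = cls (\<lambda>_. \<one>)"
  by (simp add: completion_def FactRing_def seq_class_def cauchy_seq_ring_ops)

lemma completion_zero: "\<zero>\<^bsub>completion A s\<^esub> = cls (\<lambda>_. \<zero>)"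
  using cls_def'[of "\<lambda>_. \<zero>"] by (auto simp: completion_def FactRing_def null_seqs_eq image_iff fun_eq_iff)

text \<open>The operations of \<open>completion\<close> are unions over all representatives. Such a
  union is a single class as soon as every representative yields the same one.\<close>

lemma UN_cls:
  assumes "cauchy X" "\<And>Y. Y \<in> cls X \<Longrightarrow> D Y = E" shows "(\<Union>Y\<in>cls X. D Y) = E"
  using assms self_mem_cls by blast

lemma completion_smult: assumes "cauchy X"
  shows "c \<odot>\<^bsub>completion A s\<^esub> cls X = cls (\<lambda>n. c \<odot> X n)"
proof -
  have "(\<Union>Y\<in>cls X. cls (\<lambda>n. c \<odot> Y n)) = cls (\<lambda>n. c \<odot> X n)"
  proof (rule UN_cls[OF assms])
    fix Y assume "Y \<in> cls X"
    then have Y: "cauchy Y" "(\<lambda>n. s (Y n \<ominus> X n)) \<longlonglongrightarrow> 0"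
      using assms by (auto simp: mem_cls_iff intro: mem_cls_cauchy)
    then have "(\<lambda>n. s (c \<odot> Y n \<ominus> c \<odot> X n)) \<longlonglongrightarrow> 0"
      using assms by (simp add: smult_minus[symmetric] s_smult tendsto_mult_right_zero)
    then show "cls (\<lambda>n. c \<odot> Y n) = cls (\<lambda>n. c \<odot> X n)"
      using assms Y by (simp add: cls_eq_iff cauchy_smult)
  qed
  then show ?thesis by (simp add: completion_def Let_def)
qed

lemma completion_star: assumes "cauchy X"
  shows "star (completion A s) (cls X) = cls (\<lambda>n. star A (X n))"
proof -
  have "(\<Union>Y\<in>cls X. cls (\<lambda>n. star A (Y n))) = cls (\<lambda>n. star A (X n))"
  proof (rule UN_cls[OF assms])
    fix Y assume "Y \<in> cls X"
    then have Y: "cauchy Y" "(\<lambda>n. s (Y n \<ominus> X n)) \<longlonglongrightarrow> 0"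
      using assms by (auto simp: mem_cls_iff intro: mem_cls_cauchy)
    have "star A (Y n) \<ominus> star A (X n) = star A (Y n \<ominus> X n)" for n
      using assms Y by (simp add: a_minus_def star_add star_minus)
    then have "(\<lambda>n. s (star A (Y n) \<ominus> star A (X n))) \<longlonglongrightarrow> 0"
      using assms Y by (simp add: s_star)
    then show "cls (\<lambda>n. star A (Y n)) = cls (\<lambda>n. star A (X n))"
      using assms Y by (simp add: cls_eq_iff cauchy_star)
  qed
  then show ?thesis by (simp add: completion_def Let_def)
qed

lemma completion_nrm: assumes "cauchy X" "(\<lambda>n. s (X n)) \<longlonglongrightarrow> r"
  shows "nrm (completion A s) (cls X) = r"
proof -
  have "(THE r. \<exists>Y\<in>cls X. (\<lambda>n. s (Y n)) \<longlonglongrightarrow> r) = r"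
  proof (rule the_equality)
    show "\<exists>Y\<in>cls X. (\<lambda>n. s (Y n)) \<longlonglongrightarrow> r" using assms self_mem_cls by blast
    fix r' assume "\<exists>Y\<in>cls X. (\<lambda>n. s (Y n)) \<longlonglongrightarrow> r'"
    then obtain Y where Y: "Y \<in> cls X" "(\<lambda>n. s (Y n)) \<longlonglongrightarrow> r'" by blast
    then have Yc: "\<And>n. Y n \<in> carrier A" and Yn: "(\<lambda>n. s (Y n \<ominus> X n)) \<longlonglongrightarrow> 0"
      using assms by (auto simp: mem_cls_iff)
    have "(\<lambda>n. s (Y n) - s (X n)) \<longlonglongrightarrow> 0"
      \<comment> \<open>Seminorms of two representatives differ by at most the seminorm of their
        difference, so the limit does not depend on the representative.\<close>
      by (rule Lim_null_comparison[OF _ Yn]) (use assms Yc s_abs_diff in auto)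
    moreover have "(\<lambda>n. s (Y n) - s (X n)) \<longlonglongrightarrow> r' - r"
      using Y(2) assms(2) by (rule tendsto_diff)
    ultimately show "r' = r" using LIMSEQ_unique by fastforce
  qed
  then show ?thesis by (simp add: completion_def Let_def)
qed

lemma nrm_tendsto: "cauchy X \<Longrightarrow> (\<lambda>n. s (X n)) \<longlonglongrightarrow> nrm (completion A s) (cls X)"
  using cauchy_norm_convergent completion_nrm convergent_def by metis

lemmas completion_ops = completion_add completion_mult completion_one completion_zero
  completion_smult completion_star

lemma complex_star_algebra_completion: "complex_star_algebra (completion A s)"
proof -
  note cl = cauchy_add cauchy_mult cauchy_smult cauchy_star
  have "ring (completion A s)"
  proof (intro ringI abelian_groupI monoidI)
    fix C assume "C \<in> carrier (completion A s)"
    then obtain X where X: "cauchy X" "C = cls X" by (rule completionE)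
    have "cls (\<lambda>n. \<ominus> X n) \<oplus>\<^bsub>completion A s\<^esub> C = \<zero>\<^bsub>completion A s\<^esub>"
      using X by (simp add: completion_ops cauchy_minus l_neg)
    then show "\<exists>D\<in>carrier (completion A s). D \<oplus>\<^bsub>completion A s\<^esub> C = \<zero>\<^bsub>completion A s\<^esub>"
      using X cauchy_minus by blast
  qed (auto elim!: completionE simp: completion_ops cl a_ac m_assoc l_distr r_distr)
  then show ?thesis
    unfolding complex_star_algebra_def complex_star_algebra_axioms_def
    by (auto elim!: completionE simp: completion_ops cl smult_l_distr smult_r_distr smult_assoc
        smult_mult_left smult_mult_right star_add star_mult star_smult)
qed

lemma cstar_seminorm_completion: "cstar_seminorm (completion A s) (nrm (completion A s))"
proof -
  note cl = cauchy_add cauchy_mult cauchy_smult cauchy_star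
  have 0: "0 \<le> nrm (completion A s) (cls X)" if "cauchy X" for X
    by (rule LIMSEQ_le_const[OF nrm_tendsto]) (use that in auto)
  have 1: "nrm (completion A s) (cls (\<lambda>n. X n \<oplus> Y n)) \<le> nrm (completion A s) (cls X) + nrm (completion A s) (cls Y)"
    if "cauchy X" "cauchy Y" for X Y
    by (rule LIMSEQ_le[OF nrm_tendsto tendsto_add[OF nrm_tendsto nrm_tendsto]])
       (use that in \<open>auto simp: cl s_triangle\<close>)
  have 2: "nrm (completion A s) (cls (\<lambda>n. X n \<otimes> Y n)) \<le> nrm (completion A s) (cls X) * nrm (completion A s) (cls Y)"
    if "cauchy X" "cauchy Y" for X Y
    by (rule LIMSEQ_le[OF nrm_tendsto tendsto_mult[OF nrm_tendsto nrm_tendsto]])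
       (use that in \<open>auto simp: cl s_mult\<close>)
  have 3: "nrm (completion A s) (cls (\<lambda>n. c \<odot> X n)) = cmod c * nrm (completion A s) (cls X)" if "cauchy X" for X c
    by (rule completion_nrm)
       (use that in \<open>auto simp: cl s_smult intro!: tendsto_mult nrm_tendsto\<close>)
  have 4: "nrm (completion A s) (cls (\<lambda>n. star A (X n))) = nrm (completion A s) (cls X)" if "cauchy X" for X
    by (rule completion_nrm)
       (use that in \<open>auto simp: cl s_star intro!: nrm_tendsto\<close>)
  have 5: "nrm (completion A s) (cls (\<lambda>n. star A (X n) \<otimes> X n)) = (nrm (completion A s) (cls X))\<^sup>2" if "cauchy X" for X
    by (rule completion_nrm)
       (use that in \<open>auto simp: cl s_cstar intro!: tendsto_power nrm_tendsto\<close>)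
  show ?thesis
    unfolding cstar_seminorm_def
    by (auto elim!: completionE simp: completion_ops cl 0 1 2 3 4 5)
qed

lemma const_ring_hom: "(\<lambda>a. cls (\<lambda>_. a)) \<in> ring_hom A (completion A s)"
  by (rule ring_hom_memI) (auto simp: completion_ops)

lemma cls_const_eq_iff: "a \<in> carrier A \<Longrightarrow> b \<in> carrier A \<Longrightarrow>
    cls (\<lambda>_. a) = cls (\<lambda>_. b) \<longleftrightarrow> s (a \<ominus> b) = 0"
  by (auto simp: cls_eq_iff LIMSEQ_const_iff)

end


section \<open>Seminorms from positive functionals\<close>

text \<open>Cauchy-Schwarz for an abstract form: a, b, b', d are the coefficients of the square of x
  + c y. In this shape it applies both to functionals and to 2 by 2 minors of matrices.\<close>

lemma quadratic_nonneg:
  fixes a b b' d :: complex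
  assumes q: "\<And>c. a + c * b + cnj c * b' + c * cnj c * d \<in> \<real>\<^sub>\<ge>\<^sub>0" and d: "d \<in> \<real>\<^sub>\<ge>\<^sub>0"
  shows "b' = cnj b" and "(cmod b)\<^sup>2 \<le> Re a * Re d"
proof -
  have a: "Re a \<ge> 0" "Im a = 0" using q[of 0] by (auto simp: complex_nonneg_Reals_iff)
  have d': "Re d \<ge> 0" "Im d = 0" using d by (auto simp: complex_nonneg_Reals_iff)
  \<comment> \<open>The values at c = 1 and c = \<i> are real, which compares the imaginary and the
    real parts of b and b'.\<close>
  show b': "b' = cnj b"
    using q[of 1] q[of \<i>] a d' by (auto simp: complex_nonneg_Reals_iff complex_eq_iff)
  have r: "Re a - 2 * t * (cmod b)\<^sup>2 + t\<^sup>2 * (cmod b)\<^sup>2 * Re d \<ge> 0" for t :: real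
  proof -
    have "a + (- t * cnj b) * b + cnj (- t * cnj b) * b' + (- t * cnj b) * cnj (- t * cnj b) * d
      = a - 2 * t * (b * cnj b) + t\<^sup>2 * (b * cnj b) * d"
      unfolding b' by (simp add: algebra_simps power2_eq_square)
    also have "Re \<dots> = Re a - 2 * t * (cmod b)\<^sup>2 + t\<^sup>2 * (cmod b)\<^sup>2 * Re d"
      using d' by (simp only: complex_norm_square[symmetric]) (simp add: power2_eq_square)
    finally show ?thesis using q[of "- t * cnj b"] by (simp add: complex_nonneg_Reals_iff)
  qed
  show "(cmod b)\<^sup>2 \<le> Re a * Re d"
  proof (cases "Re d = 0")
    case True
    have "(cmod b)\<^sup>2 = 0"
    proof (rule ccontr)
      assume "(cmod b)\<^sup>2 \<noteq> 0"
      \<comment> \<open>For d = 0 the expression is affine in t, and this t makes it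
        negative.\<close>
      then have "Re a - 2 * (Re a + 1) \<ge> 0"
        using r[of "(Re a + 1) / (cmod b)\<^sup>2"] True by simp
      then show False using a by simp
    qed
    then show ?thesis using True by simp
  next
    case False
    then have "Re d > 0" using d' by simp
    \<comment> \<open>The choice t = 1 / Re d minimises the quadratic polynomial in t.\<close>
    then have "Re a - (cmod b)\<^sup>2 / Re d \<ge> 0"
      using r[of "1 / Re d"] by (simp add: power2_eq_square field_simps)
    then show ?thesis using \<open>Re d > 0\<close> by (simp add: field_simps)
  qed
qed

text \<open>A constant factor disappears under roots of growing order: otherwise
  \<open>(l / r) ^ (2 ^ k)\<close> would tend to 0 while staying above 1 / K.\<close>

lemma le_of_power_two_le:
  fixes r l K :: real
  assumes "0 \<le> l" "\<And>k. r ^ (2 ^ k) \<le> K * l ^ (2 ^ k)"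
  shows "r \<le> l"
proof (rule ccontr)
  assume "\<not> r \<le> l"
  then have r: "r > 0" "l < r" using assms(1) by auto
  have "(\<lambda>n. (l / r) ^ n) \<longlonglongrightarrow> 0"
    using r assms(1) by (intro LIMSEQ_realpow_zero) auto
  moreover have "strict_mono (\<lambda>k. 2 ^ k :: nat)" by (simp add: strict_mono_def)
  ultimately have "(\<lambda>k. (l / r) ^ (2 ^ k)) \<longlonglongrightarrow> 0"
    using LIMSEQ_subseq_LIMSEQ by (auto simp: o_def)
  then have "(\<lambda>k. K * (l / r) ^ (2 ^ k)) \<longlonglongrightarrow> 0"
    by (rule tendsto_mult_right_zero)
  moreover have "1 \<le> K * (l / r) ^ (2 ^ k)" for k
    using assms(2)[of k] r by (simp add: power_divide field_simps)
  ultimately have "(1::real) \<le> 0" by (intro LIMSEQ_le_const) auto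
  then show False by simp
qed

locale positive_functional = complex_star_algebra A
  for A :: "('a, 'x) star_algebra_scheme" (structure) and \<omega> :: "'a \<Rightarrow> complex" +
  assumes func_add: "a \<in> carrier A \<Longrightarrow> b \<in> carrier A \<Longrightarrow> \<omega> (a \<oplus> b) = \<omega> a + \<omega> b"
    and func_smult: "a \<in> carrier A \<Longrightarrow> \<omega> (c \<odot> a) = c * \<omega> a"
    and func_pos: "a \<in> carrier A \<Longrightarrow> \<omega> (star A a \<otimes> a) \<in> \<real>\<^sub>\<ge>\<^sub>0"
begin

lemma func_zero [simp]: "\<omega> \<zero> = 0"
  using func_smult[of \<zero> 0] by simp

lemma func_minus: "a \<in> carrier A \<Longrightarrow> \<omega> (\<ominus> a) = - \<omega> a"
  by (simp add: minus_eq_smult func_smult)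

lemma func_diff: "a \<in> carrier A \<Longrightarrow> b \<in> carrier A \<Longrightarrow> \<omega> (a \<ominus> b) = \<omega> a - \<omega> b"
  by (simp add: a_minus_def func_add func_minus)

lemma func_quadratic:
  assumes "x \<in> carrier A" "y \<in> carrier A"
  shows "\<omega> (star A (x \<oplus> c \<odot> y) \<otimes> (x \<oplus> c \<odot> y)) =
    \<omega> (star A x \<otimes> x) + c * \<omega> (star A x \<otimes> y) + cnj c * \<omega> (star A y \<otimes> x) + c * cnj c * \<omega> (star A y \<otimes> y)"
  using assms
  by (simp add: star_add star_smult l_distr r_distr smult_mult_left smult_mult_right func_add func_smult
      algebra_simps)

lemma hermitian:
  assumes "x \<in> carrier A" "y \<in> carrier A"
  shows "\<omega> (star A y \<otimes> x) = cnj (\<omega> (star A x \<otimes> y))"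
  by (rule quadratic_nonneg(1)[of "\<omega> (star A x \<otimes> x)" _ _ "\<omega> (star A y \<otimes> y)"])
     (use assms func_pos[of "x \<oplus> c \<odot> y" for c] func_pos in \<open>auto simp: func_quadratic\<close>)

definition sq :: "'a \<Rightarrow> real" where "sq x = Re (\<omega> (star A x \<otimes> x))"

lemma sq_nonneg [simp]: "x \<in> carrier A \<Longrightarrow> 0 \<le> sq x"
  using func_pos[of x] by (simp add: sq_def complex_nonneg_Reals_iff)

lemma func_eq_sq: "x \<in> carrier A \<Longrightarrow> \<omega> (star A x \<otimes> x) = complex_of_real (sq x)"
  using func_pos[of x] by (simp add: sq_def complex_nonneg_Reals_iff complex_eq_iff)

lemma cauchy_schwarz:
  assumes "x \<in> carrier A" "y \<in> carrier A"
  shows "(cmod (\<omega> (star A x \<otimes> y)))\<^sup>2 \<le> sq x * sq y"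
  unfolding sq_def
  by (rule quadratic_nonneg(2)[of _ _ "\<omega> (star A y \<otimes> x)"])
     (use assms func_pos[of "x \<oplus> c \<odot> y" for c] func_pos in \<open>auto simp: func_quadratic\<close>)

lemma cauchy_schwarz_sqrt:
  assumes "x \<in> carrier A" "y \<in> carrier A"
  shows "cmod (\<omega> (star A x \<otimes> y)) \<le> sqrt (sq x) * sqrt (sq y)"
  using cauchy_schwarz[OF assms] by (simp add: real_le_rsqrt real_sqrt_mult[symmetric])

lemma sq_smult: "x \<in> carrier A \<Longrightarrow> sq (c \<odot> x) = (cmod c)\<^sup>2 * sq x"
  by (simp add: sq_def star_smult smult_mult_left smult_mult_right smult_assoc func_smult
      complex_norm_square[symmetric] mult.commute[of "cnj c"] del: of_real_power)

lemma sqrt_sq_triangle: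
  assumes "x \<in> carrier A" "y \<in> carrier A"
  shows "sqrt (sq (x \<oplus> y)) \<le> sqrt (sq x) + sqrt (sq y)"
proof -
  have "sq (x \<oplus> y) = sq x + sq y + 2 * Re (\<omega> (star A x \<otimes> y))"
    using func_quadratic[of x y 1] assms hermitian[of x y] by (simp add: sq_def)
  also have "\<dots> \<le> sq x + sq y + 2 * (sqrt (sq x) * sqrt (sq y))"
    using cauchy_schwarz_sqrt[OF assms] complex_Re_le_cmod[of "\<omega> (star A x \<otimes> y)"] by linarith
  also have "\<dots> = (sqrt (sq x) + sqrt (sq y))\<^sup>2"
    using assms by (simp add: power2_sum)
  finally show ?thesis using assms by (simp add: real_le_lsqrt)
qed

end

text \<open>A crude bound \<open>L\<close> on the functional improves itself: by the Cauchy-Schwarz inequality the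
  numbers \<open>r\<^sub>k = \<omega>(y\<^sup>* d^(2^k) y) / \<omega>(y\<^sup>* y)\<close> satisfy \<open>r\<^sub>k\<^sup>2 \<le> r\<^sub>k\<^sub>+\<^sub>1\<close> for selfadjoint \<open>d\<close>,
  whence \<open>r\<^sub>0 \<le> L d\<close>.\<close>

locale dominated_functional = positive_functional A \<omega>
  for A :: "('a, 'x) star_algebra_scheme" (structure) and \<omega> :: "'a \<Rightarrow> complex" +
  fixes L :: "'a \<Rightarrow> real"
  assumes dom_nonneg: "a \<in> carrier A \<Longrightarrow> 0 \<le> L a"
    and dom_mult: "a \<in> carrier A \<Longrightarrow> b \<in> carrier A \<Longrightarrow> L (a \<otimes> b) \<le> L a * L b"
    and dom_star: "a \<in> carrier A \<Longrightarrow> L (star A a) \<le> L a"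
    and dominated: "a \<in> carrier A \<Longrightarrow> cmod (\<omega> a) \<le> L a"
begin

text \<open>The exponents start at 1, since \<open>L \<one>\<close> need not be bounded by
  1.\<close>

lemma dom_pow_Suc: "a \<in> carrier A \<Longrightarrow> L (a [^] Suc n) \<le> L a ^ Suc n"
proof (induction n)
  case (Suc n)
  have "L (a [^] Suc (Suc n)) \<le> L (a [^] Suc n) * L a"
    using dom_mult[of "a [^] Suc n" a] Suc by simp
  also have "\<dots> \<le> L a ^ Suc n * L a"
    using Suc dom_nonneg by (intro mult_right_mono) auto
  finally show ?case by (simp add: mult.commute)
qed auto

lemma func_mult_bound:
  assumes d: "d \<in> carrier A" "star A d = d" and y: "y \<in> carrier A"
  shows "Re (\<omega> (star A y \<otimes> (d \<otimes> y))) \<le> L d * sq y"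
proof -
  define e where "e k = d [^] (2 ^ k :: nat)" for k :: nat
  have e_closed: "e k \<in> carrier A" for k using d by (simp add: e_def)
  have e_Suc: "e k \<otimes> e k = e (Suc k)" for k
    using d by (simp add: e_def nat_pow_mult mult_2)
  have e_star: "star A (e k) = e k" for k
  proof (induction k)
    case (Suc k)
    then show ?case using e_closed by (simp add: e_Suc[symmetric] star_mult)
  qed (use d in \<open>simp add: e_def\<close>)
  have e_L: "L (e k) \<le> L d ^ (2 ^ k)" for k
    using dom_pow_Suc[of d "2 ^ k - 1"] d by (simp add: e_def)
  define m where "m k = Re (\<omega> (star A y \<otimes> (e k \<otimes> y)))" for k
  have step: "(m k)\<^sup>2 \<le> sq y * m (Suc k)" for k
  proof -
    have "(m k)\<^sup>2 \<le> (cmod (\<omega> (star A y \<otimes> (e k \<otimes> y))))\<^sup>2"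
      unfolding m_def using abs_Re_le_cmod by (metis abs_ge_zero power2_abs power_mono)
    also have "\<dots> \<le> sq y * sq (e k \<otimes> y)"
      using y e_closed by (intro cauchy_schwarz) auto
    also have "sq (e k \<otimes> y) = m (Suc k)"
      using y e_closed by (simp add: sq_def m_def star_mult e_star e_Suc[symmetric] m_assoc)
    finally show ?thesis .
  qed
  \<comment> \<open>The factor \<open>(L y)\<^sup>2\<close> does not depend on k, so
    \<open>le_of_power_two_le\<close> removes it.\<close>
  have bound: "m k \<le> (L y)\<^sup>2 * L d ^ (2 ^ k)" for k
  proof -
    have "m k \<le> L (star A y \<otimes> (e k \<otimes> y))"
      unfolding m_def using complex_Re_le_cmod dominated y e_closed
      by (meson m_closed order_trans star_closed)
    also have "\<dots> \<le> L (star A y) * L (e k \<otimes> y)"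
      using y e_closed by (intro dom_mult) auto
    also have "\<dots> \<le> L y * (L (e k) * L y)"
      using y e_closed by (intro mult_mono dom_mult dom_star dom_nonneg) auto
    also have "\<dots> \<le> L y * (L d ^ (2 ^ k) * L y)"
      using y e_closed e_L by (intro mult_left_mono mult_right_mono dom_nonneg) auto
    finally show ?thesis by (simp add: power2_eq_square mult_ac)
  qed
  have m0: "m 0 = Re (\<omega> (star A y \<otimes> (d \<otimes> y)))" using d by (simp add: m_def e_def)
  show ?thesis
  proof (cases "sq y = 0")
    case True
    then show ?thesis using step[of 0] m0 by simp
  next
    case False
    then have N: "sq y > 0" using sq_nonneg[OF y] by linarith
    have "m 0 / sq y \<le> L d"
    \<comment> \<open>The sign is separated because the induction squares an inequality with left
      side a power of \<open>m 0 / sq y\<close>.\<close>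
    proof (cases "m 0 \<le> 0")
      case True
      then show ?thesis using N d dom_nonneg by (meson divide_nonpos_pos order_trans)
    next
      case False
      have r: "(m 0 / sq y) ^ (2 ^ k) \<le> m k / sq y" for k
      proof (induction k)
        case (Suc k)
        have "(m 0 / sq y) ^ (2 ^ Suc k) = ((m 0 / sq y) ^ (2 ^ k))\<^sup>2"
          by (simp add: power_mult[symmetric] mult.commute)
        also have "\<dots> \<le> (m k / sq y)\<^sup>2"
          using Suc False N by (intro power_mono) auto
        also have "\<dots> = (m k)\<^sup>2 / (sq y * sq y)" by (simp add: power2_eq_square)
        also have "\<dots> \<le> sq y * m (Suc k) / (sq y * sq y)"
          using step N by (intro divide_right_mono) auto
        also have "\<dots> = m (Suc k) / sq y" using N by simp
        finally show ?case .
      qed simp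
      show ?thesis
      proof (rule le_of_power_two_le)
        fix k
        show "(m 0 / sq y) ^ (2 ^ k) \<le> ((L y)\<^sup>2 / sq y) * L d ^ (2 ^ k)"
          using r[of k] divide_right_mono[OF bound[of k], of "sq y"] N by simp
      qed (use d dom_nonneg in auto)
    qed
    then show ?thesis using N m0 by (simp add: field_simps)
  qed
qed

text \<open>The selfadjoint case applied to \<open>star A t \<otimes> t\<close>: left multiplication
  by t is bounded on the GNS space by \<open>L t\<close>.\<close>

lemma sq_mult_bound:
  assumes "t \<in> carrier A" "y \<in> carrier A"
  shows "sq (t \<otimes> y) \<le> (L t)\<^sup>2 * sq y"
proof -
  have "sq (t \<otimes> y) \<le> L (star A t \<otimes> t) * sq y"
    using func_mult_bound[of "star A t \<otimes> t" y] assms by (simp add: sq_def star_mult m_assoc)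
  also have "\<dots> \<le> (L t)\<^sup>2 * sq y"
    unfolding power2_eq_square using assms
    by (intro mult_right_mono order_trans[OF dom_mult] dom_star dom_nonneg) auto
  finally show ?thesis .
qed

end

text \<open>The operator seminorm of the direct sum of the GNS representations of the functionals in
  \<Omega>. The common bound \<open>L\<close> makes the supremum finite and a normalized functional
  makes the set nonempty. Two instances follow: the products of states, giving the spatial seminorm,
  and the single functional \<open>lin vec\<close>.\<close>

locale functional_family = complex_star_algebra A
  for A :: "('a, 'x) star_algebra_scheme" (structure) +
  fixes \<Omega> :: "('a \<Rightarrow> complex) set" and L :: "'a \<Rightarrow> real"
  assumes dominated_family: "\<omega> \<in> \<Omega> \<Longrightarrow> dominated_functional A \<omega> L"
    and normalized: "\<exists>\<omega>\<in>\<Omega>. \<omega> \<one> = 1"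
begin

definition gns_seminorm :: "'a \<Rightarrow> real" where
  "gns_seminorm t = sqrt (Sup {Re (\<omega> (star A (t \<otimes> y) \<otimes> (t \<otimes> y))) |\<omega> y.
     \<omega> \<in> \<Omega> \<and> y \<in> carrier A \<and> \<omega> (star A y \<otimes> y) = 1})"

text \<open>The length of the vector that x represents in the GNS space of \<omega>.\<close>

abbreviation len :: "('a \<Rightarrow> complex) \<Rightarrow> 'a \<Rightarrow> real" where
  "len \<omega> x \<equiv> sqrt (Re (\<omega> (star A x \<otimes> x)))"

lemma pos: "\<omega> \<in> \<Omega> \<Longrightarrow> positive_functional A \<omega>"
  using dominated_family dominated_functional.axioms(1) by blast

lemma
  assumes "\<omega> \<in> \<Omega>"
  shows len_nonneg: "x \<in> carrier A \<Longrightarrow> 0 \<le> len \<omega> x"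
    and len_triangle: "x \<in> carrier A \<Longrightarrow> y \<in> carrier A \<Longrightarrow> len \<omega> (x \<oplus> y) \<le> len \<omega> x + len \<omega> y"
    and len_smult: "x \<in> carrier A \<Longrightarrow> len \<omega> (c \<odot> x) = cmod c * len \<omega> x"
    and len_bound: "t \<in> carrier A \<Longrightarrow> y \<in> carrier A \<Longrightarrow> len \<omega> (t \<otimes> y) \<le> L t * len \<omega> y"
    and len_cauchy_schwarz: "x \<in> carrier A \<Longrightarrow> y \<in> carrier A \<Longrightarrow> cmod (\<omega> (star A x \<otimes> y)) \<le> len \<omega> x * len \<omega> y"
proof -
  interpret dominated_functional A \<omega> L using assms by (rule dominated_family)
  show "0 \<le> len \<omega> x" if "x \<in> carrier A" using that by (simp add: sq_def[symmetric])
  show "len \<omega> (x \<oplus> y) \<le> len \<omega> x + len \<omega> y" if "x \<in> carrier A" "y \<in> carrier A"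
    using sqrt_sq_triangle that by (simp add: sq_def)
  show "len \<omega> (c \<odot> x) = cmod c * len \<omega> x" if "x \<in> carrier A"
    using sq_smult[OF that, of c] by (simp add: sq_def real_sqrt_mult)
  show "len \<omega> (t \<otimes> y) \<le> L t * len \<omega> y" if "t \<in> carrier A" "y \<in> carrier A"
    using real_sqrt_le_mono[OF sq_mult_bound[OF that]] dom_nonneg[of t] that
    by (simp add: sq_def real_sqrt_mult)
  show "cmod (\<omega> (star A x \<otimes> y)) \<le> len \<omega> x * len \<omega> y" if "x \<in> carrier A" "y \<in> carrier A"
    using cauchy_schwarz_sqrt that by (simp add: sq_def)
qed

lemma func_eq_len: "\<omega> \<in> \<Omega> \<Longrightarrow> x \<in> carrier A \<Longrightarrow> \<omega> (star A x \<otimes> x) = complex_of_real ((len \<omega> x)\<^sup>2)"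
  using positive_functional.func_eq_sq[OF pos] positive_functional.sq_nonneg[OF pos]
  by (simp add: positive_functional.sq_def[OF pos])

lemma len_power2: "\<omega> \<in> \<Omega> \<Longrightarrow> x \<in> carrier A \<Longrightarrow> (len \<omega> x)\<^sup>2 = Re (\<omega> (star A x \<otimes> x))"
  using positive_functional.sq_nonneg[OF pos] by (simp add: positive_functional.sq_def[OF pos])

lemma unit_iff:
  assumes "\<omega> \<in> \<Omega>" "y \<in> carrier A" shows "\<omega> (star A y \<otimes> y) = 1 \<longleftrightarrow> len \<omega> y = 1"
proof -
  have "\<omega> (star A y \<otimes> y) = 1 \<longleftrightarrow> (len \<omega> y)\<^sup>2 = 1"
    by (rule trans[OF arg_cong[OF func_eq_len[OF assms], of "\<lambda>z. z = 1"] of_real_eq_1_iff])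
  also have "\<dots> \<longleftrightarrow> len \<omega> y = 1"
    using len_nonneg[OF assms] unfolding power2_eq_1_iff by linarith
  finally show ?thesis .
qed

lemma dom_nonneg: "t \<in> carrier A \<Longrightarrow> 0 \<le> L t"
  using normalized dominated_functional.dom_nonneg[OF dominated_family] by blast

lemma gns_set_eq:
  "{Re (\<omega> (star A (t \<otimes> y) \<otimes> (t \<otimes> y))) |\<omega> y.
     \<omega> \<in> \<Omega> \<and> y \<in> carrier A \<and> \<omega> (star A y \<otimes> y) = 1} =
   {(len \<omega> (t \<otimes> y))\<^sup>2 |\<omega> y. \<omega> \<in> \<Omega> \<and> y \<in> carrier A \<and> len \<omega> y = 1}" if "t \<in> carrier A"
proof -
  have eq: "(r = Re (\<omega> (star A (t \<otimes> y) \<otimes> (t \<otimes> y))) \<and> \<omega> \<in> \<Omega> \<and> y \<in> carrier A \<and> \<omega> (star A y \<otimes> y) = 1) \<longleftrightarrow>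
     (r = (len \<omega> (t \<otimes> y))\<^sup>2 \<and> \<omega> \<in> \<Omega> \<and> y \<in> carrier A \<and> len \<omega> y = 1)" for r \<omega> y
  proof (cases "\<omega> \<in> \<Omega> \<and> y \<in> carrier A")
    case True
    then have e: "Re (\<omega> (star A (t \<otimes> y) \<otimes> (t \<otimes> y))) = (len \<omega> (t \<otimes> y))\<^sup>2"
      using len_power2[symmetric] that by blast
    have u: "\<omega> (star A y \<otimes> y) = 1 \<longleftrightarrow> len \<omega> y = 1" using True unit_iff by blast
    show ?thesis
      by (intro arg_cong2[where f = "(\<and>)"] arg_cong[OF e, of "(=) r"] u refl)
  qed blast
  show ?thesis by (intro Collect_cong ex_cong1 eq)
qed

lemma len_le_gns_unit:
  assumes "\<omega> \<in> \<Omega>" "t \<in> carrier A" "y \<in> carrier A" "len \<omega> y = 1"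
  shows "len \<omega> (t \<otimes> y) \<le> gns_seminorm t"
proof -
  let ?S = "{(len \<omega> (t \<otimes> y))\<^sup>2 |\<omega> y. \<omega> \<in> \<Omega> \<and> y \<in> carrier A \<and> len \<omega> y = 1}"
  have "bdd_above ?S"
  proof (rule bdd_aboveI[of _ "(L t)\<^sup>2"])
    fix r assume "r \<in> ?S"
    then obtain \<omega> y where "r = (len \<omega> (t \<otimes> y))\<^sup>2" "\<omega> \<in> \<Omega>" "y \<in> carrier A" "len \<omega> y = 1" by blast
    moreover have "len \<omega> (t \<otimes> y) \<le> L t"
      using calculation len_bound[of \<omega> t y] assms(2) by (simp del: real_sqrt_le_iff)
    ultimately show "r \<le> (L t)\<^sup>2"
      using len_nonneg[of \<omega> "t \<otimes> y"] assms(2) by (metis m_closed power_mono)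
  qed
  moreover have "(len \<omega> (t \<otimes> y))\<^sup>2 \<in> ?S" using assms by blast
  ultimately have "(len \<omega> (t \<otimes> y))\<^sup>2 \<le> Sup ?S" by (rule cSup_upper[rotated])
  then show ?thesis
    unfolding gns_seminorm_def gns_set_eq[OF assms(2)] by (rule real_le_rsqrt)
qed

lemma gns_least:
  assumes "t \<in> carrier A" "0 \<le> c"
    and "\<And>\<omega> y. \<omega> \<in> \<Omega> \<Longrightarrow> y \<in> carrier A \<Longrightarrow> len \<omega> y = 1 \<Longrightarrow> len \<omega> (t \<otimes> y) \<le> c"
  shows "gns_seminorm t \<le> c"
proof -
  let ?S = "{(len \<omega> (t \<otimes> y))\<^sup>2 |\<omega> y. \<omega> \<in> \<Omega> \<and> y \<in> carrier A \<and> len \<omega> y = 1}"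
  obtain \<omega> where w: "\<omega> \<in> \<Omega>" "\<omega> \<one> = 1" using normalized by blast
  then have "len \<omega> \<one> = 1" using unit_iff[of \<omega> \<one>] by simp
  with w(1) have "(len \<omega> (t \<otimes> \<one>))\<^sup>2 \<in> ?S" by blast
  then have "?S \<noteq> {}" by blast
  moreover have "r \<le> c\<^sup>2" if r: "r \<in> ?S" for r
  proof -
    obtain \<omega> y where "r = (len \<omega> (t \<otimes> y))\<^sup>2" "\<omega> \<in> \<Omega>" "y \<in> carrier A" "len \<omega> y = 1"
      using r by blast
    then show ?thesis
      using assms(3)[of \<omega> y] len_nonneg[of \<omega> "t \<otimes> y"] assms(1) by (metis m_closed power_mono)
  qed
  ultimately have "Sup ?S \<le> c\<^sup>2" by (rule cSup_least)
  then show ?thesis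
    unfolding gns_seminorm_def gns_set_eq[OF assms(1)] using assms(2) by (intro real_le_lsqrt)
qed

lemma gns_nonneg: assumes "t \<in> carrier A" shows "0 \<le> gns_seminorm t"
proof -
  obtain \<omega> where w: "\<omega> \<in> \<Omega>" "\<omega> \<one> = 1" using normalized by blast
  then have "len \<omega> \<one> = 1" using unit_iff[of \<omega> \<one>] by simp
  then show ?thesis
    using len_le_gns_unit[of \<omega> t \<one>] len_nonneg[of \<omega> "t \<otimes> \<one>"] w assms
    by (meson m_closed one_closed order_trans)
qed

text \<open>A vector of nonzero length is rescaled to length one. A null vector cannot be rescaled;
  there the bound by \<open>L\<close> shows that its image is null too.\<close>

lemma len_le_gns:
  assumes w: "\<omega> \<in> \<Omega>" and t: "t \<in> carrier A" and y: "y \<in> carrier A"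
  shows "len \<omega> (t \<otimes> y) \<le> gns_seminorm t * len \<omega> y"
proof (cases "len \<omega> y = 0")
  case True
  then show ?thesis using len_bound[OF w t y] by simp
next
  case False
  define c where "c = complex_of_real (1 / len \<omega> y)"
  have p: "len \<omega> y > 0" using False len_nonneg[OF w y] by simp
  then have c: "cmod c = 1 / len \<omega> y" by (simp add: c_def del: of_real_divide)
  have "len \<omega> (t \<otimes> (c \<odot> y)) \<le> gns_seminorm t"
    by (rule len_le_gns_unit[OF w t]) (use y p c w in \<open>auto simp: len_smult simp del: real_sqrt_eq_1_iff\<close>)
  moreover have "len \<omega> (t \<otimes> (c \<odot> y)) = len \<omega> (t \<otimes> y) / len \<omega> y"
    using t y w c len_smult[OF w, of "t \<otimes> y" c] by (simp add: smult_mult_right)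
  ultimately show ?thesis using p by (simp add: pos_divide_le_eq)
qed

lemma gns_le_dom: "t \<in> carrier A \<Longrightarrow> gns_seminorm t \<le> L t"
  by (rule gns_least) (use len_bound dom_nonneg in fastforce)+

lemma cstar_seminorm_gns: "cstar_seminorm A gns_seminorm"
proof (rule cstar_seminormI)
  note nn = gns_nonneg
  show "0 \<le> gns_seminorm a" if "a \<in> carrier A" for a using that by (rule nn)
  show "gns_seminorm (a \<oplus> b) \<le> gns_seminorm a + gns_seminorm b" if "a \<in> carrier A" "b \<in> carrier A" for a b
  proof (rule gns_least)
    fix \<omega> y assume w: "\<omega> \<in> \<Omega>" and y: "y \<in> carrier A" "len \<omega> y = 1"
    have "len \<omega> ((a \<oplus> b) \<otimes> y) \<le> len \<omega> (a \<otimes> y) + len \<omega> (b \<otimes> y)"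
      using that y w by (simp add: l_distr len_triangle)
    also have "\<dots> \<le> gns_seminorm a + gns_seminorm b"
      using that y w by (intro add_mono len_le_gns_unit) auto
    finally show "len \<omega> ((a \<oplus> b) \<otimes> y) \<le> gns_seminorm a + gns_seminorm b" .
  qed (use that nn in auto)
  show "gns_seminorm (c \<odot> a) \<le> cmod c * gns_seminorm a" if "a \<in> carrier A" for a c
  proof (rule gns_least)
    fix \<omega> y assume w: "\<omega> \<in> \<Omega>" and y: "y \<in> carrier A" "len \<omega> y = 1"
    have "len \<omega> (c \<odot> a \<otimes> y) = cmod c * len \<omega> (a \<otimes> y)"
      using that y w len_smult[of \<omega> "a \<otimes> y" c] by (simp add: smult_mult_left)
    also have "\<dots> \<le> cmod c * gns_seminorm a"
      using that y w by (intro mult_left_mono len_le_gns_unit) auto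
    finally show "len \<omega> (c \<odot> a \<otimes> y) \<le> cmod c * gns_seminorm a" .
  qed (use that nn in auto)
  show "gns_seminorm (a \<otimes> b) \<le> gns_seminorm a * gns_seminorm b" if "a \<in> carrier A" "b \<in> carrier A" for a b
  proof (rule gns_least)
    fix \<omega> y assume w: "\<omega> \<in> \<Omega>" and y: "y \<in> carrier A" "len \<omega> y = 1"
    have "len \<omega> (a \<otimes> b \<otimes> y) \<le> gns_seminorm a * len \<omega> (b \<otimes> y)"
      using that y w len_le_gns[of \<omega> a "b \<otimes> y"] by (simp add: m_assoc)
    also have "\<dots> \<le> gns_seminorm a * gns_seminorm b"
      using that y w nn by (intro mult_left_mono len_le_gns_unit) auto
    finally show "len \<omega> (a \<otimes> b \<otimes> y) \<le> gns_seminorm a * gns_seminorm b" .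
  qed (use that nn in auto)
  show "(gns_seminorm a)\<^sup>2 \<le> gns_seminorm (star A a \<otimes> a)" if a: "a \<in> carrier A" for a
  proof -
    \<comment> \<open>The squared length of a y is the inner product of y with
      \<open>star A a \<otimes> a\<close> applied to y, to which Cauchy-Schwarz applies.\<close>
    have "gns_seminorm a \<le> sqrt (gns_seminorm (star A a \<otimes> a))"
    proof (rule gns_least)
      fix \<omega> y assume w: "\<omega> \<in> \<Omega>" and y: "y \<in> carrier A" "len \<omega> y = 1"
      have "(len \<omega> (a \<otimes> y))\<^sup>2 = Re (\<omega> (star A (a \<otimes> y) \<otimes> (a \<otimes> y)))"
        using a y by (intro len_power2[OF w]) auto
      also have "\<dots> = Re (\<omega> (star A y \<otimes> (star A a \<otimes> a \<otimes> y)))"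
        using a y by (simp add: star_mult m_assoc)
      also have "\<dots> \<le> cmod (\<omega> (star A y \<otimes> (star A a \<otimes> a \<otimes> y)))" by (rule complex_Re_le_cmod)
      also have "\<dots> \<le> len \<omega> y * len \<omega> (star A a \<otimes> a \<otimes> y)"
        using a y w by (intro len_cauchy_schwarz) auto
      also have "\<dots> \<le> gns_seminorm (star A a \<otimes> a)"
        using a y w len_le_gns_unit[of \<omega> "star A a \<otimes> a" y] by simp
      finally show "len \<omega> (a \<otimes> y) \<le> sqrt (gns_seminorm (star A a \<otimes> a))" by (rule real_le_rsqrt)
    qed (use a nn in auto)
    then have "(gns_seminorm a)\<^sup>2 \<le> (sqrt (gns_seminorm (star A a \<otimes> a)))\<^sup>2"
      using nn a by (intro power_mono) auto
    then show ?thesis using nn a by simp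
  qed
qed

text \<open>A normalized functional is the matrix coefficient of the cyclic vector
  \<open>\<one>\<close>, which has length one.\<close>

lemma func_le_gns:
  assumes "\<omega> \<in> \<Omega>" "\<omega> \<one> = 1" "t \<in> carrier A"
  shows "cmod (\<omega> t) \<le> gns_seminorm t"
proof -
  have 1: "len \<omega> \<one> = 1" using assms unit_iff[of \<omega> \<one>] by simp
  have "cmod (\<omega> t) \<le> len \<omega> \<one> * len \<omega> t"
    using len_cauchy_schwarz[of \<omega> \<one> t] assms by simp
  also have "\<dots> \<le> gns_seminorm t"
    using len_le_gns_unit[of \<omega> t \<one>] assms 1 by simp
  finally show ?thesis .
qed

text \<open>All matrix coefficients of t vanish. This is the test by which bilinearity relations and
  relators are shown to disappear.\<close>

lemma gns_zeroI:
  assumes "t \<in> carrier A"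
    and "\<And>\<omega> y z. \<omega> \<in> \<Omega> \<Longrightarrow> y \<in> carrier A \<Longrightarrow> z \<in> carrier A \<Longrightarrow> \<omega> (z \<otimes> t \<otimes> y) = 0"
  shows "gns_seminorm t = 0"
proof -
  have "gns_seminorm t \<le> 0"
  proof (rule gns_least)
    fix \<omega> y assume w: "\<omega> \<in> \<Omega>" and y: "y \<in> carrier A" "len \<omega> y = 1"
    have "\<omega> (star A (t \<otimes> y) \<otimes> (t \<otimes> y)) = 0"
      using assms(2)[OF w, of y "star A (t \<otimes> y)"] assms(1) y by (simp add: m_assoc)
    then show "len \<omega> (t \<otimes> y) \<le> 0" by simp
  qed (use assms in auto)
  then show ?thesis using gns_nonneg[OF assms(1)] by simp
qed

lemma seminormed_gns: "seminormed_star_algebra A gns_seminorm"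
  by unfold_locales (rule cstar_seminorm_gns)

end


section \<open>The star algebra of a monoid with involution\<close>

text \<open>The linear extension of f from the monoid to its algebra. Identities between algebra
  elements are checked on all these functionals (\<open>alg_ext\<close>), which turns convolutions
  into iterated sums (\<open>lin_mult\<close>).\<close>

definition lin :: "('m \<Rightarrow> complex) \<Rightarrow> ('m \<Rightarrow> complex) \<Rightarrow> complex" where
  "lin f p = (\<Sum>m | p m \<noteq> 0. p m * f m)"

text \<open>A weighted l1-norm. It is the crude bound \<open>L\<close> from which the GNS machinery
  starts.\<close>

definition lin_abs :: "('m \<Rightarrow> real) \<Rightarrow> ('m \<Rightarrow> complex) \<Rightarrow> real" where
  "lin_abs N p = (\<Sum>m | p m \<noteq> 0. cmod (p m) * N m)"

lemma lin_superset:
  assumes "finite S" "{m. p m \<noteq> 0} \<subseteq> S" shows "lin f p = (\<Sum>m\<in>S. p m * f m)"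
  unfolding lin_def by (rule sum.mono_neutral_left) (use assms in auto)

lemma lin_abs_superset:
  assumes "finite S" "{m. p m \<noteq> 0} \<subseteq> S" shows "lin_abs N p = (\<Sum>m\<in>S. cmod (p m) * N m)"
  unfolding lin_abs_def by (rule sum.mono_neutral_left) (use assms in auto)

lemma lin_monomial [simp]: "lin f (monomial x) = f x"
  by (subst lin_superset[of "{x}"]) (auto simp: monomial_def split: if_splits)

lemma lin_abs_monomial [simp]: "lin_abs N (monomial x) = N x"
  by (subst lin_abs_superset[of "{x}"]) (auto simp: monomial_def split: if_splits)

lemma lin_zero [simp]: "lin f (\<lambda>_. 0) = 0"
  by (simp add: lin_def)

lemma lin_plus:
  assumes "finite {m. p m \<noteq> 0}" "finite {m. q m \<noteq> 0}"
  shows "lin f (\<lambda>m. p m + q m) = lin f p + lin f q"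
proof -
  let ?S = "{m. p m \<noteq> 0} \<union> {m. q m \<noteq> 0}"
  have "finite ?S" using assms by simp
  then have "lin f (\<lambda>m. p m + q m) = (\<Sum>m\<in>?S. (p m + q m) * f m)"
    "lin f p = (\<Sum>m\<in>?S. p m * f m)" "lin f q = (\<Sum>m\<in>?S. q m * f m)"
    by (auto intro!: lin_superset)
  then show ?thesis by (simp add: distrib_right sum.distrib)
qed

lemma lin_scale: "lin f (\<lambda>m. c * p m) = c * lin f p"
  by (cases "c = 0") (simp_all add: lin_def sum_distrib_left mult.assoc)

lemma lin_fun_add: "lin (\<lambda>m. f m + g m) p = lin f p + lin g p"
  by (simp add: lin_def distrib_left sum.distrib)

lemma lin_fun_scale: "lin (\<lambda>m. c * f m) p = c * lin f p"
  by (simp add: lin_def sum_distrib_left mult.left_commute)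

lemma lin_fun_zero [simp]: "lin (\<lambda>m. 0) p = 0"
  by (simp add: lin_def)

text \<open>The indicator functions of points already separate.\<close>

lemma lin_ext:
  assumes "finite {m. p m \<noteq> 0}" "finite {m. q m \<noteq> 0}" "\<And>f. lin f p = lin f q"
  shows "p = q"
proof
  fix x
  have "lin (\<lambda>m. if m = x then 1 else 0) p = p x" if "finite {m. p m \<noteq> 0}" for p :: "'a \<Rightarrow> complex"
    using that by (simp add: lin_def if_distrib[of "(*) _"] sum.delta cong: if_cong)
  then show "p x = q x" using assms by metis
qed

lemma cmod_lin_le:
  assumes "\<And>m. p m \<noteq> 0 \<Longrightarrow> cmod (f m) \<le> N m" shows "cmod (lin f p) \<le> lin_abs N p"
  unfolding lin_def lin_abs_def
  by (rule order_trans[OF norm_sum sum_mono]) (use assms in \<open>auto simp: norm_mult intro: mult_left_mono\<close>)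

locale star_monoid = monoid M for M :: "('m, 'x) monoid_scheme" (structure) +
  fixes adj :: "'m \<Rightarrow> 'm"
  assumes adj_closed [simp, intro]: "x \<in> carrier M \<Longrightarrow> adj x \<in> carrier M"
    and adj_mult: "x \<in> carrier M \<Longrightarrow> y \<in> carrier M \<Longrightarrow> adj (x \<otimes> y) = adj y \<otimes> adj x"
    and adj_adj [simp]: "x \<in> carrier M \<Longrightarrow> adj (adj x) = x"
begin

abbreviation (input) alg :: "('m \<Rightarrow> complex) star_algebra" where
  "alg \<equiv> monoid_star_algebra M adj"

lemma alg_carrier_iff: "p \<in> carrier alg \<longleftrightarrow> finite {m. p m \<noteq> 0} \<and> {m. p m \<noteq> 0} \<subseteq> carrier M"
  by (simp add: monoid_star_algebra_def)

lemma alg_finite: "p \<in> carrier alg \<Longrightarrow> finite {m. p m \<noteq> 0}"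
  and alg_support: "p \<in> carrier alg \<Longrightarrow> p m \<noteq> 0 \<Longrightarrow> m \<in> carrier M"
  by (auto simp: alg_carrier_iff)

lemma lin_cong:
  "p \<in> carrier alg \<Longrightarrow> (\<And>x. x \<in> carrier M \<Longrightarrow> f x = g x) \<Longrightarrow> lin f p = lin g p"
  unfolding lin_def by (rule sum.cong) (auto dest: alg_support)

lemma alg_ext:
  "p \<in> carrier alg \<Longrightarrow> q \<in> carrier alg \<Longrightarrow> (\<And>f. lin f p = lin f q) \<Longrightarrow> p = q"
  by (rule lin_ext) (auto dest: alg_finite)

lemma alg_mult_apply:
  "(p \<otimes>\<^bsub>alg\<^esub> q) m = (\<Sum>z\<in>{z \<in> {x. p x \<noteq> 0} \<times> {y. q y \<noteq> 0}. fst z \<otimes> snd z = m}. p (fst z) * q (snd z))"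
  unfolding monoid_star_algebra_def by (simp add: split_def) (rule sum.cong, auto)

lemma alg_mult_support:
  "{m. (p \<otimes>\<^bsub>alg\<^esub> q) m \<noteq> 0} \<subseteq> (\<lambda>z. fst z \<otimes> snd z) ` ({x. p x \<noteq> 0} \<times> {y. q y \<noteq> 0})"
proof
  fix m assume "m \<in> {m. (p \<otimes>\<^bsub>alg\<^esub> q) m \<noteq> 0}"
  then have "{z \<in> {x. p x \<noteq> 0} \<times> {y. q y \<noteq> 0}. fst z \<otimes> snd z = m} \<noteq> {}"
    unfolding mem_Collect_eq alg_mult_apply by (metis sum.empty)
  then show "m \<in> (\<lambda>z. fst z \<otimes> snd z) ` ({x. p x \<noteq> 0} \<times> {y. q y \<noteq> 0})" by blast
qed

lemma alg_mult_closed: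
  assumes "p \<in> carrier alg" "q \<in> carrier alg" shows "p \<otimes>\<^bsub>alg\<^esub> q \<in> carrier alg"
proof -
  let ?I = "(\<lambda>z. fst z \<otimes> snd z) ` ({x. p x \<noteq> 0} \<times> {y. q y \<noteq> 0})"
  have "finite ?I" using assms by (intro finite_imageI finite_cartesian_product alg_finite)
  moreover have "?I \<subseteq> carrier M" using assms[THEN alg_support] by auto
  ultimately show ?thesis
    unfolding alg_carrier_iff using alg_mult_support[of p q] by (meson finite_subset subset_trans)
qed

text \<open>The product pairs are grouped by their product in the monoid; regrouping turns the
  convolution into a double sum over the supports.\<close>

lemma lin_mult:
  assumes "p \<in> carrier alg" "q \<in> carrier alg"
  shows "lin f (p \<otimes>\<^bsub>alg\<^esub> q) = lin (\<lambda>x. lin (\<lambda>y. f (x \<otimes> y)) q) p"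
proof -
  let ?P = "{x. p x \<noteq> 0} \<times> {y. q y \<noteq> 0}" and ?g = "\<lambda>z. fst z \<otimes> snd z"
  have fin: "finite ?P" using assms by (simp add: alg_finite)
  have "lin f (p \<otimes>\<^bsub>alg\<^esub> q) = (\<Sum>m\<in>?g ` ?P. (p \<otimes>\<^bsub>alg\<^esub> q) m * f m)"
    using fin alg_mult_support[of p q] by (intro lin_superset) auto
  also have "\<dots> = (\<Sum>m\<in>?g ` ?P. \<Sum>z\<in>{z\<in>?P. ?g z = m}. p (fst z) * q (snd z) * f (?g z))"
    unfolding alg_mult_apply sum_distrib_right by (intro sum.cong) auto
  also have "\<dots> = (\<Sum>z\<in>?P. p (fst z) * q (snd z) * f (?g z))"
    using fin by (rule sum.image_gen[symmetric])
  also have "\<dots> = lin (\<lambda>x. lin (\<lambda>y. f (x \<otimes> y)) q) p"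
    unfolding lin_def sum.cartesian_product' by (simp add: sum_distrib_left mult.assoc)
  finally show ?thesis .
qed

lemma lin_abs_mult:
  assumes "p \<in> carrier alg" "q \<in> carrier alg"
    and N: "\<And>x y. x \<in> carrier M \<Longrightarrow> y \<in> carrier M \<Longrightarrow> N (x \<otimes> y) \<le> N x * N y"
      "\<And>x. x \<in> carrier M \<Longrightarrow> 0 \<le> N x"
  shows "lin_abs N (p \<otimes>\<^bsub>alg\<^esub> q) \<le> lin_abs N p * lin_abs N q"
proof -
  let ?P = "{x. p x \<noteq> 0} \<times> {y. q y \<noteq> 0}" and ?g = "\<lambda>z. fst z \<otimes> snd z"
  have fin: "finite ?P" using assms by (simp add: alg_finite)
  have c: "z \<in> ?P \<Longrightarrow> fst z \<in> carrier M \<and> snd z \<in> carrier M" for z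
    using assms alg_support by auto
  have "lin_abs N (p \<otimes>\<^bsub>alg\<^esub> q) = (\<Sum>m\<in>?g ` ?P. cmod ((p \<otimes>\<^bsub>alg\<^esub> q) m) * N m)"
    using fin alg_mult_support[of p q] by (intro lin_abs_superset) auto
  also have "\<dots> \<le> (\<Sum>m\<in>?g ` ?P. \<Sum>z\<in>{z\<in>?P. ?g z = m}. cmod (p (fst z)) * cmod (q (snd z)) * N (?g z))"
  proof (rule sum_mono)
    fix m assume "m \<in> ?g ` ?P"
    then obtain z where "z \<in> ?P" "m = ?g z" by blast
    then have "N m \<ge> 0" using c[of z] N(2)[of m] by simp
    then have "cmod ((p \<otimes>\<^bsub>alg\<^esub> q) m) * N m \<le> (\<Sum>z\<in>{z\<in>?P. ?g z = m}. cmod (p (fst z) * q (snd z))) * N m"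
      unfolding alg_mult_apply by (intro mult_right_mono norm_sum)
    also have "\<dots> = (\<Sum>z\<in>{z\<in>?P. ?g z = m}. cmod (p (fst z)) * cmod (q (snd z)) * N (?g z))"
      unfolding sum_distrib_right norm_mult by (intro sum.cong) auto
    finally show "cmod ((p \<otimes>\<^bsub>alg\<^esub> q) m) * N m \<le> \<dots>" .
  qed
  also have "\<dots> = (\<Sum>z\<in>?P. cmod (p (fst z)) * cmod (q (snd z)) * N (?g z))"
    using fin by (rule sum.image_gen[symmetric])
  also have "\<dots> \<le> (\<Sum>z\<in>?P. cmod (p (fst z)) * cmod (q (snd z)) * (N (fst z) * N (snd z)))"
    by (intro sum_mono mult_left_mono N) (use c in auto)
  also have "\<dots> = lin_abs N p * lin_abs N q"
    unfolding lin_abs_def sum_product sum.cartesian_product' by (intro sum.cong) auto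
  finally show ?thesis .
qed

lemma alg_star_support:
  assumes "p \<in> carrier alg" shows "{m. star alg p m \<noteq> 0} = adj ` {m. p m \<noteq> 0}"
proof (intro subset_antisym subsetI)
  fix m assume "m \<in> {m. star alg p m \<noteq> 0}"
  then have "m \<in> carrier M" "p (adj m) \<noteq> 0"
    by (auto simp: monoid_star_algebra_def split: if_splits)
  then show "m \<in> adj ` {m. p m \<noteq> 0}" by (intro image_eqI[of _ _ "adj m"]) auto
next
  fix m assume "m \<in> adj ` {m. p m \<noteq> 0}"
  then obtain x where x: "m = adj x" "p x \<noteq> 0" by blast
  then have "x \<in> carrier M" using alg_support[OF assms] by blast
  then show "m \<in> {m. star alg p m \<noteq> 0}" using x by (simp add: monoid_star_algebra_def)
qed

lemma alg_star_apply: "m \<in> carrier M \<Longrightarrow> star alg p (adj m) = cnj (p m)"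
  by (simp add: monoid_star_algebra_def)

lemma alg_star_closed: "p \<in> carrier alg \<Longrightarrow> star alg p \<in> carrier alg"
  unfolding alg_carrier_iff[of "star alg p"] alg_star_support
  by (auto simp: alg_finite intro: alg_support)

lemma adj_inj: assumes "p \<in> carrier alg" shows "inj_on adj {m. p m \<noteq> 0}"
proof (rule inj_on_inverseI)
  fix m assume "m \<in> {m. p m \<noteq> 0}"
  then show "adj (adj m) = m" using alg_support[OF assms] by simp
qed

lemma lin_star:
  assumes "p \<in> carrier alg" shows "lin f (star alg p) = cnj (lin (\<lambda>x. cnj (f (adj x))) p)"
  unfolding lin_def alg_star_support[OF assms] sum.reindex[OF adj_inj[OF assms]]
  by (simp, intro sum.cong) (auto simp: alg_star_apply alg_support[OF assms])

lemma lin_abs_star: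
  assumes "p \<in> carrier alg" shows "lin_abs N (star alg p) = lin_abs (\<lambda>x. N (adj x)) p"
  unfolding lin_abs_def alg_star_support[OF assms] sum.reindex[OF adj_inj[OF assms]]
  by (simp, intro sum.cong) (auto simp: alg_star_apply alg_support[OF assms])

lemma monomial_closed [simp, intro]: "x \<in> carrier M \<Longrightarrow> monomial x \<in> carrier alg"
  by (auto simp: alg_carrier_iff monomial_def)

lemma alg_one: "\<one>\<^bsub>alg\<^esub> = monomial \<one>"
  by (simp add: monoid_star_algebra_def monomial_def)

lemma alg_add_closed:
  assumes "p \<in> carrier alg" "q \<in> carrier alg" shows "p \<oplus>\<^bsub>alg\<^esub> q \<in> carrier alg"
proof -
  have "{m. (p \<oplus>\<^bsub>alg\<^esub> q) m \<noteq> 0} \<subseteq> {m. p m \<noteq> 0} \<union> {m. q m \<noteq> 0}"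
    by (auto simp: monoid_star_algebra_def)
  then show ?thesis
    using assms unfolding alg_carrier_iff by (meson Un_least finite_Un finite_subset subset_trans)
qed

lemma alg_smult_closed: "p \<in> carrier alg \<Longrightarrow> c \<odot>\<^bsub>alg\<^esub> p \<in> carrier alg"
  unfolding monoid_star_algebra_def by (auto intro: finite_subset[of _ "{m. p m \<noteq> 0}"])

lemma alg_zero_closed: "\<zero>\<^bsub>alg\<^esub> \<in> carrier alg"
  by (simp add: monoid_star_algebra_def)

lemma lin_add: "p \<in> carrier alg \<Longrightarrow> q \<in> carrier alg \<Longrightarrow> lin f (p \<oplus>\<^bsub>alg\<^esub> q) = lin f p + lin f q"
  using lin_plus[of p q f] by (simp add: monoid_star_algebra_def)

lemma lin_smult: "lin f (c \<odot>\<^bsub>alg\<^esub> p) = c * lin f p"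
  using lin_scale[of f c p] by (simp add: monoid_star_algebra_def)

lemma lin_alg_zero: "lin f \<zero>\<^bsub>alg\<^esub> = 0"
  by (simp add: monoid_star_algebra_def)

lemmas alg_closed = alg_mult_closed alg_star_closed alg_add_closed alg_smult_closed alg_zero_closed
lemmas lin_ops = lin_mult lin_star lin_add lin_smult lin_alg_zero

lemma complex_star_algebra_alg: "complex_star_algebra alg"
proof -
  have "ring alg"
  proof (intro ringI abelian_groupI monoidI)
    show "\<one>\<^bsub>alg\<^esub> \<in> carrier alg" by (simp add: alg_one)
    fix p assume p: "p \<in> carrier alg"
    have "(-1) \<odot>\<^bsub>alg\<^esub> p \<oplus>\<^bsub>alg\<^esub> p = \<zero>\<^bsub>alg\<^esub>" by (simp add: monoid_star_algebra_def)
    then show "\<exists>q\<in>carrier alg. q \<oplus>\<^bsub>alg\<^esub> p = \<zero>\<^bsub>alg\<^esub>" using p alg_smult_closed by blast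
    show "\<one>\<^bsub>alg\<^esub> \<otimes>\<^bsub>alg\<^esub> p = p" "p \<otimes>\<^bsub>alg\<^esub> \<one>\<^bsub>alg\<^esub> = p"
      using p by (auto simp: alg_one alg_closed lin_ops intro!: alg_ext lin_cong)
    fix q assume q: "q \<in> carrier alg"
    show "p \<oplus>\<^bsub>alg\<^esub> q = q \<oplus>\<^bsub>alg\<^esub> p" by (simp add: monoid_star_algebra_def add.commute)
    fix r assume r: "r \<in> carrier alg"
    show "p \<otimes>\<^bsub>alg\<^esub> q \<otimes>\<^bsub>alg\<^esub> r = p \<otimes>\<^bsub>alg\<^esub> (q \<otimes>\<^bsub>alg\<^esub> r)"
      using p q r by (auto simp: alg_closed lin_ops m_assoc intro!: alg_ext lin_cong)
    show "(p \<oplus>\<^bsub>alg\<^esub> q) \<otimes>\<^bsub>alg\<^esub> r = p \<otimes>\<^bsub>alg\<^esub> r \<oplus>\<^bsub>alg\<^esub> q \<otimes>\<^bsub>alg\<^esub> r"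
      "r \<otimes>\<^bsub>alg\<^esub> (p \<oplus>\<^bsub>alg\<^esub> q) = r \<otimes>\<^bsub>alg\<^esub> p \<oplus>\<^bsub>alg\<^esub> r \<otimes>\<^bsub>alg\<^esub> q"
      using p q r by (auto simp: alg_closed lin_ops lin_fun_add intro!: alg_ext)
    show "p \<oplus>\<^bsub>alg\<^esub> q \<oplus>\<^bsub>alg\<^esub> r = p \<oplus>\<^bsub>alg\<^esub> (q \<oplus>\<^bsub>alg\<^esub> r)"
      by (simp add: monoid_star_algebra_def add.assoc)
  qed (auto simp: alg_closed, simp add: monoid_star_algebra_def)
  moreover have "star alg (star alg p) = p" if p: "p \<in> carrier alg" for p
    using p by (auto simp: alg_closed lin_ops intro!: alg_ext lin_cong)
  moreover have "star alg (p \<otimes>\<^bsub>alg\<^esub> q) = star alg q \<otimes>\<^bsub>alg\<^esub> star alg p"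
    if p: "p \<in> carrier alg" and q: "q \<in> carrier alg" for p q
  proof (rule alg_ext)
    fix f
    have "lin f (star alg (p \<otimes>\<^bsub>alg\<^esub> q)) = cnj (lin (\<lambda>x. lin (\<lambda>y. cnj (f (adj y \<otimes> adj x))) q) p)"
      using p q by (auto simp: alg_closed lin_ops adj_mult intro!: lin_cong)
    also have "lin (\<lambda>x. lin (\<lambda>y. cnj (f (adj y \<otimes> adj x))) q) p
      = lin (\<lambda>y. lin (\<lambda>x. cnj (f (adj y \<otimes> adj x))) p) q"
      unfolding lin_def sum_distrib_left by (subst sum.swap) (simp add: mult.left_commute)
    also have "cnj \<dots> = lin f (star alg q \<otimes>\<^bsub>alg\<^esub> star alg p)"
      using p q by (simp add: alg_closed lin_ops)
    finally show "lin f (star alg (p \<otimes>\<^bsub>alg\<^esub> q)) = lin f (star alg q \<otimes>\<^bsub>alg\<^esub> star alg p)" .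
  qed (use p q in \<open>auto simp: alg_closed\<close>)
  ultimately show ?thesis
    unfolding complex_star_algebra_def complex_star_algebra_axioms_def
    by (auto simp: alg_closed lin_ops lin_fun_scale distrib_left distrib_right intro!: alg_ext)
qed

lemma monomial_mult:
  "x \<in> carrier M \<Longrightarrow> y \<in> carrier M \<Longrightarrow> monomial x \<otimes>\<^bsub>alg\<^esub> monomial y = monomial (x \<otimes> y)"
  by (rule alg_ext) (auto simp: alg_closed lin_ops)

lemma monomial_star: "x \<in> carrier M \<Longrightarrow> star alg (monomial x) = monomial (adj x)"
  by (rule alg_ext) (auto simp: alg_closed lin_ops)

text \<open>Positivity of \<open>lin f\<close> is positive semidefiniteness of the kernel
  \<open>f (adj x \<otimes> y)\<close> on the support of each p.\<close>

lemma positive_functional_linI: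
  assumes "\<And>p. p \<in> carrier alg \<Longrightarrow>
    (\<Sum>x | p x \<noteq> 0. \<Sum>y | p y \<noteq> 0. cnj (p x) * p y * f (adj x \<otimes> y)) \<in> \<real>\<^sub>\<ge>\<^sub>0"
  shows "positive_functional alg (lin f)"
proof -
  have "lin f (star alg p \<otimes>\<^bsub>alg\<^esub> p) \<in> \<real>\<^sub>\<ge>\<^sub>0" if "p \<in> carrier alg" for p
    using assms[OF that] that
    by (simp add: lin_ops alg_closed) (simp add: lin_def sum_distrib_left mult.assoc)
  then show ?thesis
    unfolding positive_functional_def positive_functional_axioms_def
    by (simp add: complex_star_algebra_alg lin_ops)
qed

lemma dominated_functional_linI:
  assumes "positive_functional alg (lin f)"
    and N: "\<And>x y. x \<in> carrier M \<Longrightarrow> y \<in> carrier M \<Longrightarrow> N (x \<otimes> y) \<le> N x * N y"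
      "\<And>x. x \<in> carrier M \<Longrightarrow> 0 \<le> N x"
      "\<And>x. x \<in> carrier M \<Longrightarrow> N (adj x) \<le> N x"
      "\<And>x. x \<in> carrier M \<Longrightarrow> cmod (f x) \<le> N x"
  shows "dominated_functional alg (lin f) (lin_abs N)"
proof -
  have "0 \<le> lin_abs N p" if "p \<in> carrier alg" for p
    unfolding lin_abs_def using that N alg_support by (intro sum_nonneg) auto
  moreover have "lin_abs N (star alg p) \<le> lin_abs N p" if "p \<in> carrier alg" for p
    unfolding lin_abs_star[OF that] unfolding lin_abs_def
    using that N alg_support by (intro sum_mono mult_left_mono) auto
  moreover have "cmod (lin f p) \<le> lin_abs N p" if "p \<in> carrier alg" for p
    using that N alg_support by (intro cmod_lin_le) auto
  ultimately show ?thesis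
    unfolding dominated_functional_def dominated_functional_axioms_def
    using assms lin_abs_mult by simp
qed

end

lemma (in star_monoid) lin_finsum:
  assumes "finite S" "\<And>i. i \<in> S \<Longrightarrow> h i \<in> carrier alg"
  shows "lin f (finsum alg h S) = (\<Sum>i\<in>S. lin f (h i))"
proof -
  interpret F: complex_star_algebra alg by (rule complex_star_algebra_alg)
  show ?thesis
    using assms
    by (induction S rule: finite_induct) (auto simp: lin_add lin_alg_zero Pi_def)
qed

lemma free_star_monoid:
  "star_monoid \<lparr>carrier = UNIV, mult = (@), one = []\<rparr> (\<lambda>w. rev (map (\<lambda>(x, b). (x, \<not> b)) w))"
  by unfold_locales (auto simp: rev_map o_def split_def)


section \<open>Positivity of products of states\<close>

definition psd :: "'i set \<Rightarrow> ('i \<Rightarrow> 'i \<Rightarrow> complex) \<Rightarrow> bool" where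
  "psd S K \<longleftrightarrow> (\<forall>c. (\<Sum>i\<in>S. \<Sum>j\<in>S. cnj (c i) * c j * K i j) \<in> \<real>\<^sub>\<ge>\<^sub>0)"

lemma psdD: "psd S K \<Longrightarrow> (\<Sum>i\<in>S. \<Sum>j\<in>S. cnj (c i) * c j * K i j) \<in> \<real>\<^sub>\<ge>\<^sub>0"
  by (simp add: psd_def)

lemma psd_subset:
  assumes "psd S K" "T \<subseteq> S" "finite S" shows "psd T K"
  unfolding psd_def
proof
  fix c :: "'a \<Rightarrow> complex"
  define d where "d i = (if i \<in> T then c i else 0)" for i
  have "(\<Sum>i\<in>S. \<Sum>j\<in>S. cnj (d i) * d j * K i j) = (\<Sum>i\<in>T. \<Sum>j\<in>T. cnj (d i) * d j * K i j)"
    using assms(2,3)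
    by (intro sum.mono_neutral_cong_right sum.mono_neutral_right ballI) (auto simp: d_def)
  also have "\<dots> = (\<Sum>i\<in>T. \<Sum>j\<in>T. cnj (c i) * c j * K i j)"
    by (intro sum.cong) (auto simp: d_def)
  finally show "(\<Sum>i\<in>T. \<Sum>j\<in>T. cnj (c i) * c j * K i j) \<in> \<real>\<^sub>\<ge>\<^sub>0"
    using psdD[OF assms(1), of d] by simp
qed

lemma psd_diagonal: assumes "psd S K" "finite S" "i \<in> S" shows "K i i \<in> \<real>\<^sub>\<ge>\<^sub>0"
  using psdD[OF psd_subset[OF assms(1), of "{i}"], of "\<lambda>_. 1"] assms by simp

lemma
  assumes "psd S K" "finite S" "i \<in> S" "j \<in> S"
  shows psd_hermitian: "K j i = cnj (K i j)"
    and psd_cauchy_schwarz: "(cmod (K i j))\<^sup>2 \<le> Re (K i i) * Re (K j j)"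
proof -
  have d: "K i i \<in> \<real>\<^sub>\<ge>\<^sub>0" "K j j \<in> \<real>\<^sub>\<ge>\<^sub>0" using assms psd_diagonal by metis+
  have "K j i = cnj (K i j) \<and> (cmod (K i j))\<^sup>2 \<le> Re (K i i) * Re (K j j)"
  proof (cases "i = j")
    case True
    then show ?thesis
      using d by (auto simp: complex_nonneg_Reals_iff complex_eq_iff cmod_eq_Re power2_eq_square)
  next
    case False
    have "psd {i, j} K" using assms by (intro psd_subset[OF assms(1)]) auto
    then have "K i i + c * K i j + cnj c * K j i + c * cnj c * K j j \<in> \<real>\<^sub>\<ge>\<^sub>0" for c
      using psdD[of "{i, j}" K "\<lambda>k. if k = i then 1 else c"] False by (simp add: algebra_simps)
    then show ?thesis using d quadratic_nonneg by metis
  qed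
  then show "K j i = cnj (K i j)" "(cmod (K i j))\<^sup>2 \<le> Re (K i i) * Re (K j j)" by auto
qed

text \<open>The Schur product theorem, by induction on the size of the first matrix: the Schur complement
  of a diagonal entry splits it into a matrix of rank one and a smaller positive matrix.\<close>

lemma psd_schur_product:
  assumes "finite S" "psd S K" "psd S B" shows "psd S (\<lambda>i j. K i j * B i j)"
  using assms
proof (induction S arbitrary: K rule: finite_induct)
  case empty
  then show ?case by (simp add: psd_def)
next
  case (insert a S)
  let ?T = "insert a S"
  have fin: "finite ?T" using insert by simp
  have B: "psd S B" using insert psd_subset by (metis fin subset_insertI)
  have herm: "K j i = cnj (K i j)" if "i \<in> ?T" "j \<in> ?T" for i j
    using psd_hermitian[OF insert.prems(1) fin that] .
  have Kaa: "Re (K a a) \<ge> 0" "Im (K a a) = 0"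
    using psd_diagonal[OF insert.prems(1) fin, of a] by (auto simp: complex_nonneg_Reals_iff)
  have split: "(\<Sum>i\<in>?T. \<Sum>j\<in>?T. F i j) = F a a + (\<Sum>j\<in>S. F a j) + (\<Sum>i\<in>S. F i a) + (\<Sum>i\<in>S. \<Sum>j\<in>S. F i j)"
    for F :: "'a \<Rightarrow> 'a \<Rightarrow> complex"
    using insert.hyps by (simp add: sum.distrib algebra_simps)
  show ?case
  proof (cases "K a a = 0")
    case True
    \<comment> \<open>A zero on the diagonal of a positive matrix forces its row and column to
      vanish, by Cauchy-Schwarz.\<close>
    have z: "K a j = 0" "K j a = 0" if "j \<in> ?T" for j
      using psd_cauchy_schwarz[OF insert.prems(1) fin, of a j] herm[of a j] that True by auto
    have "psd S (\<lambda>i j. K i j * B i j)"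
      using insert.IH[OF _ B] insert.prems(1) psd_subset by (metis fin subset_insertI)
    then show ?thesis unfolding psd_def split using z by simp
  next
    case False
    then have k: "Re (K a a) > 0" using Kaa by (metis complex_eqI less_eq_real_def zero_complex.simps)
    have kk: "K a a = complex_of_real (Re (K a a))" using Kaa by (simp add: complex_eq_iff)
    define k where "k = Re (K a a)"
    have k0: "k > 0" and ka: "K a a = complex_of_real k" using k kk by (auto simp: k_def)
    \<comment> \<open>The Schur complement; its row and column at a are zero.\<close>
    define K' where "K' i j = K i j - K i a * K a j / k" for i j
    have "psd S K'"
      unfolding psd_def
    proof
      fix c
      define T where "T = (\<Sum>j\<in>S. c j * K a j)"
      have T': "(\<Sum>i\<in>S. cnj (c i) * K i a) = cnj T"
        unfolding T_def cnj_sum using herm[of a] by (intro sum.cong) auto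
      \<comment> \<open>The coefficient at a that minimises the form of K; the minimum is the form
        of \<open>K'\<close> at c.\<close>
      define d where "d = c(a := - T / k)"
      have d: "d a = - T / k" "\<And>i. i \<in> S \<Longrightarrow> d i = c i" using insert.hyps by (auto simp: d_def)
      have "(\<Sum>i\<in>?T. \<Sum>j\<in>?T. cnj (d i) * d j * K i j) =
          cnj (d a) * d a * K a a + cnj (d a) * T + d a * cnj T + (\<Sum>i\<in>S. \<Sum>j\<in>S. cnj (c i) * c j * K i j)"
        unfolding split by (simp add: d(2) mult.assoc sum_distrib_left[symmetric] T_def[symmetric])
          (simp add: T'[symmetric] sum_distrib_left mult_ac d(2))
      also have "\<dots> = (\<Sum>i\<in>S. \<Sum>j\<in>S. cnj (c i) * c j * K i j) - cnj T * T / k"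
        using k0 by (simp add: d(1) ka field_simps)
      also have "cnj T * T / k = (\<Sum>i\<in>S. \<Sum>j\<in>S. cnj (c i) * c j * (K i a * K a j / k))"
      proof -
        have "cnj T * T / k = (\<Sum>i\<in>S. cnj (c i) * K i a) * T / k" by (simp only: T')
        then show ?thesis
          unfolding T_def sum_product sum_divide_distrib by (simp add: mult_ac)
      qed
      also have "(\<Sum>i\<in>S. \<Sum>j\<in>S. cnj (c i) * c j * K i j) - \<dots> = (\<Sum>i\<in>S. \<Sum>j\<in>S. cnj (c i) * c j * K' i j)"
        by (simp add: K'_def sum_subtractf right_diff_distrib)
      finally show "(\<Sum>i\<in>S. \<Sum>j\<in>S. cnj (c i) * c j * K' i j) \<in> \<real>\<^sub>\<ge>\<^sub>0"
        using psdD[OF insert.prems(1), of d] by simp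
    qed
    then have IH: "psd S (\<lambda>i j. K' i j * B i j)" using insert.IH B by blast
    show ?thesis
      unfolding psd_def
    proof
      fix c
      have "(\<Sum>i\<in>?T. \<Sum>j\<in>?T. cnj (c i) * c j * (K i j * B i j)) =
          (\<Sum>i\<in>?T. \<Sum>j\<in>?T. cnj (c i) * c j * (K' i j * B i j)) +
          (\<Sum>i\<in>?T. \<Sum>j\<in>?T. cnj (c i) * c j * (K i a * K a j / k * B i j))"
        unfolding sum.distrib[symmetric] by (intro sum.cong) (auto simp: K'_def algebra_simps)
      also have "(\<Sum>i\<in>?T. \<Sum>j\<in>?T. cnj (c i) * c j * (K' i j * B i j)) =
          (\<Sum>i\<in>S. \<Sum>j\<in>S. cnj (c i) * c j * (K' i j * B i j))"
        unfolding split using k0 by (simp add: K'_def ka)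
      \<comment> \<open>Multiplying B entrywise by a matrix of rank one only rescales its
        coefficient vector, so positivity of B itself finishes this part.\<close>
      also have "(\<Sum>i\<in>?T. \<Sum>j\<in>?T. cnj (c i) * c j * (K i a * K a j / k * B i j)) =
          complex_of_real (1 / k) * (\<Sum>i\<in>?T. \<Sum>j\<in>?T. cnj (K a i * c i) * (K a j * c j) * B i j)"
        unfolding sum_distrib_left using herm[of a] by (intro sum.cong refl) (simp add: mult_ac)
      finally show "(\<Sum>i\<in>?T. \<Sum>j\<in>?T. cnj (c i) * c j * (K i j * B i j)) \<in> \<real>\<^sub>\<ge>\<^sub>0"
        using psdD[OF IH, of c] psdD[OF insert.prems(2), of "\<lambda>i. K a i * c i"] k0
        by (simp only:) (intro nonneg_Reals_add_I nonneg_Reals_mult_I, auto)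
    qed
  qed
qed

lemma (in positive_functional) psd_gram:
  assumes "finite S" "\<And>i. i \<in> S \<Longrightarrow> v i \<in> carrier A"
  shows "psd S (\<lambda>i j. \<omega> (star A (v i) \<otimes> v j))"
  unfolding psd_def
proof
  fix c
  \<comment> \<open>The witness is the linear combination of the v j with coefficients c j. Only its
    values under \<omega> are recorded, so that sums of complex numbers replace sums in the
    algebra.\<close>
  have "\<exists>x\<in>carrier A. (\<forall>b\<in>carrier A. \<omega> (b \<otimes> x) = (\<Sum>j\<in>S. c j * \<omega> (b \<otimes> v j))) \<and>
     (\<forall>b\<in>carrier A. \<omega> (star A x \<otimes> b) = (\<Sum>j\<in>S. cnj (c j) * \<omega> (star A (v j) \<otimes> b)))"
    using assms
  proof (induction S rule: finite_induct)
    case empty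
    then show ?case by (intro bexI[of _ \<zero>]) auto
  next
    case (insert i S)
    then obtain x where x: "x \<in> carrier A" "\<forall>b\<in>carrier A. \<omega> (b \<otimes> x) = (\<Sum>j\<in>S. c j * \<omega> (b \<otimes> v j))"
      "\<forall>b\<in>carrier A. \<omega> (star A x \<otimes> b) = (\<Sum>j\<in>S. cnj (c j) * \<omega> (star A (v j) \<otimes> b))" by auto
    have "v i \<in> carrier A" using insert by simp
    then show ?case
      using x insert.hyps
      by (intro bexI[of _ "c i \<odot> v i \<oplus> x"])
        (auto simp: r_distr l_distr func_add func_smult star_add star_smult smult_mult_left smult_mult_right)
  qed
  then obtain x where x: "x \<in> carrier A" "\<forall>b\<in>carrier A. \<omega> (b \<otimes> x) = (\<Sum>j\<in>S. c j * \<omega> (b \<otimes> v j))"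
    "\<forall>b\<in>carrier A. \<omega> (star A x \<otimes> b) = (\<Sum>j\<in>S. cnj (c j) * \<omega> (star A (v j) \<otimes> b))" by blast
  have "\<omega> (star A x \<otimes> x) = (\<Sum>i\<in>S. \<Sum>j\<in>S. cnj (c i) * c j * \<omega> (star A (v i) \<otimes> v j))"
  proof -
    have "\<omega> (star A x \<otimes> x) = (\<Sum>i\<in>S. cnj (c i) * \<omega> (star A (v i) \<otimes> x))" using x by blast
    also have "\<dots> = (\<Sum>i\<in>S. cnj (c i) * (\<Sum>j\<in>S. c j * \<omega> (star A (v i) \<otimes> v j)))"
      using x assms by (intro sum.cong) auto
    finally show ?thesis by (simp add: sum_distrib_left mult.assoc)
  qed
  then show "(\<Sum>i\<in>S. \<Sum>j\<in>S. cnj (c i) * c j * \<omega> (star A (v i) \<otimes> v j)) \<in> \<real>\<^sub>\<ge>\<^sub>0"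
    using func_pos[OF x(1)] by simp
qed


section \<open>The spatial seminorm\<close>

locale normed_star_algebra = seminormed_star_algebra A "nrm A"
  for A :: "('a, 'x) cstar_algebra_scheme" (structure)

lemma (in normed_star_algebra) state_positive: "is_state A \<phi> \<Longrightarrow> positive_functional A \<phi>"
  unfolding is_state_def by unfold_locales auto

text \<open>The required states will be explicit: point evaluations on \<open>CU\<close>, and on
  \<open>Au\<close> the extension of the vector functional \<open>lin vec\<close>.\<close>

locale spatial_pair = A: normed_star_algebra A + B: normed_star_algebra B
  for A :: "('a, 'x) cstar_algebra_scheme" and B :: "('b, 'y) cstar_algebra_scheme" +
  assumes exists_state: "\<exists>\<phi>. is_state A \<phi>" "\<exists>\<psi>. is_state B \<psi>"
begin

abbreviation (input) FT where "FT \<equiv> formal_tensors A B"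

lemma star_monoid_prod: "star_monoid (A \<times>\<times> B) (map_prod (star A) (star B))"
proof -
  interpret monoid "A \<times>\<times> B" by (rule DirProd_monoid) (rule A.monoid_axioms B.monoid_axioms)+
  show ?thesis by unfold_locales (auto simp: DirProd_def A.star_mult B.star_mult)
qed

sublocale ft: star_monoid "A \<times>\<times> B" "map_prod (star A) (star B)"
  rewrites "monoid_star_algebra (A \<times>\<times> B) (map_prod (star A) (star B)) = formal_tensors A B"
    and "carrier (A \<times>\<times> B) = carrier A \<times> carrier B"
  by (rule star_monoid_prod) (auto simp: formal_tensors_def DirProd_def)

lemma product_functional_eq_lin: "product_functional \<phi> \<psi> = lin (\<lambda>z. \<phi> (fst z) * \<psi> (snd z))"
  unfolding product_functional_def lin_def fun_eq_iff by (auto intro!: sum.cong)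

lemma DirProd_mult: "z \<otimes>\<^bsub>A \<times>\<times> B\<^esub> w = (fst z \<otimes>\<^bsub>A\<^esub> fst w, snd z \<otimes>\<^bsub>B\<^esub> snd w)"
  by (simp add: DirProd_def split_def)

text \<open>The kernel of \<phi> \<otimes> \<psi> is the entrywise product of two Gram matrices, one
  for each leg, and the Schur product theorem applies.\<close>

lemma positive_product_functional:
  assumes "is_state A \<phi>" "is_state B \<psi>"
  shows "positive_functional FT (product_functional \<phi> \<psi>)"
  unfolding product_functional_eq_lin
proof (rule ft.positive_functional_linI)
  fix p assume p: "p \<in> carrier FT"
  interpret a: positive_functional A \<phi> using assms(1) by (rule A.state_positive)
  interpret b: positive_functional B \<psi> using assms(2) by (rule B.state_positive)
  let ?S = "{m. p m \<noteq> 0}"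
  have fin: "finite ?S" using p by (rule ft.alg_finite)
  have S: "fst z \<in> carrier A" "snd z \<in> carrier B" if "z \<in> ?S" for z
    using ft.alg_support[OF p, of z] that by (auto simp: mem_Times_iff)
  have "psd ?S (\<lambda>z w. \<phi> (star A (fst z) \<otimes>\<^bsub>A\<^esub> fst w) * \<psi> (star B (snd z) \<otimes>\<^bsub>B\<^esub> snd w))"
    by (rule psd_schur_product[OF fin a.psd_gram[OF fin] b.psd_gram[OF fin]]) (use S in auto)
  from psdD[OF this, of p]
  show "(\<Sum>x\<in>?S. \<Sum>y\<in>?S. cnj (p x) * p y *
     (\<phi> (fst (map_prod (star A) (star B) x \<otimes>\<^bsub>A \<times>\<times> B\<^esub> y)) * \<psi> (snd (map_prod (star A) (star B) x \<otimes>\<^bsub>A \<times>\<times> B\<^esub> y)))) \<in> \<real>\<^sub>\<ge>\<^sub>0"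
    by (simp add: DirProd_mult)
qed

abbreviation (input) prod_nrm where "prod_nrm z \<equiv> nrm A (fst z) * nrm B (snd z)"

abbreviation (input) product_states where
  "product_states \<equiv> {product_functional \<phi> \<psi> |\<phi> \<psi>. is_state A \<phi> \<and> is_state B \<psi>}"

text \<open>States are bounded by the norms, so the l1-norm weighted by the products of norms
  dominates all product functionals simultaneously.\<close>

lemma functional_family_product:
  "functional_family FT product_states (lin_abs prod_nrm)"
proof -
  interpret F: complex_star_algebra FT by (rule ft.complex_star_algebra_alg)
  have dom: "dominated_functional FT (product_functional \<phi> \<psi>) (lin_abs prod_nrm)"
    if "is_state A \<phi>" "is_state B \<psi>" for \<phi> \<psi>
    using positive_product_functional[OF that] that unfolding product_functional_eq_lin
    by (rule_tac ft.dominated_functional_linI)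
       (auto simp: DirProd_mult A.s_star B.s_star norm_mult is_state_def mult_mono
         intro!: order_trans[OF mult_mono[OF A.s_mult B.s_mult]])
  obtain \<phi> \<psi> where st: "is_state A \<phi>" "is_state B \<psi>" using exists_state by blast
  then have "product_functional \<phi> \<psi> \<one>\<^bsub>FT\<^esub> = 1"
    by (simp add: product_functional_eq_lin ft.alg_one is_state_def DirProd_def)
  with st have one: "\<exists>\<omega>\<in>product_states. \<omega> \<one>\<^bsub>FT\<^esub> = 1" by blast
  show ?thesis
    by (intro functional_family.intro functional_family_axioms.intro F.complex_star_algebra_axioms one)
       (use dom in blast)
qed

sublocale fam: functional_family "formal_tensors A B" product_states "lin_abs prod_nrm"
  by (rule functional_family_product)

lemma spatial_seminorm_eq: "spatial_seminorm A B = fam.gns_seminorm"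
proof -
  have eq: "{Re (\<omega> (star FT (t \<otimes>\<^bsub>FT\<^esub> y) \<otimes>\<^bsub>FT\<^esub> (t \<otimes>\<^bsub>FT\<^esub> y))) |\<omega> y.
       \<omega> \<in> product_states \<and> y \<in> carrier FT \<and> \<omega> (star FT y \<otimes>\<^bsub>FT\<^esub> y) = 1} =
     {Re (product_functional \<phi> \<psi> (star FT (t \<otimes>\<^bsub>FT\<^esub> y) \<otimes>\<^bsub>FT\<^esub> (t \<otimes>\<^bsub>FT\<^esub> y))) |\<phi> \<psi> y.
        is_state A \<phi> \<and> is_state B \<psi> \<and> y \<in> carrier FT \<and>
        product_functional \<phi> \<psi> (star FT y \<otimes>\<^bsub>FT\<^esub> y) = 1}" for t
    by blast
  show ?thesis
    unfolding fun_eq_iff[of "spatial_seminorm A B"] spatial_seminorm_def fam.gns_seminorm_def Let_def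
    by (intro allI arg_cong[OF eq[symmetric], of "\<lambda>S. sqrt (Sup S)"])
qed

sublocale sp: seminormed_star_algebra "formal_tensors A B" "spatial_seminorm A B"
  unfolding spatial_seminorm_eq by (rule fam.seminormed_gns)

lemma spatial_tensor_eq: "spatial_tensor A B = completion FT (spatial_seminorm A B)"
  by (simp add: spatial_tensor_def)

sublocale st: complex_star_algebra "spatial_tensor A B"
  unfolding spatial_tensor_eq by (rule sp.complex_star_algebra_completion)

text \<open>The canonical map with dense image. Every tensor computed below lies in its image, so
  the calculations can be made in the formal algebra.\<close>

definition incl :: "('a \<times> 'b \<Rightarrow> complex) \<Rightarrow> ('a, 'b) tensor" where
  "incl t = tensor_class A B (\<lambda>_. t)"

lemma incl_eq_cls: "incl t = sp.cls (\<lambda>_. t)"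
  by (simp add: incl_def tensor_class_def)

lemma elem_tensor_eq: "elem_tensor A B a b = incl (monomial (a, b))"
  by (simp add: elem_tensor_def incl_def)

lemma incl_hom: "incl \<in> ring_hom FT (spatial_tensor A B)"
  using sp.const_ring_hom unfolding spatial_tensor_eq incl_eq_cls[abs_def] .

lemma incl_star: "t \<in> carrier FT \<Longrightarrow> star (spatial_tensor A B) (incl t) = incl (star FT t)"
  unfolding spatial_tensor_eq incl_eq_cls by (simp add: sp.completion_star)

lemma incl_eq_iff: "t \<in> carrier FT \<Longrightarrow> u \<in> carrier FT \<Longrightarrow>
    incl t = incl u \<longleftrightarrow> spatial_seminorm A B (t \<ominus>\<^bsub>FT\<^esub> u) = 0"
  unfolding incl_eq_cls by (rule sp.cls_const_eq_iff)

lemma elem_tensor_closed [simp, intro]: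
  "a \<in> carrier A \<Longrightarrow> b \<in> carrier B \<Longrightarrow> elem_tensor A B a b \<in> carrier (spatial_tensor A B)"
  unfolding elem_tensor_eq by (rule ring_hom_closed[OF incl_hom]) auto

lemma elem_tensor_mult:
  assumes "a \<in> carrier A" "b \<in> carrier B" "a' \<in> carrier A" "b' \<in> carrier B"
  shows "elem_tensor A B a b \<otimes>\<^bsub>spatial_tensor A B\<^esub> elem_tensor A B a' b' =
    elem_tensor A B (a \<otimes>\<^bsub>A\<^esub> a') (b \<otimes>\<^bsub>B\<^esub> b')"
proof -
  have "incl (monomial (a, b)) \<otimes>\<^bsub>spatial_tensor A B\<^esub> incl (monomial (a', b')) =
    incl (monomial (a, b) \<otimes>\<^bsub>FT\<^esub> monomial (a', b'))"
    using assms by (intro ring_hom_mult[OF incl_hom, symmetric]) auto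
  then show ?thesis using assms by (simp add: elem_tensor_eq ft.monomial_mult DirProd_mult)
qed

lemma elem_tensor_star:
  assumes "a \<in> carrier A" "b \<in> carrier B"
  shows "star (spatial_tensor A B) (elem_tensor A B a b) = elem_tensor A B (star A a) (star B b)"
  using assms by (simp add: elem_tensor_eq incl_star ft.monomial_star)

lemma elem_tensor_one: "elem_tensor A B \<one>\<^bsub>A\<^esub> \<one>\<^bsub>B\<^esub> = \<one>\<^bsub>spatial_tensor A B\<^esub>"
  using ring_hom_one[OF incl_hom] by (simp add: elem_tensor_eq ft.alg_one DirProd_def)

lemma lin_FT_minus:
  "t \<in> carrier FT \<Longrightarrow> u \<in> carrier FT \<Longrightarrow> lin f (t \<ominus>\<^bsub>FT\<^esub> u) = lin f t - lin f u"
  by (simp add: a_minus_def fam.minus_eq_smult ft.lin_add ft.lin_smult)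

text \<open>The coefficients of z t y under a product of states are biadditive functions of the
  pairs in t. Elements that no biadditive function separates therefore differ by an element of
  seminorm zero.\<close>

lemma incl_eqI:
  assumes t: "t \<in> carrier FT" and u: "u \<in> carrier FT"
    and eq: "\<And>f. (\<And>a a' b. a \<in> carrier A \<Longrightarrow> a' \<in> carrier A \<Longrightarrow> b \<in> carrier B \<Longrightarrow> f (a \<oplus>\<^bsub>A\<^esub> a', b) = f (a, b) + f (a', b)) \<Longrightarrow>
      (\<And>a b b'. a \<in> carrier A \<Longrightarrow> b \<in> carrier B \<Longrightarrow> b' \<in> carrier B \<Longrightarrow> f (a, b \<oplus>\<^bsub>B\<^esub> b') = f (a, b) + f (a, b')) \<Longrightarrow>
      lin f t = lin f u"
  shows "incl t = incl u"
proof -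
  have "spatial_seminorm A B (t \<ominus>\<^bsub>FT\<^esub> u) = 0"
    unfolding spatial_seminorm_eq
  proof (rule fam.gns_zeroI)
    fix \<omega> y z assume "\<omega> \<in> product_states" and y: "y \<in> carrier FT" and z: "z \<in> carrier FT"
    then obtain \<phi> \<psi> where w: "is_state A \<phi>" "is_state B \<psi>" "\<omega> = product_functional \<phi> \<psi>" by blast
    let ?h = "\<lambda>z. \<phi> (fst z) * \<psi> (snd z)"
    interpret a: positive_functional A \<phi> using w(1) by (rule A.state_positive)
    interpret b: positive_functional B \<psi> using w(2) by (rule B.state_positive)
    have "\<omega> (z \<otimes>\<^bsub>FT\<^esub> (t \<ominus>\<^bsub>FT\<^esub> u) \<otimes>\<^bsub>FT\<^esub> y) =
      lin (\<lambda>v. lin (\<lambda>m. lin (\<lambda>m'. ?h ((v \<otimes>\<^bsub>A \<times>\<times> B\<^esub> m) \<otimes>\<^bsub>A \<times>\<times> B\<^esub> m')) y) (t \<ominus>\<^bsub>FT\<^esub> u)) z"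
      unfolding w product_functional_eq_lin
      using y z t u by (simp add: ft.lin_mult)
    also have "\<dots> = lin (\<lambda>v. 0) z"
    proof (rule ft.lin_cong[OF z])
      fix v assume v: "v \<in> carrier A \<times> carrier B"
      let ?f = "\<lambda>m. lin (\<lambda>m'. ?h ((v \<otimes>\<^bsub>A \<times>\<times> B\<^esub> m) \<otimes>\<^bsub>A \<times>\<times> B\<^esub> m')) y"
      have "lin ?f t = lin ?f u"
      proof (rule eq)
        fix a a' b assume "a \<in> carrier A" "a' \<in> carrier A" "b \<in> carrier B"
        then show "?f (a \<oplus>\<^bsub>A\<^esub> a', b) = ?f (a, b) + ?f (a', b)"
          unfolding lin_fun_add[symmetric] using v
          by (intro ft.lin_cong[OF y]) (auto simp: DirProd_mult A.l_distr A.r_distr a.func_add algebra_simps)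
      next
        fix a b b' assume "a \<in> carrier A" "b \<in> carrier B" "b' \<in> carrier B"
        then show "?f (a, b \<oplus>\<^bsub>B\<^esub> b') = ?f (a, b) + ?f (a, b')"
          unfolding lin_fun_add[symmetric] using v
          by (intro ft.lin_cong[OF y]) (auto simp: DirProd_mult B.l_distr B.r_distr b.func_add algebra_simps)
      qed
      then show "lin ?f (t \<ominus>\<^bsub>FT\<^esub> u) = 0" using t u by (simp add: lin_FT_minus)
    qed
    finally show "\<omega> (z \<otimes>\<^bsub>FT\<^esub> (t \<ominus>\<^bsub>FT\<^esub> u) \<otimes>\<^bsub>FT\<^esub> y) = 0" by simp
  qed (use t u in auto)
  then show ?thesis using t u by (simp add: incl_eq_iff)
qed

text \<open>Multiplicativity and the unit come from the formal tensors. Additivity fails there and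
  holds only after passing to classes.\<close>

lemma elem_tensor_left_hom: "(\<lambda>a. elem_tensor A B a \<one>\<^bsub>B\<^esub>) \<in> ring_hom A (spatial_tensor A B)"
proof (rule ring_hom_memI)
  fix a a' assume a: "a \<in> carrier A" "a' \<in> carrier A"
  have "incl (monomial (a \<oplus>\<^bsub>A\<^esub> a', \<one>\<^bsub>B\<^esub>)) = incl (monomial (a, \<one>\<^bsub>B\<^esub>) \<oplus>\<^bsub>FT\<^esub> monomial (a', \<one>\<^bsub>B\<^esub>))"
    using a by (intro incl_eqI) (auto simp: ft.lin_add)
  also have "\<dots> = incl (monomial (a, \<one>\<^bsub>B\<^esub>)) \<oplus>\<^bsub>spatial_tensor A B\<^esub> incl (monomial (a', \<one>\<^bsub>B\<^esub>))"
    using a by (intro ring_hom_add[OF incl_hom]) auto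
  finally show "elem_tensor A B (a \<oplus>\<^bsub>A\<^esub> a') \<one>\<^bsub>B\<^esub> =
    elem_tensor A B a \<one>\<^bsub>B\<^esub> \<oplus>\<^bsub>spatial_tensor A B\<^esub> elem_tensor A B a' \<one>\<^bsub>B\<^esub>"
    by (simp add: elem_tensor_eq)
qed (auto simp: elem_tensor_mult elem_tensor_one)

lemma elem_tensor_right_hom: "elem_tensor A B \<one>\<^bsub>A\<^esub> \<in> ring_hom B (spatial_tensor A B)"
proof (rule ring_hom_memI)
  fix b b' assume b: "b \<in> carrier B" "b' \<in> carrier B"
  have "incl (monomial (\<one>\<^bsub>A\<^esub>, b \<oplus>\<^bsub>B\<^esub> b')) = incl (monomial (\<one>\<^bsub>A\<^esub>, b) \<oplus>\<^bsub>FT\<^esub> monomial (\<one>\<^bsub>A\<^esub>, b'))"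
    using b by (intro incl_eqI) (auto simp: ft.lin_add)
  also have "\<dots> = incl (monomial (\<one>\<^bsub>A\<^esub>, b)) \<oplus>\<^bsub>spatial_tensor A B\<^esub> incl (monomial (\<one>\<^bsub>A\<^esub>, b'))"
    using b by (intro ring_hom_add[OF incl_hom]) auto
  finally show "elem_tensor A B \<one>\<^bsub>A\<^esub> (b \<oplus>\<^bsub>B\<^esub> b') =
    elem_tensor A B \<one>\<^bsub>A\<^esub> b \<oplus>\<^bsub>spatial_tensor A B\<^esub> elem_tensor A B \<one>\<^bsub>A\<^esub> b'"
    by (simp add: elem_tensor_eq)
qed (auto simp: elem_tensor_mult elem_tensor_one)

text \<open>Product states are bounded by the spatial seminorm, so they may be used to test
  equations between classes.\<close>

lemma product_functional_cong:
  assumes "is_state A \<phi>" "is_state B \<psi>" "t \<in> carrier FT" "u \<in> carrier FT" "incl t = incl u"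
  shows "product_functional \<phi> \<psi> t = product_functional \<phi> \<psi> u"
proof -
  have 1: "product_functional \<phi> \<psi> \<one>\<^bsub>FT\<^esub> = 1"
    using assms(1,2) by (simp add: product_functional_eq_lin ft.alg_one is_state_def DirProd_def)
  have "cmod (product_functional \<phi> \<psi> (t \<ominus>\<^bsub>FT\<^esub> u)) \<le> spatial_seminorm A B (t \<ominus>\<^bsub>FT\<^esub> u)"
    unfolding spatial_seminorm_eq using assms 1 by (intro fam.func_le_gns) auto
  then show ?thesis
    using assms by (simp add: incl_eq_iff product_functional_eq_lin lin_FT_minus)
qed

end


section \<open>Functoriality of the spatial seminorm\<close>

lemma star_homD:
  assumes "star_hom A B f"
  shows "f \<in> ring_hom A B" "a \<in> carrier A \<Longrightarrow> f a \<in> carrier B"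
    "a \<in> carrier A \<Longrightarrow> b \<in> carrier A \<Longrightarrow> f (a \<oplus>\<^bsub>A\<^esub> b) = f a \<oplus>\<^bsub>B\<^esub> f b"
    "a \<in> carrier A \<Longrightarrow> b \<in> carrier A \<Longrightarrow> f (a \<otimes>\<^bsub>A\<^esub> b) = f a \<otimes>\<^bsub>B\<^esub> f b"
    "f \<one>\<^bsub>A\<^esub> = \<one>\<^bsub>B\<^esub>"
    "a \<in> carrier A \<Longrightarrow> f (c \<odot>\<^bsub>A\<^esub> a) = c \<odot>\<^bsub>B\<^esub> f a"
    "a \<in> carrier A \<Longrightarrow> f (star A a) = star B (f a)"
  using assms unfolding star_hom_def by (auto simp: ring_hom_def)

lemma star_hom_id: "star_hom A A id"
  by (simp add: star_hom_def ring_hom_def)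

lemma state_comp:
  assumes f: "star_hom A C f" and n: "\<And>a. a \<in> carrier A \<Longrightarrow> nrm C (f a) \<le> nrm A a"
    and cl: "\<And>a. a \<in> carrier A \<Longrightarrow> star A a \<in> carrier A" and \<phi>: "is_state C \<phi>"
  shows "is_state A (\<phi> \<circ> f)"
proof -
  have "cmod (\<phi> (f a)) \<le> nrm A a" if "a \<in> carrier A" for a
    using \<phi> n[OF that] star_homD(2)[OF f that] unfolding is_state_def by (meson order_trans)
  then show ?thesis
    using \<phi> unfolding is_state_def by (simp add: star_homD[OF f] cl)
qed

lemma formal_map_support: "{z. formal_map f g t z \<noteq> 0} \<subseteq> map_prod f g ` {w. t w \<noteq> 0}"
proof
  fix z assume "z \<in> {z. formal_map f g t z \<noteq> 0}"
  then have "{w. t w \<noteq> 0 \<and> map_prod f g w = z} \<noteq> {}"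
    unfolding formal_map_def by (metis (mono_tags, lifting) mem_Collect_eq sum.empty)
  then show "z \<in> map_prod f g ` {w. t w \<noteq> 0}" by blast
qed

lemma lin_formal_map:
  assumes "finite {z. t z \<noteq> 0}"
  shows "lin h (formal_map f g t) = lin (h \<circ> map_prod f g) t"
proof -
  let ?S = "{w. t w \<noteq> 0}" and ?g = "map_prod f g"
  have "lin h (formal_map f g t) = (\<Sum>z\<in>?g ` ?S. formal_map f g t z * h z)"
    using assms formal_map_support[of f g t] by (intro lin_superset) auto
  also have "\<dots> = (\<Sum>z\<in>?g ` ?S. \<Sum>w\<in>{w\<in>?S. ?g w = z}. t w * h (?g w))"
    unfolding formal_map_def sum_distrib_right by (intro sum.cong) auto
  also have "\<dots> = (\<Sum>w\<in>?S. t w * h (?g w))"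
    using assms by (rule sum.image_gen[symmetric])
  finally show ?thesis by (simp add: lin_def)
qed

text \<open>Contractivity pulls states of C and D back to states of A and B, and surjectivity lifts
  the test vectors that enter the spatial seminorm of the target.\<close>

locale spatial_contraction = src: spatial_pair A B + tgt: spatial_pair C D
  for A :: "('a, 'x) cstar_algebra_scheme" and B :: "('b, 'y) cstar_algebra_scheme"
    and C :: "('c, 'z) cstar_algebra_scheme" and D :: "('d, 'w) cstar_algebra_scheme" +
  fixes f :: "'a \<Rightarrow> 'c" and g :: "'b \<Rightarrow> 'd"
  assumes f: "star_hom A C f" and f_nrm: "\<And>a. a \<in> carrier A \<Longrightarrow> nrm C (f a) \<le> nrm A a"
    and f_surj: "f ` carrier A = carrier C"
    and g: "star_hom B D g" and g_nrm: "\<And>b. b \<in> carrier B \<Longrightarrow> nrm D (g b) \<le> nrm B b"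
    and g_surj: "g ` carrier B = carrier D"
begin

lemma formal_map_closed: assumes t: "t \<in> carrier (formal_tensors A B)"
  shows "formal_map f g t \<in> carrier (formal_tensors C D)"
proof -
  let ?S = "{w. t w \<noteq> 0}"
  have "finite (map_prod f g ` ?S)" using src.ft.alg_finite[OF t] by simp
  moreover have "map_prod f g ` ?S \<subseteq> carrier C \<times> carrier D"
    using src.ft.alg_support[OF t] star_homD(2)[OF f] star_homD(2)[OF g] by fastforce
  ultimately show ?thesis
    unfolding tgt.ft.alg_carrier_iff using formal_map_support[of f g t] by (meson finite_subset subset_trans)
qed

lemma lin_map: "t \<in> carrier (formal_tensors A B) \<Longrightarrow> lin h (formal_map f g t) = lin (h \<circ> map_prod f g) t"
  by (rule lin_formal_map) (rule src.ft.alg_finite)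

lemma formal_map_mult:
  assumes t: "t \<in> carrier (formal_tensors A B)" and u: "u \<in> carrier (formal_tensors A B)"
  shows "formal_map f g (t \<otimes>\<^bsub>formal_tensors A B\<^esub> u) =
    formal_map f g t \<otimes>\<^bsub>formal_tensors C D\<^esub> formal_map f g u"
proof (rule tgt.ft.alg_ext)
  fix h
  show "lin h (formal_map f g (t \<otimes>\<^bsub>formal_tensors A B\<^esub> u)) =
    lin h (formal_map f g t \<otimes>\<^bsub>formal_tensors C D\<^esub> formal_map f g u)"
    using t u
    by (simp add: lin_map src.ft.lin_mult tgt.ft.lin_mult formal_map_closed o_def)
       (auto simp: star_homD[OF f] star_homD[OF g] intro!: src.ft.lin_cong)
qed (use t u formal_map_closed in auto)

lemma formal_map_add:
  assumes t: "t \<in> carrier (formal_tensors A B)" and u: "u \<in> carrier (formal_tensors A B)"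
  shows "formal_map f g (t \<oplus>\<^bsub>formal_tensors A B\<^esub> u) =
    formal_map f g t \<oplus>\<^bsub>formal_tensors C D\<^esub> formal_map f g u"
  by (rule tgt.ft.alg_ext)
     (use t u in \<open>auto simp: formal_map_closed lin_map src.ft.lin_add tgt.ft.lin_add\<close>)

lemma formal_map_smult:
  assumes t: "t \<in> carrier (formal_tensors A B)"
  shows "formal_map f g (c \<odot>\<^bsub>formal_tensors A B\<^esub> t) = c \<odot>\<^bsub>formal_tensors C D\<^esub> formal_map f g t"
  by (rule tgt.ft.alg_ext)
     (use t in \<open>auto simp: formal_map_closed lin_map src.ft.lin_smult tgt.ft.lin_smult\<close>)

lemma formal_map_star:
  assumes t: "t \<in> carrier (formal_tensors A B)"
  shows "formal_map f g (star (formal_tensors A B) t) = star (formal_tensors C D) (formal_map f g t)"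
proof (rule tgt.ft.alg_ext)
  fix h
  show "lin h (formal_map f g (star (formal_tensors A B) t)) =
    lin h (star (formal_tensors C D) (formal_map f g t))"
    using t
    by (simp add: lin_map src.ft.lin_star tgt.ft.lin_star formal_map_closed o_def)
       (auto simp: star_homD[OF f] star_homD[OF g] intro!: src.ft.lin_cong)
qed (use t formal_map_closed in auto)

lemma formal_map_monomial:
  assumes "a \<in> carrier A" "b \<in> carrier B"
  shows "formal_map f g (monomial (a, b)) = monomial (f a, g b)"
  by (rule tgt.ft.alg_ext)
     (use assms in \<open>auto simp: formal_map_closed lin_map star_homD[OF f] star_homD[OF g]\<close>)

lemma formal_map_one: "formal_map f g \<one>\<^bsub>formal_tensors A B\<^esub> = \<one>\<^bsub>formal_tensors C D\<^esub>"
  by (simp add: src.ft.alg_one tgt.ft.alg_one DirProd_def formal_map_monomial star_homD[OF f] star_homD[OF g])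

lemma formal_map_hom: "formal_map f g \<in> ring_hom (formal_tensors A B) (formal_tensors C D)"
  by (rule ring_hom_memI) (auto simp: formal_map_closed formal_map_mult formal_map_add formal_map_one)

text \<open>Induction on a finite set containing the support: one pair is lifted leg by leg and
  keeps its coefficient.\<close>

lemma formal_map_surj:
  assumes "y \<in> carrier (formal_tensors C D)"
  shows "\<exists>x\<in>carrier (formal_tensors A B). formal_map f g x = y"
proof -
  have "finite S \<Longrightarrow> \<forall>y\<in>carrier (formal_tensors C D). {z. y z \<noteq> 0} \<subseteq> S \<longrightarrow>
      (\<exists>x\<in>carrier (formal_tensors A B). formal_map f g x = y)" for S
  proof (induction S rule: finite_induct)
    case empty
    have "formal_map f g \<zero>\<^bsub>formal_tensors A B\<^esub> = (\<lambda>_. 0)"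
      unfolding formal_map_def formal_tensors_def monoid_star_algebra_def by auto
    moreover have "y = (\<lambda>_. 0)" if "{z. y z \<noteq> 0} \<subseteq> {}" for y :: "'c \<times> 'd \<Rightarrow> complex"
      using that by auto
    ultimately show ?case using src.fam.zero_closed by metis
  next
    case (insert z S)
    show ?case
    proof (intro ballI impI)
      fix y assume y: "y \<in> carrier (formal_tensors C D)" "{z. y z \<noteq> 0} \<subseteq> insert z S"
      show "\<exists>x\<in>carrier (formal_tensors A B). formal_map f g x = y"
      proof (cases "y z = 0")
        case True
        then have "{z. y z \<noteq> 0} \<subseteq> S" using y by auto
        then show ?thesis using insert.IH y by blast
      next
        case False
        then have "z \<in> carrier C \<times> carrier D" using y tgt.ft.alg_support by blast
        then obtain a b where ab: "a \<in> carrier A" "b \<in> carrier B" "z = (f a, g b)"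
          using f_surj g_surj by blast
        define y' where "y' = y(z := 0)"
        have "y' \<in> carrier (formal_tensors C D)"
          using y(1) unfolding tgt.ft.alg_carrier_iff y'_def by (auto elim: rev_finite_subset)
        moreover have "{z. y' z \<noteq> 0} \<subseteq> S" using y by (auto simp: y'_def split: if_splits)
        ultimately obtain x' where x': "x' \<in> carrier (formal_tensors A B)" "formal_map f g x' = y'"
          using insert.IH by blast
        let ?x = "x' \<oplus>\<^bsub>formal_tensors A B\<^esub> y z \<odot>\<^bsub>formal_tensors A B\<^esub> monomial (a, b)"
        have m: "monomial (a, b) \<in> carrier (formal_tensors A B)" using ab by auto
        then have "formal_map f g ?x = y' \<oplus>\<^bsub>formal_tensors C D\<^esub> y z \<odot>\<^bsub>formal_tensors C D\<^esub> monomial z"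
          using x' ab by (simp add: formal_map_add formal_map_smult formal_map_monomial)
        also have "\<dots> = y"
          by (auto simp: formal_tensors_def monoid_star_algebra_def y'_def monomial_def fun_eq_iff)
        finally show ?thesis using x' m by (intro bexI[of _ ?x]) auto
      qed
    qed
  qed
  then show ?thesis using assms tgt.ft.alg_finite[OF assms] by blast
qed

lemma product_functional_map:
  "t \<in> carrier (formal_tensors A B) \<Longrightarrow>
    product_functional \<phi> \<psi> (formal_map f g t) = product_functional (\<phi> \<circ> f) (\<psi> \<circ> g) t"
  unfolding tgt.product_functional_eq_lin src.product_functional_eq_lin
  by (simp add: lin_map o_def)

text \<open>For a lift x of the test vector y, the pulled back product state gives t x the same
  length that the given state gives to the image of t times y.\<close>

lemma spatial_seminorm_map_le:
  assumes t: "t \<in> carrier (formal_tensors A B)"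
  shows "spatial_seminorm C D (formal_map f g t) \<le> spatial_seminorm A B t"
  unfolding tgt.spatial_seminorm_eq
proof (rule tgt.fam.gns_least)
  show "formal_map f g t \<in> carrier (formal_tensors C D)" using t by (rule formal_map_closed)
  show "0 \<le> spatial_seminorm A B t" using t by simp
  fix \<omega> y assume "\<omega> \<in> {product_functional \<phi> \<psi> |\<phi> \<psi>. is_state C \<phi> \<and> is_state D \<psi>}"
    and y: "y \<in> carrier (formal_tensors C D)" and unit: "tgt.fam.len \<omega> y = 1"
  then obtain \<phi> \<psi> where w: "\<omega> = product_functional \<phi> \<psi>" "is_state C \<phi>" "is_state D \<psi>" by blast
  obtain x where x: "x \<in> carrier (formal_tensors A B)" "formal_map f g x = y"
    using formal_map_surj[OF y] by blast
  have st: "is_state A (\<phi> \<circ> f)" "is_state B (\<psi> \<circ> g)"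
    using state_comp[OF f f_nrm src.A.star_closed w(2)] state_comp[OF g g_nrm src.B.star_closed w(3)] by auto
  let ?\<omega>' = "product_functional (\<phi> \<circ> f) (\<psi> \<circ> g)"
  have len: "tgt.fam.len \<omega> (formal_map f g u) = src.fam.len ?\<omega>' u" if "u \<in> carrier (formal_tensors A B)" for u
    using that unfolding w(1)
    by (simp add: formal_map_star[symmetric] formal_map_mult[symmetric] product_functional_map)
  have "src.fam.len ?\<omega>' x = 1" using unit x len by metis
  moreover have "?\<omega>' \<in> {product_functional \<phi> \<psi> |\<phi> \<psi>. is_state A \<phi> \<and> is_state B \<psi>}" using st by blast
  ultimately have "src.fam.len ?\<omega>' (t \<otimes>\<^bsub>formal_tensors A B\<^esub> x) \<le> spatial_seminorm A B t"
    unfolding src.spatial_seminorm_eq using t x by (intro src.fam.len_le_gns_unit)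
  moreover have "tgt.fam.len \<omega> (formal_map f g t \<otimes>\<^bsub>formal_tensors C D\<^esub> y) = src.fam.len ?\<omega>' (t \<otimes>\<^bsub>formal_tensors A B\<^esub> x)"
    using len[of "t \<otimes>\<^bsub>formal_tensors A B\<^esub> x"] t x by (simp add: formal_map_mult)
  ultimately show "tgt.fam.len \<omega> (formal_map f g t \<otimes>\<^bsub>formal_tensors C D\<^esub> y) \<le> spatial_seminorm A B t"
    by simp
qed

text \<open>By contractivity, the image of any sequence representing \<open>src.incl t\<close>
  differs from the constant image by a null sequence, so the union defining
  \<open>tensor_map\<close> is one class.\<close>

lemma tensor_map_incl:
  assumes t: "t \<in> carrier (formal_tensors A B)"
  shows "tensor_map C D f g (src.incl t) = tgt.incl (formal_map f g t)"
proof -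
  have "tensor_class C D (\<lambda>n. formal_map f g (X n)) = tgt.incl (formal_map f g t)"
    if X: "X \<in> src.incl t" for X
  proof -
    have X': "\<And>n. X n \<in> carrier (formal_tensors A B)"
      "(\<lambda>n. spatial_seminorm A B (X n \<ominus>\<^bsub>formal_tensors A B\<^esub> t)) \<longlonglongrightarrow> 0"
      using X t unfolding src.incl_eq_cls by (auto simp: src.sp.mem_cls_iff)
    have minus: "formal_map f g (u \<ominus>\<^bsub>formal_tensors A B\<^esub> v) =
        formal_map f g u \<ominus>\<^bsub>formal_tensors C D\<^esub> formal_map f g v"
      if "u \<in> carrier (formal_tensors A B)" "v \<in> carrier (formal_tensors A B)" for u v
      using that by (simp add: a_minus_def src.fam.minus_eq_smult tgt.fam.minus_eq_smult
          formal_map_add formal_map_smult formal_map_closed)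
    have "(\<lambda>n. spatial_seminorm C D (formal_map f g (X n) \<ominus>\<^bsub>formal_tensors C D\<^esub> formal_map f g t)) \<longlonglongrightarrow> 0"
    proof (rule tendsto_sandwich[OF _ _ tendsto_const X'(2)])
      show "\<forall>\<^sub>F n in sequentially. 0 \<le> spatial_seminorm C D (formal_map f g (X n) \<ominus>\<^bsub>formal_tensors C D\<^esub> formal_map f g t)"
        using X' t by (simp add: formal_map_closed)
      show "\<forall>\<^sub>F n in sequentially. spatial_seminorm C D (formal_map f g (X n) \<ominus>\<^bsub>formal_tensors C D\<^esub> formal_map f g t)
          \<le> spatial_seminorm A B (X n \<ominus>\<^bsub>formal_tensors A B\<^esub> t)"
        using X' t by (simp add: minus[symmetric] spatial_seminorm_map_le)
    qed
    then have "(\<lambda>n. formal_map f g (X n)) \<in> tgt.incl (formal_map f g t)"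
      using X' t unfolding tgt.incl_eq_cls by (simp add: tgt.sp.mem_cls_iff formal_map_closed)
    then show ?thesis
      using t unfolding tgt.incl_eq_cls tensor_class_def
      by (intro tgt.sp.cls_eqI) (auto simp: formal_map_closed)
  qed
  moreover have "(\<lambda>_. t) \<in> src.incl t" unfolding src.incl_eq_cls using t by (intro src.sp.self_mem_cls) auto
  ultimately show ?thesis unfolding tensor_map_def by blast
qed

end


section \<open>Characters and states of a completion\<close>

context seminormed_star_algebra
begin

text \<open>Partial sums of the geometric series of x in Horner form, with k + 1 terms.\<close>

fun neumann :: "'a \<Rightarrow> nat \<Rightarrow> 'a" where
  "neumann x 0 = \<one>"
| "neumann x (Suc k) = \<one> \<oplus> x \<otimes> neumann x k"

lemma neumann_closed [simp]: "x \<in> carrier A \<Longrightarrow> neumann x k \<in> carrier A"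
  by (induction k) auto

lemma one_plus_minus:
  assumes "a \<in> carrier A" "b \<in> carrier A" shows "(\<one> \<oplus> a) \<ominus> (\<one> \<oplus> b) = a \<ominus> b"
  using assms by (simp add: add_minus_swap) (simp add: a_minus_def r_neg)

lemma mult_minus_right:
  "a \<in> carrier A \<Longrightarrow> b \<in> carrier A \<Longrightarrow> c \<in> carrier A \<Longrightarrow> a \<otimes> b \<ominus> a \<otimes> c = a \<otimes> (b \<ominus> c)"
  by (simp add: a_minus_def r_distr r_minus)

lemma s_neumann:
  assumes x: "x \<in> carrier A" "s x \<le> q" and q: "q < 1"
  shows "s (neumann x k) \<le> 1 / (1 - q)"
proof (induction k)
  case 0
  have "0 \<le> q" using x s_nonneg[of x] by linarith
  then have "1 \<le> 1 / (1 - q)" using q by simp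
  then show ?case using s_one by simp
next
  case (Suc k)
  have "0 \<le> q" using x s_nonneg[of x] by linarith
  have "s (neumann x (Suc k)) \<le> s \<one> + s (x \<otimes> neumann x k)" using x by (simp add: s_triangle)
  also have "\<dots> \<le> 1 + s x * s (neumann x k)" using x s_one s_mult by (intro add_mono) auto
  also have "\<dots> \<le> 1 + q * (1 / (1 - q))"
    using x Suc \<open>0 \<le> q\<close> by (intro add_left_mono mult_mono) auto
  also have "\<dots> = 1 / (1 - q)" using q by (simp add: field_simps)
  finally show ?case .
qed

lemma s_neumann_tail:
  assumes x: "x \<in> carrier A" "s x \<le> q" and q: "q < 1"
  shows "s (neumann x (n + j) \<ominus> neumann x n) \<le> q ^ n * (1 / (1 - q))"
proof (induction n)
  case 0
  have q0: "0 \<le> q" using x s_nonneg[of x] by linarith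
  show ?case
  proof (cases j)
    case 0
    then show ?thesis using q by (simp add: a_minus_def r_neg)
  next
    case (Suc i)
    have "neumann x j \<ominus> \<one> = x \<otimes> neumann x i"
      using x one_plus_minus[of "x \<otimes> neumann x i" \<zero>] Suc by (simp add: a_minus_def)
    then have "s (neumann x j \<ominus> \<one>) \<le> s x * s (neumann x i)" using x s_mult by simp
    also have "\<dots> \<le> 1 * (1 / (1 - q))"
      using x q s_neumann[OF x q] by (intro mult_mono) auto
    finally show ?thesis by simp
  qed
next
  case (Suc n)
  have q0: "0 \<le> q" using x s_nonneg[of x] by linarith
  have "s (neumann x (Suc n + j) \<ominus> neumann x (Suc n)) = s (x \<otimes> (neumann x (n + j) \<ominus> neumann x n))"
    using x by (simp add: one_plus_minus mult_minus_right)
  also have "\<dots> \<le> s x * s (neumann x (n + j) \<ominus> neumann x n)" using x by (simp add: s_mult)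
  also have "\<dots> \<le> q * (q ^ n * (1 / (1 - q)))" using x Suc q0 by (intro mult_mono) auto
  finally show ?case by simp
qed

text \<open>The partial sums are Lipschitz in x on the ball of radius q, with a constant independent
  of their length. This permits x and the length to vary together.\<close>

lemma s_neumann_diff:
  assumes x: "x \<in> carrier A" "s x \<le> q" and y: "y \<in> carrier A" "s y \<le> q" and q: "q < 1"
  shows "s (neumann x n \<ominus> neumann y n) \<le> (1 / (1 - q))\<^sup>2 * s (x \<ominus> y)"
proof (induction n)
  case 0
  then show ?case using x y by (simp add: a_minus_def r_neg)
next
  case (Suc n)
  let ?K = "1 / (1 - q)"
  have q0: "0 \<le> q" using x s_nonneg[of x] by linarith
  have "s (neumann x (Suc n) \<ominus> neumann y (Suc n)) =
      s (x \<otimes> (neumann x n \<ominus> neumann y n) \<oplus> (x \<ominus> y) \<otimes> neumann y n)"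
    using x y by (simp add: one_plus_minus mult_minus_split)
  also have "\<dots> \<le> s x * s (neumann x n \<ominus> neumann y n) + s (x \<ominus> y) * s (neumann y n)"
    using x y by (intro order_trans[OF s_triangle] add_mono s_mult) auto
  also have "\<dots> \<le> q * (?K\<^sup>2 * s (x \<ominus> y)) + s (x \<ominus> y) * ?K"
    using x y q0 Suc s_neumann[OF y q] by (intro add_mono mult_mono) auto
  also have "\<dots> = ?K\<^sup>2 * s (x \<ominus> y)"
    using q by (simp add: power2_eq_square divide_simps) (simp add: algebra_simps)
  finally show ?case .
qed

text \<open>The class of Y is the inverse of 1 minus the class of X. The diagonal sequence, the n-th
  partial sum at X n, represents it directly, without a limit inside the completion.\<close>

lemma neumann_inverse:
  assumes X: "cauchy X" and q: "q < 1" "\<And>n. s (X n) \<le> q"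
  shows "\<exists>Y. cauchy Y \<and> cls Y = cls (\<lambda>n. \<one> \<oplus> X n \<otimes> Y n)"
proof -
  let ?K = "1 / (1 - q)" and ?Y = "\<lambda>n. neumann (X n) n"
  have q0: "0 \<le> q" using q(2)[of 0] X s_nonneg[of "X 0"] by (meson cauchy_closed order_trans)
  have tail: "s (neumann x m \<ominus> neumann x n) \<le> (q ^ m + q ^ n) * ?K" if "x \<in> carrier A" "s x \<le> q" for x m n
  proof (cases "n \<le> m")
    case True
    then have "s (neumann x m \<ominus> neumann x n) \<le> q ^ n * ?K"
      using s_neumann_tail[OF that q(1), of n "m - n"] by simp
    also have "\<dots> \<le> (q ^ m + q ^ n) * ?K" using q(1) q0 by (intro mult_right_mono) auto
    finally show ?thesis .
  next
    case False
    then have "s (neumann x m \<ominus> neumann x n) \<le> q ^ m * ?K"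
      using s_neumann_tail[OF that q(1), of m "n - m"] that by (simp add: s_minus_commute)
    also have "\<dots> \<le> (q ^ m + q ^ n) * ?K" using q(1) q0 by (intro mult_right_mono) auto
    finally show ?thesis .
  qed
  have qn: "(\<lambda>n. q ^ n) \<longlonglongrightarrow> 0" using q(1) q0 by (intro LIMSEQ_realpow_zero) auto
  have Y: "cauchy ?Y"
  proof (rule cauchyI)
    fix m n
    \<comment> \<open>The length of the partial sum is changed first, with the argument X m fixed,
      and then the argument.\<close>
    have "?Y m \<ominus> ?Y n = (neumann (X m) m \<ominus> neumann (X m) n) \<oplus> (neumann (X m) n \<ominus> neumann (X n) n)"
      using X by (simp add: a_minus_def a_assoc) (simp add: a_assoc[symmetric] l_neg)
    then have "s (?Y m \<ominus> ?Y n) \<le> s (neumann (X m) m \<ominus> neumann (X m) n) + s (neumann (X m) n \<ominus> neumann (X n) n)"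
      using X by (simp add: s_triangle)
    also have "\<dots> \<le> (q ^ m + q ^ n) * ?K + ?K\<^sup>2 * s (X m \<ominus> X n)"
      using X q by (intro add_mono tail s_neumann_diff) auto
    finally show "s (?Y m \<ominus> ?Y n) \<le> (q ^ m + q ^ n) * ?K + ?K\<^sup>2 * s (X m \<ominus> X n)" .
    have "((\<lambda>z. (q ^ fst z + q ^ snd z) * ?K + ?K\<^sup>2 * s (X (fst z) \<ominus> X (snd z))) \<longlongrightarrow> (0 + 0) * ?K + ?K\<^sup>2 * 0) (sequentially \<times>\<^sub>F sequentially)"
      using cauchy_tendsto[OF X] unfolding split_def
      by (intro tendsto_intros filterlim_compose[OF qn filterlim_fst] filterlim_compose[OF qn filterlim_snd])
    then show "((\<lambda>(m, n). (q ^ m + q ^ n) * ?K + ?K\<^sup>2 * s (X m \<ominus> X n)) \<longlongrightarrow> 0) (sequentially \<times>\<^sub>F sequentially)"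
      by (simp add: split_def)
  qed (use X in auto)
  have "(\<lambda>n. s (?Y n \<ominus> (\<one> \<oplus> X n \<otimes> ?Y n))) \<longlonglongrightarrow> 0"
  proof (rule tendsto_sandwich[OF _ _ tendsto_const])
    show "\<forall>\<^sub>F n in sequentially. s (?Y n \<ominus> (\<one> \<oplus> X n \<otimes> ?Y n)) \<le> q ^ n * ?K"
    proof (intro always_eventually allI)
      fix n
      \<comment> \<open>Substituting into 1 + x y adds one further term to the partial sum, so the
        defect is a tail of the series.\<close>
      have "s (?Y n \<ominus> neumann (X n) (Suc n)) = s (neumann (X n) (n + 1) \<ominus> neumann (X n) n)"
        using X by (subst s_minus_commute) auto
      also have "\<dots> \<le> q ^ n * ?K" using X q by (intro s_neumann_tail) auto
      finally show "s (?Y n \<ominus> (\<one> \<oplus> X n \<otimes> ?Y n)) \<le> q ^ n * ?K" by simp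
    qed
    show "(\<lambda>n. q ^ n * ?K) \<longlonglongrightarrow> 0" using qn by (rule tendsto_mult_left_zero)
  qed (use X in auto)
  then have "cls ?Y = cls (\<lambda>n. \<one> \<oplus> X n \<otimes> ?Y n)"
    using X Y by (simp add: cls_eq_iff cauchy_add cauchy_mult)
  then show ?thesis using Y by blast
qed

text \<open>If a value of \<theta> exceeded the norm, rescaling would give D of norm below 1 with
  value 1 at D. The Neumann series solves y = 1 + D y, and applying \<theta> gives the contradiction
  \<theta> y = 1 + \<theta> y.\<close>

lemma character_contractive:
  assumes hom: "\<And>C D. C \<in> carrier (completion A s) \<Longrightarrow> D \<in> carrier (completion A s) \<Longrightarrow>
      \<theta> (C \<oplus>\<^bsub>completion A s\<^esub> D) = \<theta> C + \<theta> D"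
    "\<And>C D. C \<in> carrier (completion A s) \<Longrightarrow> D \<in> carrier (completion A s) \<Longrightarrow>
      \<theta> (C \<otimes>\<^bsub>completion A s\<^esub> D) = \<theta> C * \<theta> D"
    "\<And>c C. C \<in> carrier (completion A s) \<Longrightarrow> \<theta> (c \<odot>\<^bsub>completion A s\<^esub> C) = c * \<theta> C"
    "\<theta> \<one>\<^bsub>completion A s\<^esub> = (1::complex)"
    and C: "C \<in> carrier (completion A s)"
  shows "cmod (\<theta> C) \<le> nrm (completion A s) C"
proof (rule ccontr)
  assume gt: "\<not> cmod (\<theta> C) \<le> nrm (completion A s) C"
  interpret N: seminormed_star_algebra "completion A s" "nrm (completion A s)"
    by (intro seminormed_star_algebra.intro complex_star_algebra_completion
        seminormed_star_algebra_axioms.intro cstar_seminorm_completion)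
  have nz: "cmod (\<theta> C) > 0" using gt N.s_nonneg[OF C] by linarith
  define D where "D = (1 / \<theta> C) \<odot>\<^bsub>completion A s\<^esub> C"
  have D: "D \<in> carrier (completion A s)" using C by (simp add: D_def)
  have chi: "\<theta> D = 1" using nz C by (simp add: D_def hom)
  have "nrm (completion A s) D < 1"
    using gt nz C by (simp add: D_def N.s_smult norm_divide)
  then obtain q where q: "nrm (completion A s) D < q" "q < 1" using dense by blast
  obtain X where X: "cauchy X" "D = cls X" using D by (rule completionE)
  have "(\<lambda>n. s (X n)) \<longlonglongrightarrow> nrm (completion A s) D" using nrm_tendsto X by simp
  then have "\<forall>\<^sub>F n in sequentially. s (X n) < q" using q order_tendstoD(2) by blast
  then obtain M where M: "\<And>n. n \<ge> M \<Longrightarrow> s (X n) < q" by (auto simp: eventually_sequentially)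
  \<comment> \<open>The bound q holds only eventually for X; replacing the initial terms by zero
    makes it hold everywhere without changing the class.\<close>
  define X' where "X' n = (if n \<ge> M then X n else \<zero>)" for n
  have "(\<lambda>n. s (X' n \<ominus> X n)) \<longlonglongrightarrow> 0"
    by (rule tendsto_eventually, rule eventually_sequentiallyI[of M])
       (use X in \<open>simp add: X'_def a_minus_def r_neg\<close>)
  then have X'_mem: "X' \<in> cls X" using X by (simp add: mem_cls_iff X'_def)
  have X': "cauchy X'" using mem_cls_cauchy[OF X(1) X'_mem] .
  have D_eq: "D = cls X'" using cls_eqI[OF X(1) X'_mem] X(2) by simp
  have q0: "0 < q" using q N.s_nonneg[OF D] by linarith
  have bound: "s (X' n) \<le> q" for n using M[of n] q0 by (auto simp: X'_def)
  obtain Y where Y: "cauchy Y" "cls Y = cls (\<lambda>n. \<one> \<oplus> X' n \<otimes> Y n)"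
    using neumann_inverse[OF X' q(2) bound] by blast
  have "\<one>\<^bsub>completion A s\<^esub> \<oplus>\<^bsub>completion A s\<^esub> D \<otimes>\<^bsub>completion A s\<^esub> cls Y = cls (\<lambda>n. \<one> \<oplus> X' n \<otimes> Y n)"
    unfolding D_eq completion_one
    using Y(1) X' by (simp add: completion_mult completion_add cauchy_mult)
  with Y(2) have "cls Y = \<one>\<^bsub>completion A s\<^esub> \<oplus>\<^bsub>completion A s\<^esub> D \<otimes>\<^bsub>completion A s\<^esub> cls Y"
    by (rule trans[OF _ sym])
  then have "\<theta> (cls Y) = \<theta> (\<one>\<^bsub>completion A s\<^esub> \<oplus>\<^bsub>completion A s\<^esub> D \<otimes>\<^bsub>completion A s\<^esub> cls Y)"
    by (rule arg_cong)
  also have "\<dots> = 1 + \<theta> D * \<theta> (cls Y)"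
    using D completion_mem[OF Y(1)] by (simp add: hom)
  finally show False by (simp add: chi)
qed

text \<open>Extension by continuity: the value on a class is the limit along a chosen
  representative, and boundedness by \<open>s\<close> makes it independent of the choice.\<close>

lemma state_extends:
  assumes w: "positive_functional A \<omega>" "\<And>a. a \<in> carrier A \<Longrightarrow> cmod (\<omega> a) \<le> s a" "\<omega> \<one> = 1"
  obtains \<psi> where "is_state (completion A s) \<psi>" "\<And>a. a \<in> carrier A \<Longrightarrow> \<psi> (cls (\<lambda>_. a)) = \<omega> a"
proof -
  interpret w: positive_functional A \<omega> by (rule w)
  define \<psi> where "\<psi> C = lim (\<lambda>n. \<omega> ((SOME X. cauchy X \<and> C = cls X) n))" for C
  have conv: "convergent (\<lambda>n. \<omega> (X n))" if "cauchy X" for X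
  proof (rule cauchy_convergent[OF that])
    fix x y assume "x \<in> carrier A" "y \<in> carrier A"
    then show "dist (\<omega> x) (\<omega> y) \<le> s (x \<ominus> y)"
      using w(2)[of "x \<ominus> y"] by (simp add: dist_norm w.func_diff)
  qed
  have lim: "(\<lambda>n. \<omega> (X n)) \<longlonglongrightarrow> \<psi> (cls X)" if X: "cauchy X" for X
  proof -
    define Z where "Z = (SOME Z. cauchy Z \<and> cls X = cls Z)"
    have Z: "cauchy Z" "cls X = cls Z"
      using someI[of "\<lambda>Z. cauchy Z \<and> cls X = cls Z" X] X unfolding Z_def by auto
    have "(\<lambda>n. \<omega> (Z n)) \<longlonglongrightarrow> \<psi> (cls X)"
      using conv[OF Z(1)] unfolding \<psi>_def Z_def[symmetric] by (simp add: convergent_LIMSEQ_iff)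
    moreover have "(\<lambda>n. \<omega> (X n) - \<omega> (Z n)) \<longlonglongrightarrow> 0"
    proof (rule Lim_null_comparison)
      show "(\<lambda>n. s (X n \<ominus> Z n)) \<longlonglongrightarrow> 0" using X Z by (simp add: cls_eq_iff)
      show "\<forall>\<^sub>F n in sequentially. norm (\<omega> (X n) - \<omega> (Z n)) \<le> s (X n \<ominus> Z n)"
        using X Z w(2)[of "X n \<ominus> Z n" for n] by (simp add: w.func_diff)
    qed
    ultimately show ?thesis using tendsto_add by fastforce
  qed
  have eqI: "\<psi> (cls X) = c" if "cauchy X" "(\<lambda>n. \<omega> (X n)) \<longlonglongrightarrow> c" for X c
    using LIMSEQ_unique[OF lim] that by blast
  note cl = cauchy_add cauchy_mult cauchy_smult cauchy_star
  have const: "\<psi> (cls (\<lambda>_. a)) = \<omega> a" if "a \<in> carrier A" for a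
    using that by (intro eqI) auto
  have pos: "\<psi> (cls (\<lambda>n. star A (X n) \<otimes> X n)) \<in> \<real>\<^sub>\<ge>\<^sub>0" if X: "cauchy X" for X
  proof (rule Lim_in_closed_set[OF closed_nonneg_Reals_complex _ _ lim])
    show "cauchy (\<lambda>n. star A (X n) \<otimes> X n)" using X by (simp add: cl)
    show "\<forall>\<^sub>F n in sequentially. \<omega> (star A (X n) \<otimes> X n) \<in> \<real>\<^sub>\<ge>\<^sub>0"
      using X w.func_pos by simp
  qed simp
  have "is_state (completion A s) \<psi>"
    unfolding is_state_def
  proof (intro conjI ballI allI)
    fix C assume "C \<in> carrier (completion A s)"
    then obtain X where X: "cauchy X" "C = cls X" by (rule completionE)
    show "\<psi> (star (completion A s) C \<otimes>\<^bsub>completion A s\<^esub> C) \<in> \<real>\<^sub>\<ge>\<^sub>0"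
      using X pos by (simp add: completion_ops cl)
    show "cmod (\<psi> C) \<le> nrm (completion A s) C"
      unfolding X(2)
      by (rule LIMSEQ_le[OF tendsto_norm[OF lim[OF X(1)]] nrm_tendsto[OF X(1)]]) (use X w(2) in auto)
    show "\<psi> (c \<odot>\<^bsub>completion A s\<^esub> C) = c * \<psi> C" for c
      using X by (simp add: completion_ops, intro eqI) (auto simp: cl w.func_smult intro!: tendsto_mult lim)
    fix D assume "D \<in> carrier (completion A s)"
    then obtain Y where Y: "cauchy Y" "D = cls Y" by (rule completionE)
    show "\<psi> (C \<oplus>\<^bsub>completion A s\<^esub> D) = \<psi> C + \<psi> D"
      using X Y by (simp add: completion_ops, intro eqI) (auto simp: cl w.func_add intro!: tendsto_add lim)
  qed (use w(3) const[of \<one>] in \<open>simp add: completion_one\<close>)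
  then show ?thesis using const by (rule that)
qed

end


section \<open>The universal seminorm\<close>

context complex_star_algebra
begin

lemma cstar_seminorm_zero: "cstar_seminorm A (\<lambda>_. 0)"
  by (simp add: cstar_seminorm_def)

text \<open>Gives both the universal seminorm and the supremum norm on \<open>CU\<close>.\<close>

lemma cstar_seminorm_Sup:
  assumes S: "\<And>s. s \<in> S \<Longrightarrow> cstar_seminorm A s" and ne: "S \<noteq> {}"
    and bdd: "\<And>a. a \<in> carrier A \<Longrightarrow> bdd_above ((\<lambda>s. s a) ` S)"
  shows "cstar_seminorm A (\<lambda>a. SUP s\<in>S. s a)"
proof -
  have sn: "seminormed_star_algebra A s" if "s \<in> S" for s
    using S[OF that] by unfold_locales
  note s_facts = seminormed_star_algebra.s_nonneg[OF sn] seminormed_star_algebra.s_triangle[OF sn]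
    seminormed_star_algebra.s_smult[OF sn] seminormed_star_algebra.s_mult[OF sn]
    seminormed_star_algebra.s_cstar[OF sn]
  let ?p = "\<lambda>a. SUP s\<in>S. s a"
  have up: "s a \<le> ?p a" if "s \<in> S" "a \<in> carrier A" for s a
    using that bdd by (intro cSUP_upper)
  have least: "?p a \<le> c" if "\<And>s. s \<in> S \<Longrightarrow> s a \<le> c" for a c
    using that ne by (intro cSUP_least)
  have nn: "0 \<le> ?p a" if "a \<in> carrier A" for a
    using ne up that s_facts(1) by (metis ex_in_conv order_trans)
  show ?thesis
  proof (rule cstar_seminormI)
    show "0 \<le> ?p a" if "a \<in> carrier A" for a using that by (rule nn)
    show "?p (c \<odot> a) \<le> cmod c * ?p a" if "a \<in> carrier A" for c a
      using that up by (intro least) (simp add: s_facts mult_left_mono)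
    show "?p (a \<oplus> b) \<le> ?p a + ?p b" if "a \<in> carrier A" "b \<in> carrier A" for a b
      using that up by (intro least) (meson add_mono order_trans s_facts(2))
    show "?p (a \<otimes> b) \<le> ?p a * ?p b" if "a \<in> carrier A" "b \<in> carrier A" for a b
    proof (rule least)
      fix s assume s: "s \<in> S"
      have "s (a \<otimes> b) \<le> s a * s b" using s that by (simp add: s_facts)
      also have "\<dots> \<le> ?p a * ?p b" using s that up nn by (intro mult_mono) (auto simp: s_facts)
      finally show "s (a \<otimes> b) \<le> ?p a * ?p b" .
    qed
    show "(?p a)\<^sup>2 \<le> ?p (star A a \<otimes> a)" if a: "a \<in> carrier A" for a
    proof -
      have "?p a \<le> sqrt (?p (star A a \<otimes> a))"
      proof (rule least)
        fix s assume s: "s \<in> S"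
        have "(s a)\<^sup>2 \<le> ?p (star A a \<otimes> a)" using up[OF s, of "star A a \<otimes> a"] s a by (simp add: s_facts)
        then show "s a \<le> sqrt (?p (star A a \<otimes> a))" by (rule real_le_rsqrt)
      qed
      then have "(?p a)\<^sup>2 \<le> (sqrt (?p (star A a \<otimes> a)))\<^sup>2" using nn[OF a] by (rule power_mono)
      then show ?thesis using nn[of "star A a \<otimes> a"] a by simp
    qed
  qed
qed

end

section \<open>The free algebra and uniform bounds on the admissible seminorms\<close>

lemma (in star_monoid) seminorm_le_lin_abs:
  assumes s: "cstar_seminorm alg s" and N: "\<And>x. x \<in> carrier M \<Longrightarrow> s (monomial x) \<le> N x"
    and p: "p \<in> carrier alg"
  shows "s p \<le> lin_abs N p"
proof -
  interpret F: seminormed_star_algebra alg s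
    by (intro seminormed_star_algebra.intro complex_star_algebra_alg seminormed_star_algebra_axioms.intro s)
  have "finite S \<Longrightarrow> \<forall>p\<in>carrier alg. {z. p z \<noteq> 0} \<subseteq> S \<longrightarrow> s p \<le> (\<Sum>m\<in>S. cmod (p m) * N m)" for S
  proof (induction S rule: finite_induct)
    case empty
    show ?case
    proof (intro ballI impI)
      fix p :: "'m \<Rightarrow> complex" assume "{z. p z \<noteq> 0} \<subseteq> {}"
      then have "p = \<zero>\<^bsub>alg\<^esub>" by (auto simp: monoid_star_algebra_def)
      then show "s p \<le> (\<Sum>m\<in>{}. cmod (p m) * N m)" using F.s_zero by simp
    qed
  next
    case (insert x S)
    show ?case
    proof (intro ballI impI)
      fix p assume p: "p \<in> carrier alg" "{z. p z \<noteq> 0} \<subseteq> insert x S"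
      define p' where "p' = p(x := 0)"
      have p': "p' \<in> carrier alg"
        using p(1) unfolding alg_carrier_iff p'_def by (auto elim: rev_finite_subset)
      have "{z. p' z \<noteq> 0} \<subseteq> S" using p by (auto simp: p'_def split: if_splits)
      then have le: "s p' \<le> (\<Sum>m\<in>S. cmod (p' m) * N m)" using insert.IH p' by blast
      also have "\<dots> = (\<Sum>m\<in>S. cmod (p m) * N m)"
        using insert.hyps by (intro sum.cong) (auto simp: p'_def)
      finally have le: "s p' \<le> (\<Sum>m\<in>S. cmod (p m) * N m)" .
      show "s p \<le> (\<Sum>m\<in>insert x S. cmod (p m) * N m)"
      proof (cases "p x = 0")
        case True
        then have "p' = p" by (auto simp: p'_def)
        then show ?thesis using le insert.hyps True by simp
      next
        case False
        then have x: "x \<in> carrier M" using p alg_support by blast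
        have "p = p x \<odot>\<^bsub>alg\<^esub> monomial x \<oplus>\<^bsub>alg\<^esub> p'"
          by (auto simp: monoid_star_algebra_def p'_def monomial_def fun_eq_iff)
        then have "s p \<le> s (p x \<odot>\<^bsub>alg\<^esub> monomial x) + s p'"
          using F.s_triangle[of "p x \<odot>\<^bsub>alg\<^esub> monomial x" p'] x p' by simp
        also have "s (p x \<odot>\<^bsub>alg\<^esub> monomial x) \<le> cmod (p x) * N x"
          using x N by (simp add: F.s_smult mult_left_mono)
        finally show ?thesis using le insert.hyps by simp
      qed
    qed
  qed
  then show ?thesis unfolding lin_abs_def using p alg_finite by blast
qed

interpretation free: star_monoid "\<lparr>carrier = UNIV, mult = (@), one = []\<rparr>"
    "\<lambda>w. rev (map (\<lambda>(x, b). (x, \<not> b)) w)"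
  rewrites "monoid_star_algebra \<lparr>carrier = UNIV, mult = (@), one = []\<rparr>
      (\<lambda>w. rev (map (\<lambda>(x, b). (x, \<not> b)) w)) = free_star_algebra"
    and "carrier \<lparr>carrier = UNIV, mult = (@), one = []\<rparr> = UNIV"
    and "mult \<lparr>carrier = UNIV, mult = (@), one = []\<rparr> = (@)"
    and "one \<lparr>carrier = UNIV, mult = (@), one = []\<rparr> = []"
  by (rule free_star_monoid) (auto simp: free_star_algebra_def)

interpretation free_alg: complex_star_algebra free_star_algebra
  by (rule free.complex_star_algebra_alg)

lemma gen_closed [simp, intro]: "gen x \<in> carrier free_star_algebra"
  by (simp add: gen_def free.monomial_closed)

lemma star_gen: "star free_star_algebra (gen x) = monomial [(x, True)]"
  by (simp add: gen_def free.monomial_star)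

definition admissible :: "(('x \<times> bool) list \<Rightarrow> complex) set \<Rightarrow> ((('x \<times> bool) list \<Rightarrow> complex) \<Rightarrow> real) \<Rightarrow> bool" where
  "admissible R s \<longleftrightarrow> cstar_seminorm free_star_algebra s \<and> (\<forall>x. s (gen x) \<le> 1) \<and> (\<forall>r\<in>R. s r = 0)"

text \<open>Words are products of generators and their adjoints, all of seminorm at most one. Hence
  the l1-norm bounds every admissible seminorm and the supremum is finite.\<close>

lemma admissible_monomial_le:
  assumes "admissible R s" shows "s (monomial w) \<le> 1"
proof -
  interpret F: seminormed_star_algebra free_star_algebra s
    using assms by unfold_locales (simp add: admissible_def)
  show ?thesis
  proof (induction w)
    case Nil
    then show ?case using F.s_one by (simp add: free.alg_one)
  next
    case (Cons l w)
    obtain x b where l: "l = (x, b)" by force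
    have "s (monomial [l]) \<le> 1"
    proof (cases b)
      case True
      then have "s (monomial [l]) = s (gen x)"
        using F.s_star[of "gen x"] by (simp add: l star_gen)
      then show ?thesis using assms by (simp add: admissible_def)
    next
      case False
      then show ?thesis using assms by (simp add: admissible_def l gen_def)
    qed
    moreover have "s (monomial (l # w)) \<le> s (monomial [l]) * s (monomial w)"
      using F.s_mult[of "monomial [l]" "monomial w"] by (simp add: free.monomial_mult free.monomial_closed)
    moreover have "s (monomial [l]) * s (monomial w) \<le> 1 * 1"
      using Cons calculation(1) by (intro mult_mono) (auto simp: free.monomial_closed)
    ultimately show ?case by simp
  qed
qed

lemma admissible_bdd:
  assumes "p \<in> carrier free_star_algebra" shows "bdd_above ((\<lambda>s. s p) ` Collect (admissible R))"
proof (rule bdd_aboveI)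
  fix r assume "r \<in> (\<lambda>s. s p) ` Collect (admissible R)"
  then obtain s where s: "admissible R s" "r = s p" by blast
  then show "r \<le> lin_abs (\<lambda>_. 1) p"
    using free.seminorm_le_lin_abs[of s "\<lambda>_. 1" p] admissible_monomial_le[OF s(1)] assms
    by (simp add: admissible_def)
qed

lemma universal_seminorm_eq: "universal_seminorm R = (\<lambda>p. SUP s\<in>Collect (admissible R). s p)"
  unfolding universal_seminorm_def admissible_def[symmetric] by (simp add: setcompr_eq_image)

lemma le_universal_seminorm:
  "admissible R s \<Longrightarrow> p \<in> carrier free_star_algebra \<Longrightarrow> s p \<le> universal_seminorm R p"
  unfolding universal_seminorm_eq by (intro cSUP_upper admissible_bdd) auto

lemma seminormed_universal: "seminormed_star_algebra free_star_algebra (universal_seminorm R)"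
proof -
  \<comment> \<open>The zero seminorm ensures that the supremum is over a nonempty set, whatever the
    relators are.\<close>
  have "admissible R (\<lambda>_. 0)" by (simp add: admissible_def free_alg.cstar_seminorm_zero)
  then have "Collect (admissible R) \<noteq> {}" by blast
  then have "cstar_seminorm free_star_algebra (universal_seminorm R)"
    unfolding universal_seminorm_eq
    by (intro free_alg.cstar_seminorm_Sup admissible_bdd) (auto simp: admissible_def)
  then show ?thesis by unfold_locales
qed

interpretation univ: seminormed_star_algebra free_star_algebra "universal_seminorm R" for R
  by (rule seminormed_universal)


section \<open>The algebras \<open>A\<^sub>u(n)\<close> and \<open>C(U(n))\<close>\<close>

lemma Au_eq: "Au = completion free_star_algebra (universal_seminorm Au_relators)"
  by (simp add: Au_def universal_cstar_algebra_def)

lemma normed_Au: "normed_star_algebra (Au :: 'n::finite au cstar_algebra)"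
  unfolding normed_star_algebra_def seminormed_star_algebra_def seminormed_star_algebra_axioms_def Au_eq
  using univ.complex_star_algebra_completion univ.cstar_seminorm_completion by blast

section \<open>The unitary group, its compactness, and its continuous functions\<close>

lemma unitary_group_rows:
  assumes "g \<in> unitary_group" shows "(\<Sum>k\<in>UNIV. g $ i $ k * cnj (g $ j $ k)) = (if i = j then 1 else 0)"
proof -
  have "(g ** (\<chi> i j. cnj (g $ j $ i))) $ i $ j = mat 1 $ i $ j"
    using assms by (simp add: unitary_group_def)
  then show ?thesis by (simp add: matrix_matrix_mult_def mat_def)
qed

lemma mat_one_unitary: "mat 1 \<in> unitary_group"
proof -
  have "(\<chi> i j. cnj (mat 1 $ j $ i)) = (mat 1 :: complex ^ 'n ^ 'n)"
    by (simp add: mat_def vec_eq_iff)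
  then show ?thesis by (simp add: unitary_group_def)
qed

lemma unitary_group_entry_le: assumes "g \<in> unitary_group" shows "cmod (g $ i $ j) \<le> 1"
proof -
  have "complex_of_real (\<Sum>k\<in>UNIV. (cmod (g $ i $ k))\<^sup>2) = 1"
    using unitary_group_rows[OF assms, of i i] by (simp add: complex_norm_square del: of_real_power)
  then have "(\<Sum>k\<in>UNIV. (cmod (g $ i $ k))\<^sup>2) = 1" by (simp only: of_real_eq_1_iff)
  moreover have "(cmod (g $ i $ j))\<^sup>2 \<le> (\<Sum>k\<in>UNIV. (cmod (g $ i $ k))\<^sup>2)"
    by (rule member_le_sum) auto
  ultimately show ?thesis by (simp add: power2_le_iff_abs_le[of 1 "cmod (g $ i $ j)"] abs_square_le_1)
qed

text \<open>Compactness bounds the continuous functions, so that the supremum norm of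
  \<open>CU\<close> is finite.\<close>

lemma compact_unitary_group: "compact (unitary_group :: (complex ^ 'n ^ 'n) set)"
  unfolding compact_eq_bounded_closed
proof
  have "norm g \<le> (\<Sum>i\<in>(UNIV :: 'n set). \<Sum>j\<in>(UNIV :: 'n set). 1)" if "g \<in> unitary_group" for g :: "complex ^ 'n ^ 'n"
  proof -
    have "norm g \<le> (\<Sum>i\<in>UNIV. norm (g $ i))"
      unfolding norm_vec_def by (rule L2_set_le_sum) simp
    also have "\<dots> \<le> (\<Sum>i\<in>UNIV. \<Sum>j\<in>UNIV. norm (g $ i $ j))"
      by (intro sum_mono) (simp add: norm_vec_def L2_set_le_sum)
    also have "\<dots> \<le> (\<Sum>i\<in>(UNIV::'n set). \<Sum>j\<in>(UNIV::'n set). 1)"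
      by (intro sum_mono unitary_group_entry_le that)
    finally show ?thesis .
  qed
  then show "bounded (unitary_group :: (complex ^ 'n ^ 'n) set)" unfolding bounded_iff by blast
  have "unitary_group = {g :: complex ^ 'n ^ 'n. g ** (\<chi> i j. cnj (g $ j $ i)) = mat 1} \<inter>
      {g. (\<chi> i j. cnj (g $ j $ i)) ** g = mat 1}"
    by (auto simp: unitary_group_def)
  also have "closed \<dots>"
    unfolding matrix_matrix_mult_def
    by (intro closed_Int closed_Collect_eq continuous_intros)
  finally show "closed (unitary_group :: (complex ^ 'n ^ 'n) set)" .
qed

lemma CU_ops:
  "carrier CU = {f \<in> extensional unitary_group. continuous_on unitary_group f}"
  "mult CU f h = (\<lambda>g\<in>unitary_group. f g * h g)"
  "one CU = (\<lambda>g\<in>unitary_group. 1)"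
  "zero CU = (\<lambda>g\<in>unitary_group. 0)"
  "add CU f h = (\<lambda>g\<in>unitary_group. f g + h g)"
  "c \<odot>\<^bsub>CU\<^esub> f = (\<lambda>g\<in>unitary_group. c * f g)"
  "star CU f = (\<lambda>g\<in>unitary_group. cnj (f g))"
  "nrm CU f = (SUP g\<in>unitary_group. cmod (f g))"
  by (simp_all add: CU_def)

lemma continuous_on_restrict_iff: "continuous_on S (restrict f S) \<longleftrightarrow> continuous_on S f"
  by (rule continuous_on_cong) auto

lemma CU_restrict: "continuous_on unitary_group f \<Longrightarrow> restrict f unitary_group \<in> carrier CU"
  by (simp add: CU_ops continuous_on_restrict_iff)

lemma complex_star_algebra_CU: "complex_star_algebra CU"
proof -
  have "ring CU"
  proof (intro ringI abelian_groupI monoidI)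
    fix f assume "f \<in> carrier CU"
    then show "\<exists>h\<in>carrier CU. h \<oplus>\<^bsub>CU\<^esub> f = \<zero>\<^bsub>CU\<^esub>"
      by (intro bexI[of _ "\<lambda>g\<in>unitary_group. - f g"] CU_restrict)
         (auto simp: CU_ops intro!: continuous_intros)
  qed (auto simp: CU_ops continuous_on_restrict_iff fun_eq_iff extensional_def restrict_def algebra_simps
      intro!: continuous_intros CU_restrict)
  then show ?thesis
    unfolding complex_star_algebra_def complex_star_algebra_axioms_def
    by (auto simp: CU_ops continuous_on_restrict_iff fun_eq_iff extensional_def restrict_def algebra_simps
      intro!: continuous_intros CU_restrict)
qed

lemma CU_bdd: "f \<in> carrier CU \<Longrightarrow> bdd_above ((\<lambda>g. cmod (f g)) ` unitary_group)"
  using compact_continuous_image[OF continuous_on_norm compact_unitary_group, of f]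
  by (auto simp: CU_ops intro!: bounded_imp_bdd_above compact_imp_bounded)

text \<open>The norm is the supremum of the C*-seminorms \<open>cmod (f g)\<close> over the points
  g.\<close>

lemma normed_CU: "normed_star_algebra (CU :: 'n::finite cu cstar_algebra)"
proof -
  interpret complex_star_algebra CU by (rule complex_star_algebra_CU)
  have "cstar_seminorm CU (\<lambda>f. SUP s\<in>(\<lambda>g f. cmod (f g)) ` (unitary_group :: (complex ^ 'n ^ 'n) set). s f)"
  proof (rule cstar_seminorm_Sup)
    fix s assume "s \<in> (\<lambda>g f. cmod (f g)) ` (unitary_group :: (complex ^ 'n ^ 'n) set)"
    then obtain g :: "complex ^ 'n ^ 'n" where "g \<in> unitary_group" "s = (\<lambda>f. cmod (f g))" by blast
    then show "cstar_seminorm CU s"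
      by (auto simp: cstar_seminorm_def CU_ops norm_mult norm_triangle_ineq power2_eq_square)
  next
    show "(\<lambda>g f. cmod (f g)) ` (unitary_group :: (complex ^ 'n ^ 'n) set) \<noteq> {}"
      using mat_one_unitary by blast
    fix f assume "f \<in> carrier (CU :: 'n cu cstar_algebra)"
    from CU_bdd[OF this]
    show "bdd_above ((\<lambda>s. s f) ` (\<lambda>g f. cmod (f g)) ` (unitary_group :: (complex ^ 'n ^ 'n) set))"
      by (simp add: image_image)
  qed
  then have "cstar_seminorm CU (nrm (CU :: 'n cu cstar_algebra))"
    by (simp add: image_image CU_ops(8)[abs_def])
  then show ?thesis
    unfolding normed_star_algebra_def by unfold_locales
qed

lemma point_evaluation_state:
  assumes "g \<in> unitary_group" shows "is_state CU (\<lambda>f. f g)"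
proof -
  have "cmod (f g) \<le> nrm CU f" if "f \<in> carrier CU" for f
    unfolding CU_ops using assms CU_bdd[OF that] by (rule cSUP_upper)
  then show ?thesis
    using assms by (auto simp: is_state_def CU_ops complex_nonneg_Reals_iff)
qed


section \<open>A representation of \<open>A\<^sub>u(n)\<close> on the plane\<close>

text \<open>The generator \<open>u\<^sub>i\<^sub>j\<close> acts by \<open>v\<^sub>i\<^sub>j e\<^sub>j\<close>, where \<open>v\<close> is the reflection in the vector with entries
  \<open>1\<close> and \<open>2\<close> at \<open>p\<close> and \<open>q\<close>, and \<open>e\<^sub>p\<close>, \<open>e\<^sub>q\<close> are the anticommuting reflections
  \<open>(x, y) \<mapsto> (y, x)\<close> and \<open>(x, y) \<mapsto> (x, -y)\<close>. All \<open>v\<^sub>i\<^sub>j\<close> are real and all \<open>e\<^sub>j\<close> symmetric, hence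
  generators and their adjoints act in the same way, and the flag of a letter is ignored.\<close>

locale plane_rep =
  fixes p q :: "'n::finite"
  assumes pq: "p \<noteq> q"
begin

text \<open>The squared length is 5, whence the factor \<open>2 / 5\<close> in \<open>v\<close>, and
  the entries of \<open>v\<close> at p and q are 3/5, -4/5, -3/5. With equal entries of
  \<open>y\<close> the reflection would exchange the two coordinates up to sign, and the sum in
  \<open>vec_cross\<close> would vanish.\<close>

definition y :: "'n \<Rightarrow> real" where
  "y i = (if i = p then 1 else if i = q then 2 else 0)"

definition v :: "'n \<Rightarrow> 'n \<Rightarrow> real" where
  "v i j = (if i = j then 1 else 0) - 2 / 5 * (y i * y j)"

definition e :: "'n \<Rightarrow> real \<times> real \<Rightarrow> real \<times> real" where
  "e j u = (if j = p then (snd u, fst u) else if j = q then (fst u, - snd u) else u)"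

fun act :: "(('n \<times> 'n) \<times> bool) list \<Rightarrow> real \<times> real \<Rightarrow> real \<times> real" where
  "act [] u = u"
| "act (((i, j), b) # w) u = v i j *\<^sub>R e j (act w u)"

text \<open>The matrix coefficient of the representation at the unit vector (1, 0).\<close>

definition vec :: "(('n \<times> 'n) \<times> bool) list \<Rightarrow> complex" where
  "vec w = complex_of_real (fst (act w (1, 0)))"

lemma sum_y: "(\<Sum>k\<in>UNIV. y k * y k) = 5"
proof -
  have "(\<Sum>k\<in>UNIV. y k * y k) = (\<Sum>k\<in>{p, q}. y k * y k)"
    by (rule sum.mono_neutral_right) (auto simp: y_def)
  then show ?thesis using pq by (simp add: y_def)
qed

lemma v_sym: "v i j = v j i"
  by (auto simp: v_def)

lemma v_orthogonal: "(\<Sum>k\<in>UNIV. v i k * v j k) = (if i = j then 1 else 0)"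
proof -
  have "v i k * v j k = (if i = k then (if j = k then 1 else 0) else 0) - 2 / 5 * (if i = k then y j * y k else 0)
     - 2 / 5 * (if j = k then y i * y k else 0) + 4 / 25 * (y i * y j) * (y k * y k)" for k
    by (auto simp: v_def algebra_simps)
  then have "(\<Sum>k\<in>UNIV. v i k * v j k) = (if j = i then 1 else 0) - 2 / 5 * (y j * y i) - 2 / 5 * (y i * y j)
     + 4 / 25 * (y i * y j) * 5"
    by (simp only: sum.distrib sum_subtractf sum_distrib_left[symmetric] sum_y) (simp add: sum.delta')
  then show ?thesis by auto
qed

lemma v_le: "\<bar>v i j\<bar> \<le> 1"
  using pq by (auto simp: v_def y_def)

lemma e_linear: "linear (e j)"
  by (rule linearI) (auto simp: e_def)

lemma e_sym: "inner (e j u) w = inner u (e j w)"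
  by (auto simp: e_def inner_prod_def)

lemma e_e [simp]: "e j (e j u) = u"
  by (auto simp: e_def)

lemma norm_e: "norm (e j u) = norm u"
  by (simp add: norm_eq_sqrt_inner e_sym)

lemma act_append: "act (w @ w') u = act w (act w' u)"
  by (induction w u rule: act.induct) auto

lemma act_linear: "linear (act w)"
proof (induction w)
  case Nil
  then show ?case by (intro linearI) simp_all
next
  case (Cons l w)
  obtain i j b where l: "l = ((i, j), b)" by (metis prod.exhaust)
  show ?case
    unfolding l by (rule linearI)
      (simp_all add: linear_add[OF Cons] linear_add[OF e_linear] linear_scale[OF Cons] linear_scale[OF e_linear]
        scaleR_add_right)
qed

lemma act_adj: "inner (act w u) z = inner u (act (rev (map (\<lambda>(x, b). (x, \<not> b)) w)) z)"
proof (induction w arbitrary: u z)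
  case (Cons l w)
  obtain i j b where l: "l = ((i, j), b)" by (metis prod.exhaust)
  show ?case
    by (simp add: l act_append Cons[symmetric] e_sym linear_scale[OF act_linear])
qed simp

lemma norm_act: "norm (act w u) \<le> norm u"
proof (induction w u rule: act.induct)
  case (2 i j b w u)
  have "norm (act (((i, j), b) # w) u) \<le> 1 * norm (act w u)"
    using v_le[of i j] by (simp add: norm_e mult_left_le_one_le)
  then show ?case using 2 by simp
qed simp

text \<open>The kernel is the inner product of two vectors of the plane, hence a sum of two kernels
  of rank one, one for each coordinate.\<close>

lemma positive_vec: "positive_functional free_star_algebra (lin vec)"
proof (rule free.positive_functional_linI)
  fix p :: "(('n \<times> 'n) \<times> bool) list \<Rightarrow> complex" assume "p \<in> carrier free_star_algebra"
  let ?S = "{x. p x \<noteq> 0}" and ?u = "\<lambda>x. act x (1, 0)"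
  have vec: "vec (rev (map (\<lambda>(x, b). (x, \<not> b)) x) @ y) =
      complex_of_real (fst (?u x)) * complex_of_real (fst (?u y)) +
      complex_of_real (snd (?u x)) * complex_of_real (snd (?u y))" for x y
  proof -
    have "vec (rev (map (\<lambda>(x, b). (x, \<not> b)) x) @ y) = complex_of_real (inner (?u x) (?u y))"
      unfolding act_adj by (simp add: vec_def act_append inner_prod_def)
    then show ?thesis by (simp add: inner_prod_def)
  qed
  have sq: "(\<Sum>x\<in>?S. \<Sum>y\<in>?S. cnj (p x) * p y * (complex_of_real (h x) * complex_of_real (h y))) \<in> \<real>\<^sub>\<ge>\<^sub>0"
    for h :: "_ \<Rightarrow> real"
  proof -
    have "(\<Sum>x\<in>?S. \<Sum>y\<in>?S. cnj (p x) * p y * (complex_of_real (h x) * complex_of_real (h y))) =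
        cnj (\<Sum>x\<in>?S. p x * complex_of_real (h x)) * (\<Sum>y\<in>?S. p y * complex_of_real (h y))"
      unfolding cnj_sum sum_product by (intro sum.cong) (auto simp: mult_ac)
    also have "\<dots> = complex_of_real ((cmod (\<Sum>y\<in>?S. p y * complex_of_real (h y)))\<^sup>2)"
      by (simp add: complex_norm_square mult.commute del: of_real_power)
    finally show ?thesis by (simp only: nonneg_Reals_of_real_iff zero_le_power2)
  qed
  have "(\<Sum>x\<in>?S. \<Sum>y\<in>?S. cnj (p x) * p y * vec (rev (map (\<lambda>(x, b). (x, \<not> b)) x) @ y)) =
     (\<Sum>x\<in>?S. \<Sum>y\<in>?S. cnj (p x) * p y * (complex_of_real (fst (?u x)) * complex_of_real (fst (?u y)))) +
     (\<Sum>x\<in>?S. \<Sum>y\<in>?S. cnj (p x) * p y * (complex_of_real (snd (?u x)) * complex_of_real (snd (?u y))))"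
    unfolding vec by (simp only: distrib_left sum.distrib)
  then show "(\<Sum>x\<in>?S. \<Sum>y\<in>?S. cnj (p x) * p y * vec (rev (map (\<lambda>(x, b). (x, \<not> b)) x) @ y)) \<in> \<real>\<^sub>\<ge>\<^sub>0"
    using sq[of "\<lambda>x. fst (?u x)"] sq[of "\<lambda>x. snd (?u x)"] by (simp only: nonneg_Reals_add_I)
qed

lemma vec_le: "cmod (vec w) \<le> 1"
proof -
  have "\<bar>fst (act w (1, 0))\<bar> \<le> norm (act w (1, 0))"
    using norm_fst_le[of "fst (act w (1, 0))" "snd (act w (1, 0))"] by simp
  also have "\<dots> \<le> norm (1 :: real, 0 :: real)" by (rule norm_act)
  finally show ?thesis by (simp add: vec_def norm_Pair)
qed

lemma lin_vec_one: "lin vec \<one>\<^bsub>free_star_algebra\<^esub> = 1"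
  by (simp add: free.alg_one vec_def)

lemma functional_family_vec: "functional_family free_star_algebra {lin vec} (lin_abs (\<lambda>_. 1))"
proof -
  have "dominated_functional free_star_algebra (lin vec) (lin_abs (\<lambda>_. 1))"
    by (rule free.dominated_functional_linI[OF positive_vec]) (auto simp: vec_le)
  then show ?thesis
    using lin_vec_one
    by (intro functional_family.intro functional_family_axioms.intro free_alg.complex_star_algebra_axioms) auto
qed

lemma lin_free_minus:
  "a \<in> carrier free_star_algebra \<Longrightarrow> b \<in> carrier free_star_algebra \<Longrightarrow>
    lin f (a \<ominus>\<^bsub>free_star_algebra\<^esub> b) = lin f a - lin f b"
  by (simp add: a_minus_def free_alg.minus_eq_smult free.lin_add free.lin_smult)

text \<open>The flag treats the generator matrix and its entrywise adjoint together. The surrounding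
  words are those of the two factors that \<open>gns_zeroI\<close> places around the
  relator.\<close>

lemma relators_vanish:
  assumes r: "r \<in> unitary_relators free_star_algebra (\<lambda>i j. monomial [((i, j), b)])"
  shows "r \<in> carrier free_star_algebra" "lin (\<lambda>m. vec (w @ m @ w')) r = 0"
proof -
  let ?F = "free_star_algebra :: ((('n \<times> 'n) \<times> bool) list \<Rightarrow> complex) star_algebra"
  have mc: "monomial m \<in> carrier ?F" for m by (simp add: free.monomial_closed)
  have d: "(if i = j then \<one>\<^bsub>?F\<^esub> else \<zero>\<^bsub>?F\<^esub>) \<in> carrier ?F" for i j :: 'n by simp
  have "r \<in> carrier ?F \<and> lin (\<lambda>m. vec (w @ m @ w')) r = 0"
  proof -
    \<comment> \<open>Row and column relators share one form: a sum of words of length two whose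
      actions add up to the identity or to zero.\<close>
    obtain i j :: 'n and m :: "'n \<Rightarrow> (('n \<times> 'n) \<times> bool) list"
      where r_eq: "r = (\<Oplus>\<^bsub>?F\<^esub>k\<in>UNIV. monomial (m k)) \<ominus>\<^bsub>?F\<^esub> (if i = j then \<one>\<^bsub>?F\<^esub> else \<zero>\<^bsub>?F\<^esub>)"
        and m: "(\<Sum>k\<in>UNIV. act (m k) u) = (if i = j then u else 0)" for u
    proof -
      from r consider (row) i j where "r = (\<Oplus>\<^bsub>?F\<^esub>k\<in>UNIV. monomial [((i, k), b)] \<otimes>\<^bsub>?F\<^esub> star ?F (monomial [((j, k), b)]))
            \<ominus>\<^bsub>?F\<^esub> (if i = j then \<one>\<^bsub>?F\<^esub> else \<zero>\<^bsub>?F\<^esub>)"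
        | (col) i j where "r = (\<Oplus>\<^bsub>?F\<^esub>k\<in>UNIV. star ?F (monomial [((k, i), b)]) \<otimes>\<^bsub>?F\<^esub> monomial [((k, j), b)])
            \<ominus>\<^bsub>?F\<^esub> (if i = j then \<one>\<^bsub>?F\<^esub> else \<zero>\<^bsub>?F\<^esub>)"
        unfolding unitary_relators_def by blast
      then show thesis
      proof cases
        case row
        show thesis
        proof (rule that[of "\<lambda>k. [((i, k), b), ((j, k), \<not> b)]" i j])
          show "r = (\<Oplus>\<^bsub>?F\<^esub>k\<in>UNIV. monomial [((i, k), b), ((j, k), \<not> b)]) \<ominus>\<^bsub>?F\<^esub> (if i = j then \<one>\<^bsub>?F\<^esub> else \<zero>\<^bsub>?F\<^esub>)"
            unfolding row by (simp add: free.monomial_star free.monomial_mult)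
          show "(\<Sum>k\<in>UNIV. act [((i, k), b), ((j, k), \<not> b)] u) = (if i = j then u else 0)" for u
            by (simp add: linear_scale[OF e_linear] scaleR_sum_left[symmetric] v_orthogonal)
        qed
      next
        \<comment> \<open>Here \<open>e i\<close> and \<open>e j\<close> meet instead of
          \<open>e k\<close> with itself. They cancel for i = j, and for distinct i, j orthogonality
          of the columns of \<open>v\<close> gives zero.\<close>
        case col
        show thesis
        proof (rule that[of "\<lambda>k. [((k, i), \<not> b), ((k, j), b)]" i j])
          show "r = (\<Oplus>\<^bsub>?F\<^esub>k\<in>UNIV. monomial [((k, i), \<not> b), ((k, j), b)]) \<ominus>\<^bsub>?F\<^esub> (if i = j then \<one>\<^bsub>?F\<^esub> else \<zero>\<^bsub>?F\<^esub>)"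
            unfolding col by (simp add: free.monomial_star free.monomial_mult)
          show "(\<Sum>k\<in>UNIV. act [((k, i), \<not> b), ((k, j), b)] u) = (if i = j then u else 0)" for u
            using v_orthogonal[of i j]
            by (simp add: linear_scale[OF e_linear] scaleR_sum_left[symmetric] v_sym[of _ i] v_sym[of _ j])
        qed
      qed
    qed
    have s: "(\<Oplus>\<^bsub>?F\<^esub>k\<in>UNIV. monomial (m k)) \<in> carrier ?F" using mc by (intro free_alg.finsum_closed) auto
    have "(\<Sum>k\<in>UNIV. vec (w @ m k @ w')) = complex_of_real (fst (act w (\<Sum>k\<in>UNIV. act (m k) (act w' (1, 0)))))"
      by (simp add: vec_def act_append linear_sum[OF act_linear] fst_sum)
    also have "\<dots> = (if i = j then vec (w @ w') else 0)"
      unfolding m by (simp add: vec_def act_append linear_0[OF act_linear])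
    finally have "lin (\<lambda>m. vec (w @ m @ w')) r = 0"
      unfolding r_eq using s d mc by (simp add: lin_free_minus free.lin_finsum free.alg_one free.lin_alg_zero)
    then show ?thesis using s d unfolding r_eq by simp
  qed
  then show "r \<in> carrier ?F" "lin (\<lambda>m. vec (w @ m @ w')) r = 0" by auto
qed

text \<open>The GNS seminorm of \<open>lin vec\<close> is one of the seminorms over which the
  universal seminorm is the supremum.\<close>

lemma vec_le_universal:
  assumes "a \<in> carrier free_star_algebra"
  shows "cmod (lin vec a) \<le> universal_seminorm Au_relators a"
proof -
  interpret V: functional_family free_star_algebra "{lin vec}" "lin_abs (\<lambda>_. 1)"
    by (rule functional_family_vec)
  have "admissible Au_relators V.gns_seminorm"
    unfolding admissible_def
  proof (intro conjI allI ballI)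
    show "cstar_seminorm free_star_algebra V.gns_seminorm" by (rule V.cstar_seminorm_gns)
    show "V.gns_seminorm (gen x) \<le> 1" for x
      using V.gns_le_dom[of "gen x"] by (simp add: gen_def free.monomial_closed)
    fix r :: "(('n \<times> 'n) \<times> bool) list \<Rightarrow> complex" assume "r \<in> Au_relators"
    then obtain b where r: "r \<in> unitary_relators free_star_algebra (\<lambda>i j. monomial [((i, j), b)])"
      unfolding Au_relators_def star_gen by (auto simp: gen_def)
    show "V.gns_seminorm r = 0"
    proof (rule V.gns_zeroI)
      show rc: "r \<in> carrier free_star_algebra" using relators_vanish(1)[OF r] .
      fix \<omega> and y z :: "(('n \<times> 'n) \<times> bool) list \<Rightarrow> complex"
      assume w: "\<omega> \<in> {lin vec}" and yz: "y \<in> carrier free_star_algebra" "z \<in> carrier free_star_algebra"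
      \<comment> \<open>Interchanging the finite sums puts r innermost, between two fixed
        words.\<close>
      have "lin (\<lambda>m. lin (\<lambda>m'. vec ((u @ m) @ m')) y) r = lin (\<lambda>m'. lin (\<lambda>m. vec (u @ m @ m')) r) y" for u
        unfolding lin_def sum_distrib_left by (subst sum.swap) (simp add: mult.left_commute)
      then show "\<omega> (z \<otimes>\<^bsub>free_star_algebra\<^esub> r \<otimes>\<^bsub>free_star_algebra\<^esub> y) = 0"
        using w yz rc by (simp add: free.lin_mult free.alg_mult_closed relators_vanish(2)[OF r])
    qed
  qed
  then have "V.gns_seminorm a \<le> universal_seminorm Au_relators a"
    using assms by (rule le_universal_seminorm)
  moreover have "cmod (lin vec a) \<le> V.gns_seminorm a"
    using assms by (intro V.func_le_gns) (auto simp: lin_vec_one)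
  ultimately show ?thesis by simp
qed

text \<open>Only k, l in {p, q} contribute, as \<open>v p k = 0\<close> elsewhere. There
  \<open>e k e l e k e l\<close> is 1 for k = l and -1 otherwise, so the sum is 2 * (12/25) * (16/25
  - 9/25), where 12/25 is \<open>v p q * v q q\<close>. Without the signs, orthogonality of rows p
  and q would give 0.\<close>

lemma vec_cross:
  "(\<Sum>k\<in>UNIV. \<Sum>l\<in>UNIV. vec [((p, k), False), ((p, l), False), ((p, k), True), ((q, l), True)]) = 168 / 625"
proof -
  have "vec [((p, k), False), ((p, l), False), ((p, k), True), ((q, l), True)] =
      complex_of_real (v p k * v p l * v p k * v q l * fst (e k (e l (e k (e l (1, 0))))))" for k l
    by (simp add: vec_def linear_scale[OF e_linear])
  then have "(\<Sum>k\<in>UNIV. \<Sum>l\<in>UNIV. vec [((p, k), False), ((p, l), False), ((p, k), True), ((q, l), True)]) =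
    complex_of_real (\<Sum>k\<in>UNIV. \<Sum>l\<in>UNIV. v p k * v p l * v p k * v q l * fst (e k (e l (e k (e l (1, 0))))))"
    by simp
  also have "(\<Sum>k\<in>UNIV. \<Sum>l\<in>UNIV. v p k * v p l * v p k * v q l * fst (e k (e l (e k (e l (1, 0)))))) =
     (\<Sum>k\<in>{p, q}. \<Sum>l\<in>{p, q}. v p k * v p l * v p k * v q l * fst (e k (e l (e k (e l (1, 0))))))"
    by (intro sum.mono_neutral_cong_right sum.mono_neutral_right ballI) (auto simp: v_def y_def)
  also have "\<dots> = 168 / 625"
    using pq by (simp add: v_def y_def e_def)
  finally show ?thesis by simp
qed

lemma Au_state:
  obtains \<psi> where "is_state (Au :: 'n au cstar_algebra) \<psi>"
    "\<And>a. a \<in> carrier free_star_algebra \<Longrightarrow>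
      \<psi> (seq_class free_star_algebra (universal_seminorm Au_relators) (\<lambda>_. a)) = lin vec a"
  using univ.state_extends[OF positive_vec vec_le_universal lin_vec_one] unfolding Au_eq by blast

end


section \<open>The invariant element\<close>

lemma hom_finsum:
  assumes "ring R" "ring S" "h \<in> ring_hom R S" "\<And>i. i \<in> I \<Longrightarrow> f i \<in> carrier R"
  shows "h (finsum R f I) = finsum S (\<lambda>i. h (f i)) I"
proof -
  interpret R: ring R by fact
  interpret S: ring S by fact
  show ?thesis
    using assms(4)
  proof (induction I rule: infinite_finite_induct)
    case (insert i I)
    then show ?case
      using ring_hom_closed[OF assms(3)] ring_hom_add[OF assms(3)] by (simp add: Pi_def)
  qed (use ring_hom_zero[OF assms(3,1,2)] in \<open>auto simp: R.finsum_infinite S.finsum_infinite\<close>)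
qed

lemma (in ring) finsum_swap:
  assumes "finite I" "finite J" "\<And>i j. i \<in> I \<Longrightarrow> j \<in> J \<Longrightarrow> f i j \<in> carrier R"
  shows "(\<Oplus>i\<in>I. \<Oplus>j\<in>J. f i j) = (\<Oplus>j\<in>J. \<Oplus>i\<in>I. f i j)"
  using assms(1,3)
proof (induction I rule: finite_induct)
  case empty
  then show ?case by (simp add: finsum_zero)
next
  case (insert i I)
  have "(\<Oplus>j\<in>J. \<Oplus>i'\<in>insert i I. f i' j) = (\<Oplus>j\<in>J. f i j \<oplus> (\<Oplus>i'\<in>I. f i' j))"
    using insert by (intro finsum_cong') (auto simp: Pi_def)
  also have "\<dots> = (\<Oplus>j\<in>J. f i j) \<oplus> (\<Oplus>j\<in>J. \<Oplus>i'\<in>I. f i' j)"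
    using insert by (intro finsum_addf) (auto simp: Pi_def)
  finally show ?case using insert by (simp add: Pi_def)
qed

lemma (in ring) finsum_delta:
  assumes "finite I" "i \<in> I" "\<And>j. j \<in> I \<Longrightarrow> f j \<in> carrier R"
  shows "(\<Oplus>j\<in>I. if i = j then f j else \<zero>) = f i"
  using add.finprod_singleton[of i I f] assms by (auto simp: Pi_def)

text \<open>Since \<beta> can be moved past z, it meets \<gamma>, and the sum over k contracts their
  product to the identity matrix. What remains is z between \<alpha> and \<delta>.\<close>

lemma (in ring) matrix_conjugation:
  fixes \<alpha> \<beta> \<gamma> \<delta> :: "'n::finite \<Rightarrow> 'n \<Rightarrow> 'a"
  assumes cl: "\<And>i j. \<alpha> i j \<in> carrier R" "\<And>i j. \<beta> i j \<in> carrier R" "\<And>i j. \<gamma> i j \<in> carrier R"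
      "\<And>i j. \<delta> i j \<in> carrier R" "z \<in> carrier R"
    and comm: "\<And>i j. \<beta> i j \<otimes> z = z \<otimes> \<beta> i j"
    and inv: "\<And>i j. (\<Oplus>k\<in>UNIV. \<beta> i k \<otimes> \<gamma> j k) = (if i = j then \<one> else \<zero>)"
  shows "(\<Oplus>k\<in>UNIV. (\<Oplus>m\<in>UNIV. \<alpha> i m \<otimes> \<beta> m k) \<otimes> z \<otimes> (\<Oplus>m\<in>UNIV. \<gamma> m k \<otimes> \<delta> j m)) =
    (\<Oplus>m\<in>UNIV. \<alpha> i m \<otimes> z \<otimes> \<delta> j m)"
proof -
  have "(\<Oplus>k\<in>UNIV. (\<Oplus>m\<in>UNIV. \<alpha> i m \<otimes> \<beta> m k) \<otimes> z \<otimes> (\<Oplus>m\<in>UNIV. \<gamma> m k \<otimes> \<delta> j m)) =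
     (\<Oplus>k\<in>UNIV. \<Oplus>m\<in>UNIV. \<Oplus>r\<in>UNIV. \<alpha> i m \<otimes> z \<otimes> (\<beta> m k \<otimes> \<gamma> r k) \<otimes> \<delta> j r)"
  proof (intro finsum_cong' refl)
    fix k
    have "\<alpha> i m \<otimes> \<beta> m k \<otimes> z \<otimes> (\<gamma> r k \<otimes> \<delta> j r) = \<alpha> i m \<otimes> z \<otimes> (\<beta> m k \<otimes> \<gamma> r k) \<otimes> \<delta> j r" for m r
      using cl by (simp add: m_assoc) (simp add: m_assoc[symmetric] comm)
    then show "(\<Oplus>m\<in>UNIV. \<alpha> i m \<otimes> \<beta> m k) \<otimes> z \<otimes> (\<Oplus>m\<in>UNIV. \<gamma> m k \<otimes> \<delta> j m) =
        (\<Oplus>m\<in>UNIV. \<Oplus>r\<in>UNIV. \<alpha> i m \<otimes> z \<otimes> (\<beta> m k \<otimes> \<gamma> r k) \<otimes> \<delta> j r)"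
      using cl by (simp add: finsum_ldistr finsum_rdistr Pi_def) (intro finsum_swap, auto)
  qed (use cl in auto)
  also have "\<dots> = (\<Oplus>m\<in>UNIV. \<Oplus>k\<in>UNIV. \<Oplus>r\<in>UNIV. \<alpha> i m \<otimes> z \<otimes> (\<beta> m k \<otimes> \<gamma> r k) \<otimes> \<delta> j r)"
    using cl by (intro finsum_swap) auto
  also have "\<dots> = (\<Oplus>m\<in>UNIV. \<Oplus>r\<in>UNIV. \<Oplus>k\<in>UNIV. \<alpha> i m \<otimes> z \<otimes> (\<beta> m k \<otimes> \<gamma> r k) \<otimes> \<delta> j r)"
    using cl by (intro finsum_cong' finsum_swap refl) auto
  also have "\<dots> = (\<Oplus>m\<in>UNIV. \<Oplus>r\<in>UNIV. if m = r then \<alpha> i m \<otimes> z \<otimes> \<delta> j r else \<zero>)"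
  proof (intro finsum_cong' refl)
    fix m r
    have "(\<Oplus>k\<in>UNIV. \<alpha> i m \<otimes> z \<otimes> (\<beta> m k \<otimes> \<gamma> r k) \<otimes> \<delta> j r) =
       \<alpha> i m \<otimes> z \<otimes> (\<Oplus>k\<in>UNIV. \<beta> m k \<otimes> \<gamma> r k) \<otimes> \<delta> j r"
      using cl by (simp add: finsum_ldistr finsum_rdistr Pi_def)
    then show "(\<Oplus>k\<in>UNIV. \<alpha> i m \<otimes> z \<otimes> (\<beta> m k \<otimes> \<gamma> r k) \<otimes> \<delta> j r) =
       (if m = r then \<alpha> i m \<otimes> z \<otimes> \<delta> j r else \<zero>)"
      using cl by (simp add: inv)
  qed (use cl in auto)
  also have "\<dots> = (\<Oplus>m\<in>UNIV. \<alpha> i m \<otimes> z \<otimes> \<delta> j m)"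
    using cl by (intro finsum_cong' finsum_delta refl) auto
  finally show ?thesis .
qed

text \<open>The inner sum over \<open>k\<close> is removed first, with \<open>V p l\<close> in the middle; then the sum over \<open>l\<close>,
  with \<open>\<delta> p m\<close> in the middle.\<close>

lemma (in ring) crossing_conjugation:
  fixes \<alpha> \<beta> \<gamma> \<delta> V W :: "'n::finite \<Rightarrow> 'n \<Rightarrow> 'a"
  assumes cl: "\<And>i j. \<alpha> i j \<in> carrier R" "\<And>i j. \<beta> i j \<in> carrier R" "\<And>i j. \<gamma> i j \<in> carrier R"
      "\<And>i j. \<delta> i j \<in> carrier R"
    and comm: "\<And>i j k l. \<beta> i j \<otimes> \<alpha> k l = \<alpha> k l \<otimes> \<beta> i j" "\<And>i j k l. \<beta> i j \<otimes> \<beta> k l = \<beta> k l \<otimes> \<beta> i j"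
      "\<And>i j k l. \<beta> i j \<otimes> \<delta> k l = \<delta> k l \<otimes> \<beta> i j"
    and inv: "\<And>i j. (\<Oplus>k\<in>UNIV. \<beta> i k \<otimes> \<gamma> j k) = (if i = j then \<one> else \<zero>)"
    and V_def: "\<And>i k. V i k = (\<Oplus>m\<in>UNIV. \<alpha> i m \<otimes> \<beta> m k)"
    and W_def: "\<And>i k. W i k = (\<Oplus>m\<in>UNIV. \<gamma> m k \<otimes> \<delta> i m)"
  shows "(\<Oplus>k\<in>UNIV. \<Oplus>l\<in>UNIV. V p k \<otimes> V p l \<otimes> W p k \<otimes> W q l) =
    (\<Oplus>k\<in>UNIV. \<Oplus>l\<in>UNIV. \<alpha> p k \<otimes> \<alpha> p l \<otimes> \<delta> p k \<otimes> \<delta> q l)"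
proof -
  have VW: "V i k \<in> carrier R" "W i k \<in> carrier R" for i k
    unfolding V_def W_def using cl by (auto intro!: finsum_closed)
  \<comment> \<open>This makes \<open>V p l\<close> an admissible middle element. It requires the
    \<beta> to commute with each other, and it is here that commutativity of the subgroup algebra
    enters.\<close>
  have comm_V: "\<beta> i j \<otimes> V k l = V k l \<otimes> \<beta> i j" for i j k l
  proof -
    have "\<beta> i j \<otimes> (\<alpha> k m \<otimes> \<beta> m l) = (\<alpha> k m \<otimes> \<beta> m l) \<otimes> \<beta> i j" for m
    proof -
      have "\<beta> i j \<otimes> (\<alpha> k m \<otimes> \<beta> m l) = \<alpha> k m \<otimes> (\<beta> i j \<otimes> \<beta> m l)"
        using cl by (simp add: m_assoc[symmetric] comm(1))
      also have "\<dots> = (\<alpha> k m \<otimes> \<beta> m l) \<otimes> \<beta> i j"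
        using cl by (subst comm(2)) (simp add: m_assoc)
      finally show ?thesis .
    qed
    then show ?thesis
      unfolding V_def using cl by (simp add: finsum_ldistr finsum_rdistr Pi_def)
  qed
  \<comment> \<open>The two open premises concern the middle element z and are discharged at each
    use.\<close>
  note conj = matrix_conjugation[of \<alpha> \<beta> \<gamma> \<delta>, OF cl _ _ inv, folded V_def W_def]
  have "(\<Oplus>k\<in>UNIV. \<Oplus>l\<in>UNIV. V p k \<otimes> V p l \<otimes> W p k \<otimes> W q l) =
      (\<Oplus>l\<in>UNIV. \<Oplus>k\<in>UNIV. V p k \<otimes> V p l \<otimes> W p k \<otimes> W q l)"
    using VW by (intro finsum_swap) auto
  also have "\<dots> = (\<Oplus>l\<in>UNIV. (\<Oplus>k\<in>UNIV. V p k \<otimes> V p l \<otimes> W p k) \<otimes> W q l)"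
    using VW by (simp add: finsum_ldistr Pi_def)
  also have "\<dots> = (\<Oplus>l\<in>UNIV. (\<Oplus>m\<in>UNIV. \<alpha> p m \<otimes> V p l \<otimes> \<delta> p m) \<otimes> W q l)"
    using VW comm_V by (simp add: conj)
  also have "\<dots> = (\<Oplus>l\<in>UNIV. \<Oplus>m\<in>UNIV. \<alpha> p m \<otimes> (V p l \<otimes> \<delta> p m \<otimes> W q l))"
    using VW cl by (simp add: finsum_ldistr m_assoc Pi_def)
  also have "\<dots> = (\<Oplus>m\<in>UNIV. \<Oplus>l\<in>UNIV. \<alpha> p m \<otimes> (V p l \<otimes> \<delta> p m \<otimes> W q l))"
    using VW cl by (intro finsum_swap) auto
  also have "\<dots> = (\<Oplus>m\<in>UNIV. \<alpha> p m \<otimes> (\<Oplus>l\<in>UNIV. V p l \<otimes> \<delta> p m \<otimes> W q l))"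
    using VW cl by (simp add: finsum_rdistr Pi_def)
  also have "\<dots> = (\<Oplus>m\<in>UNIV. \<alpha> p m \<otimes> (\<Oplus>r\<in>UNIV. \<alpha> p r \<otimes> \<delta> p m \<otimes> \<delta> q r))"
    using cl comm(3) by (simp add: conj)
  also have "\<dots> = (\<Oplus>m\<in>UNIV. \<Oplus>r\<in>UNIV. \<alpha> p m \<otimes> \<alpha> p r \<otimes> \<delta> p m \<otimes> \<delta> q r)"
    using cl by (simp add: finsum_rdistr m_assoc Pi_def)
  finally show ?thesis .
qed

text \<open>Algebra and matrix are parameters because the same expression is carried by
  \<open>hom_cross\<close> through the free algebra, \<open>Au\<close>, the formal tensors and the
  spatial tensor products.\<close>

definition cross :: "('a, 'x) star_algebra_scheme \<Rightarrow> ('n::finite \<Rightarrow> 'n \<Rightarrow> 'a) \<Rightarrow> 'n \<Rightarrow> 'n \<Rightarrow> 'a" where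
  "cross A u p q = (\<Oplus>\<^bsub>A\<^esub>k\<in>UNIV. \<Oplus>\<^bsub>A\<^esub>l\<in>UNIV.
     u p k \<otimes>\<^bsub>A\<^esub> u p l \<otimes>\<^bsub>A\<^esub> star A (u p k) \<otimes>\<^bsub>A\<^esub> star A (u q l))"

lemma (in complex_star_algebra) cross_closed:
  "(\<And>i j. u i j \<in> carrier A) \<Longrightarrow> cross A u p q \<in> carrier A"
  unfolding cross_def by (intro finsum_closed funcsetI m_closed star_closed) auto

lemma hom_cross:
  assumes A: "complex_star_algebra A" and B: "complex_star_algebra B" and h: "h \<in> ring_hom A B"
    and star: "\<And>a. a \<in> carrier A \<Longrightarrow> h (star A a) = star B (h a)"
    and u: "\<And>i j. u i j \<in> carrier A"
  shows "h (cross A u p q) = cross B (\<lambda>i j. h (u i j)) p q"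
proof -
  interpret A: complex_star_algebra A by fact
  interpret B: complex_star_algebra B by fact
  note hs = hom_finsum[OF A.ring_axioms B.ring_axioms h]
  have "h (u p k \<otimes>\<^bsub>A\<^esub> u p l \<otimes>\<^bsub>A\<^esub> star A (u p k) \<otimes>\<^bsub>A\<^esub> star A (u q l)) =
      h (u p k) \<otimes>\<^bsub>B\<^esub> h (u p l) \<otimes>\<^bsub>B\<^esub> star B (h (u p k)) \<otimes>\<^bsub>B\<^esub> star B (h (u q l))" for k l
    using u by (simp add: ring_hom_mult[OF h] star)
  then show ?thesis
    unfolding cross_def using u by (simp add: hs)
qed

context spatial_pair
begin

lemma elem_tensor_split:
  assumes "a \<in> carrier A" "b \<in> carrier B"
  shows "elem_tensor A B a \<one>\<^bsub>B\<^esub> \<otimes>\<^bsub>spatial_tensor A B\<^esub> elem_tensor A B \<one>\<^bsub>A\<^esub> b = elem_tensor A B a b"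
    and "elem_tensor A B \<one>\<^bsub>A\<^esub> b \<otimes>\<^bsub>spatial_tensor A B\<^esub> elem_tensor A B a \<one>\<^bsub>B\<^esub> = elem_tensor A B a b"
  using assms by (simp_all add: elem_tensor_mult)

lemma star_finsum_elem:
  fixes u :: "'n::finite \<Rightarrow> 'a"
  assumes "\<And>m. u m \<in> carrier A" "\<And>m. w m \<in> carrier B"
  shows "star (spatial_tensor A B) (\<Oplus>\<^bsub>spatial_tensor A B\<^esub>m\<in>UNIV. elem_tensor A B (u m) (w m)) =
    (\<Oplus>\<^bsub>spatial_tensor A B\<^esub>m\<in>UNIV. elem_tensor A B (star A (u m)) (star B (w m)))"
proof -
  have "star (spatial_tensor A B) (\<Oplus>\<^bsub>spatial_tensor A B\<^esub>m\<in>S. elem_tensor A B (u m) (w m)) =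
    (\<Oplus>\<^bsub>spatial_tensor A B\<^esub>m\<in>S. elem_tensor A B (star A (u m)) (star B (w m)))" if "finite S" for S
    using that
    by (induction S rule: finite_induct) (use assms in \<open>auto simp: st.star_add elem_tensor_star Pi_def\<close>)
  then show ?thesis by simp
qed

text \<open>Elements \<beta> = 1 \<otimes> x commute with everything in the first leg, and with each
  other since B is commutative. The row relation of x then contracts both interleaved sums.\<close>

lemma cross_contract:
  fixes u :: "'n::finite \<Rightarrow> 'n \<Rightarrow> 'a" and x :: "'n \<Rightarrow> 'n \<Rightarrow> 'b"
  assumes u: "\<And>i j. u i j \<in> carrier A" and x: "\<And>i j. x i j \<in> carrier B"
    and comm: "\<And>b b'. b \<in> carrier B \<Longrightarrow> b' \<in> carrier B \<Longrightarrow> b \<otimes>\<^bsub>B\<^esub> b' = b' \<otimes>\<^bsub>B\<^esub> b"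
    and rows: "\<And>i j. (\<Oplus>\<^bsub>B\<^esub>k\<in>UNIV. x i k \<otimes>\<^bsub>B\<^esub> star B (x j k)) = (if i = j then \<one>\<^bsub>B\<^esub> else \<zero>\<^bsub>B\<^esub>)"
  shows "cross (spatial_tensor A B) (\<lambda>i j. \<Oplus>\<^bsub>spatial_tensor A B\<^esub>m\<in>UNIV. elem_tensor A B (u i m) (x m j)) p q =
    elem_tensor A B (cross A u p q) \<one>\<^bsub>B\<^esub>"
proof -
  define S where "S = spatial_tensor A B"
  interpret S: complex_star_algebra S unfolding S_def by (rule st.complex_star_algebra_axioms)
  define \<alpha> \<delta> where "\<alpha> i m = elem_tensor A B (u i m) \<one>\<^bsub>B\<^esub>"
    and "\<delta> i m = elem_tensor A B (star A (u i m)) \<one>\<^bsub>B\<^esub>" for i m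
  define \<beta> \<gamma> where "\<beta> m k = elem_tensor A B \<one>\<^bsub>A\<^esub> (x m k)"
    and "\<gamma> m k = elem_tensor A B \<one>\<^bsub>A\<^esub> (star B (x m k))" for m k
  have cl: "\<alpha> i m \<in> carrier S" "\<delta> i m \<in> carrier S" "\<beta> i m \<in> carrier S" "\<gamma> i m \<in> carrier S" for i m
    using u x by (auto simp: \<alpha>_def \<beta>_def \<gamma>_def \<delta>_def S_def)
  define V where "V i k = (\<Oplus>\<^bsub>S\<^esub>m\<in>UNIV. \<alpha> i m \<otimes>\<^bsub>S\<^esub> \<beta> m k)" for i k
  \<comment> \<open>The adjoint of \<open>V i k\<close>. As the legs commute, \<gamma> may be
    written first, where it can meet \<beta>.\<close>
  define W where "W i k = (\<Oplus>\<^bsub>S\<^esub>m\<in>UNIV. \<gamma> m k \<otimes>\<^bsub>S\<^esub> \<delta> i m)" for i k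
  have V: "(\<Oplus>\<^bsub>S\<^esub>m\<in>UNIV. elem_tensor A B (u i m) (x m j)) = V i j" for i j
    unfolding V_def \<alpha>_def \<beta>_def S_def using u x by (simp add: elem_tensor_split)
  have W: "star S (V i j) = W i j" for i j
    unfolding V[symmetric] unfolding W_def \<gamma>_def \<delta>_def S_def
    using u x by (simp add: star_finsum_elem elem_tensor_split)
  have inv: "(\<Oplus>\<^bsub>S\<^esub>k\<in>UNIV. \<beta> i k \<otimes>\<^bsub>S\<^esub> \<gamma> j k) = (if i = j then \<one>\<^bsub>S\<^esub> else \<zero>\<^bsub>S\<^esub>)" for i j
  proof -
    have "(\<Oplus>\<^bsub>S\<^esub>k\<in>UNIV. \<beta> i k \<otimes>\<^bsub>S\<^esub> \<gamma> j k) =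
        (\<Oplus>\<^bsub>S\<^esub>k\<in>UNIV. elem_tensor A B \<one>\<^bsub>A\<^esub> (x i k \<otimes>\<^bsub>B\<^esub> star B (x j k)))"
      unfolding \<beta>_def \<gamma>_def S_def using x by (simp add: elem_tensor_mult)
    also have "\<dots> = elem_tensor A B \<one>\<^bsub>A\<^esub> (\<Oplus>\<^bsub>B\<^esub>k\<in>UNIV. x i k \<otimes>\<^bsub>B\<^esub> star B (x j k))"
      unfolding S_def using x
      by (intro hom_finsum[symmetric] elem_tensor_right_hom B.ring_axioms st.ring_axioms) auto
    also have "\<dots> = (if i = j then \<one>\<^bsub>S\<^esub> else \<zero>\<^bsub>S\<^esub>)"
      unfolding rows S_def
      using ring_hom_zero[OF elem_tensor_right_hom B.ring_axioms st.ring_axioms] by (simp add: elem_tensor_one)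
    finally show ?thesis .
  qed
  have comm_\<alpha>: "\<beta> i j \<otimes>\<^bsub>S\<^esub> \<alpha> k l = \<alpha> k l \<otimes>\<^bsub>S\<^esub> \<beta> i j"
    and comm_\<delta>: "\<beta> i j \<otimes>\<^bsub>S\<^esub> \<delta> k l = \<delta> k l \<otimes>\<^bsub>S\<^esub> \<beta> i j"
    and comm_\<beta>: "\<beta> i j \<otimes>\<^bsub>S\<^esub> \<beta> k l = \<beta> k l \<otimes>\<^bsub>S\<^esub> \<beta> i j" for i j k l
    unfolding \<alpha>_def \<beta>_def \<delta>_def S_def using u x comm by (simp_all add: elem_tensor_split elem_tensor_mult)
  have "cross S V p q = (\<Oplus>\<^bsub>S\<^esub>k\<in>UNIV. \<Oplus>\<^bsub>S\<^esub>l\<in>UNIV. V p k \<otimes>\<^bsub>S\<^esub> V p l \<otimes>\<^bsub>S\<^esub> W p k \<otimes>\<^bsub>S\<^esub> W q l)"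
    by (simp add: cross_def W)
  also have "\<dots> = (\<Oplus>\<^bsub>S\<^esub>m\<in>UNIV. \<Oplus>\<^bsub>S\<^esub>r\<in>UNIV. \<alpha> p m \<otimes>\<^bsub>S\<^esub> \<alpha> p r \<otimes>\<^bsub>S\<^esub> \<delta> p m \<otimes>\<^bsub>S\<^esub> \<delta> q r)"
    by (rule S.crossing_conjugation[OF cl(1,3,4,2) comm_\<alpha> comm_\<beta> comm_\<delta> inv V_def W_def])
  also have "\<dots> = cross S (\<lambda>i j. elem_tensor A B (u i j) \<one>\<^bsub>B\<^esub>) p q"
    unfolding cross_def \<alpha>_def \<delta>_def S_def using u by (simp add: elem_tensor_star)
  also have "\<dots> = elem_tensor A B (cross A u p q) \<one>\<^bsub>B\<^esub>"
    unfolding S_def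
    by (rule hom_cross[OF A.complex_star_algebra_axioms st.complex_star_algebra_axioms elem_tensor_left_hom, symmetric])
       (use u in \<open>auto simp: elem_tensor_star\<close>)
  finally show ?thesis by (simp add: V[unfolded S_def] S_def)
qed

text \<open>A character with diagonal values c acts on the first leg like left translation by a
  diagonal matrix: u i j becomes c i times w i j. The three factors from row p and the one from row
  q each contribute their scalar.\<close>

lemma lin_cross:
  fixes u :: "'n::finite \<Rightarrow> 'n \<Rightarrow> 'a" and w :: "'n \<Rightarrow> 'n \<Rightarrow> 'b"
  assumes u: "\<And>i j. u i j \<in> carrier A" and w: "\<And>i j. w i j \<in> carrier B"
    and \<theta>: "\<And>a b. a \<in> carrier A \<Longrightarrow> b \<in> carrier A \<Longrightarrow> \<theta> (a \<otimes>\<^bsub>A\<^esub> b) = \<theta> a * \<theta> b"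
      "\<And>a. a \<in> carrier A \<Longrightarrow> \<theta> (star A a) = cnj (\<theta> a)"
      "\<And>i j. \<theta> (u i j) = (if i = j then c i else 0)"
    and \<psi>: "is_state B \<psi>"
  shows "lin (\<lambda>z. \<theta> (fst z) * \<psi> (snd z)) (cross FT (\<lambda>i j. \<Oplus>\<^bsub>FT\<^esub>m\<in>UNIV. monomial (u i m, w m j)) p q) =
    c p * c p * cnj (c p) * cnj (c q) * \<psi> (cross B w p q)"
proof -
  interpret b: positive_functional B \<psi> using \<psi> by (rule B.state_positive)
  have \<psi>_finsum: "\<psi> (finsum B f S) = (\<Sum>i\<in>S. \<psi> (f i))" if "finite S" "\<And>i. f i \<in> carrier B"
    for f :: "'n \<Rightarrow> 'b" and S
    using that by (induction S rule: finite_induct) (auto simp: b.func_add Pi_def)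
  define W where "W i j = (\<Oplus>\<^bsub>FT\<^esub>m\<in>UNIV. monomial (u i m, w m j))" for i j
  have m: "monomial (u i m, w m j) \<in> carrier FT" for i m j using u w by auto
  have W: "W i j \<in> carrier FT" for i j unfolding W_def using m by (intro fam.finsum_closed) auto
  have linW: "lin f (W i j) = (\<Sum>m\<in>UNIV. f (u i m, w m j))" for f i j
    unfolding W_def using m by (simp add: ft.lin_finsum)
  have linWs: "lin f (star FT (W i j)) = (\<Sum>m\<in>UNIV. f (star A (u i m), star B (w m j)))" for f i j
    using W by (simp add: ft.lin_star linW)
  \<comment> \<open>Diagonality leaves one term in each of the four sums that come from the
    comultiplication.\<close>
  have collapse: "(\<Sum>m\<in>UNIV. \<theta> (u i m) * g m) = c i * g i"
    "(\<Sum>m\<in>UNIV. cnj (\<theta> (u i m)) * g m) = cnj (c i) * g i" for i and g :: "'n \<Rightarrow> complex"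
  proof -
    have "(\<Sum>m\<in>UNIV. \<theta> (u i m) * g m) = (\<Sum>m\<in>UNIV. if i = m then c i * g m else 0)"
      "(\<Sum>m\<in>UNIV. cnj (\<theta> (u i m)) * g m) = (\<Sum>m\<in>UNIV. if i = m then cnj (c i) * g m else 0)"
      by (intro sum.cong; simp add: \<theta>(3))+
    then show "(\<Sum>m\<in>UNIV. \<theta> (u i m) * g m) = c i * g i"
      "(\<Sum>m\<in>UNIV. cnj (\<theta> (u i m)) * g m) = cnj (c i) * g i" by simp_all
  qed
  have four: "lin (\<lambda>z. \<theta> (fst z) * \<psi> (snd z))
      (W p k \<otimes>\<^bsub>FT\<^esub> W p l \<otimes>\<^bsub>FT\<^esub> star FT (W p k) \<otimes>\<^bsub>FT\<^esub> star FT (W q l)) =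
    c p * c p * cnj (c p) * cnj (c q) *
      \<psi> (w p k \<otimes>\<^bsub>B\<^esub> w p l \<otimes>\<^bsub>B\<^esub> star B (w p k) \<otimes>\<^bsub>B\<^esub> star B (w q l))" for k l
  proof -
    have "lin (\<lambda>z. \<theta> (fst z) * \<psi> (snd z))
        (W p k \<otimes>\<^bsub>FT\<^esub> W p l \<otimes>\<^bsub>FT\<^esub> star FT (W p k) \<otimes>\<^bsub>FT\<^esub> star FT (W q l)) =
      (\<Sum>a\<in>UNIV. \<Sum>b\<in>UNIV. \<Sum>d\<in>UNIV. \<Sum>e\<in>UNIV.
        \<theta> (u p a \<otimes>\<^bsub>A\<^esub> u p b \<otimes>\<^bsub>A\<^esub> star A (u p d) \<otimes>\<^bsub>A\<^esub> star A (u q e)) *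
        \<psi> (w a k \<otimes>\<^bsub>B\<^esub> w b l \<otimes>\<^bsub>B\<^esub> star B (w d k) \<otimes>\<^bsub>B\<^esub> star B (w e l)))"
      using W by (simp add: ft.lin_mult ft.alg_closed linW linWs DirProd_mult)
    also have "\<dots> = (\<Sum>a\<in>UNIV. \<theta> (u p a) * (\<Sum>b\<in>UNIV. \<theta> (u p b) * (\<Sum>d\<in>UNIV. cnj (\<theta> (u p d)) *
        (\<Sum>e\<in>UNIV. cnj (\<theta> (u q e)) * \<psi> (w a k \<otimes>\<^bsub>B\<^esub> w b l \<otimes>\<^bsub>B\<^esub> star B (w d k) \<otimes>\<^bsub>B\<^esub> star B (w e l))))))"
      using u by (simp add: \<theta>(1,2) sum_distrib_left mult.assoc)
    also have "\<dots> = c p * (c p * (cnj (c p) * (cnj (c q) *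
        \<psi> (w p k \<otimes>\<^bsub>B\<^esub> w p l \<otimes>\<^bsub>B\<^esub> star B (w p k) \<otimes>\<^bsub>B\<^esub> star B (w q l)))))"
      by (simp only: collapse)
    finally show ?thesis by (simp add: mult.assoc)
  qed
  have "lin (\<lambda>z. \<theta> (fst z) * \<psi> (snd z)) (cross FT W p q) =
     (\<Sum>k\<in>UNIV. \<Sum>l\<in>UNIV. c p * c p * cnj (c p) * cnj (c q) *
       \<psi> (w p k \<otimes>\<^bsub>B\<^esub> w p l \<otimes>\<^bsub>B\<^esub> star B (w p k) \<otimes>\<^bsub>B\<^esub> star B (w q l)))"
    unfolding cross_def four[symmetric] using W
    by (subst ft.lin_finsum; (simp add: ft.alg_closed)?) (simp_all add: ft.lin_finsum ft.alg_closed fam.finsum_closed Pi_def)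
  also have "\<dots> = c p * c p * cnj (c p) * cnj (c q) * \<psi> (cross B w p q)"
    unfolding cross_def using w by (simp add: \<psi>_finsum sum_distrib_left)
  finally show ?thesis unfolding W_def .
qed

end


section \<open>\<open>C(U(n))\<close> is not normal in \<open>A\<^sub>u(n)\<close>\<close>

lemma Au_gen_closed [simp, intro]: "Au_gen i j \<in> carrier Au"
  unfolding Au_gen_def Au_eq by (rule univ.completion_mem) (rule univ.cauchy_const, rule gen_closed)

lemma coord_closed [simp, intro]: "coord i j \<in> carrier CU"
  unfolding coord_def by (intro CU_restrict continuous_intros)

lemma CU_comm: "f \<otimes>\<^bsub>CU\<^esub> h = h \<otimes>\<^bsub>CU\<^esub> f"
  by (simp add: CU_ops mult.commute)

lemma CU_finsum:
  assumes "finite S" "\<And>i. i \<in> S \<Longrightarrow> f i \<in> carrier CU"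
  shows "finsum CU f S = (\<lambda>g\<in>unitary_group. \<Sum>i\<in>S. f i g)"
proof -
  interpret complex_star_algebra CU by (rule complex_star_algebra_CU)
  show ?thesis
    using assms by (induction S rule: finite_induct) (auto simp: Pi_def CU_ops(4,5) intro!: restrict_ext)
qed

lemma coord_rows:
  "(\<Oplus>\<^bsub>CU\<^esub>k\<in>UNIV. coord i k \<otimes>\<^bsub>CU\<^esub> star CU (coord j k)) = (if i = j then \<one>\<^bsub>CU\<^esub> else \<zero>\<^bsub>CU\<^esub>)"
proof -
  interpret complex_star_algebra CU by (rule complex_star_algebra_CU)
  have "(\<Oplus>\<^bsub>CU\<^esub>k\<in>UNIV. coord i k \<otimes>\<^bsub>CU\<^esub> star CU (coord j k)) =
      (\<lambda>g\<in>unitary_group. \<Sum>k\<in>UNIV. (coord i k \<otimes>\<^bsub>CU\<^esub> star CU (coord j k)) g)"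
    by (rule CU_finsum) auto
  also have "\<dots> = (\<lambda>g\<in>unitary_group. if i = j then 1 else 0)"
    by (intro restrict_ext) (simp add: CU_ops coord_def unitary_group_rows)
  finally show ?thesis by (simp add: CU_ops)
qed

text \<open>Point evaluation after \<rho> is a character of \<open>Au\<close>; the supremum over the
  points gives the norm.\<close>

lemma star_hom_CU_contractive:
  assumes \<rho>: "star_hom Au CU \<rho>" and a: "a \<in> carrier Au"
  shows "nrm CU (\<rho> a) \<le> nrm Au a"
proof -
  have "cmod (\<rho> a g) \<le> nrm Au a" if g: "g \<in> unitary_group" for g
    unfolding Au_eq
    by (rule univ.character_contractive[where \<theta> = "\<lambda>a. \<rho> a g"])
       (use a g in \<open>simp_all add: Au_eq[symmetric] star_homD[OF \<rho>] CU_ops\<close>)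
  then show ?thesis
    unfolding CU_ops using mat_one_unitary by (intro cSUP_least) auto
qed

text \<open>The value lies in the image of the formal tensors, where \<open>tensor_map\<close> and
  product functionals can be computed.\<close>

lemma Au_comult_cross:
  fixes \<Phi> :: "'n::finite au \<Rightarrow> ('n au, 'n au) tensor"
  assumes P: "spatial_pair (Au :: 'n au cstar_algebra) (Au :: 'n au cstar_algebra)" and \<Phi>: "Au_comult \<Phi>"
  shows "\<Phi> (cross Au Au_gen p q) = spatial_pair.incl Au Au
    (cross (formal_tensors Au Au)
      (\<lambda>i j. \<Oplus>\<^bsub>formal_tensors Au Au\<^esub>m\<in>UNIV. monomial (Au_gen i m, Au_gen m j)) p q)"
proof -
  interpret P: spatial_pair "Au :: 'n au cstar_algebra" "Au :: 'n au cstar_algebra" by (rule P)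
  have hom: "star_hom Au (spatial_tensor Au Au) \<Phi>"
    and gen: "\<And>i j. \<Phi> (Au_gen i j) =
      (\<Oplus>\<^bsub>spatial_tensor Au Au\<^esub>k\<in>UNIV. elem_tensor Au Au (Au_gen i k) (Au_gen k j))"
    using \<Phi> unfolding Au_comult_def by auto
  define W where "W i j = (\<Oplus>\<^bsub>formal_tensors Au Au\<^esub>m\<in>UNIV. monomial (Au_gen i m, Au_gen m j))" for i j :: 'n
  have W: "W i j \<in> carrier (formal_tensors Au Au)" for i j
    unfolding W_def by (intro P.fam.finsum_closed) auto
  have "\<Phi> (cross Au Au_gen p q) = cross (spatial_tensor Au Au) (\<lambda>i j. \<Phi> (Au_gen i j)) p q"
    by (rule hom_cross[OF P.A.complex_star_algebra_axioms P.st.complex_star_algebra_axioms star_homD(1)[OF hom]])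
       (auto simp: star_homD(7)[OF hom])
  also have "(\<lambda>i j. \<Phi> (Au_gen i j)) = (\<lambda>i j. P.incl (W i j))"
    unfolding gen W_def P.elem_tensor_eq
    by (intro ext, rule hom_finsum[OF P.fam.ring_axioms P.st.ring_axioms P.incl_hom, symmetric]) auto
  also have "cross (spatial_tensor Au Au) \<dots> p q = P.incl (cross (formal_tensors Au Au) W p q)"
    by (rule hom_cross[OF P.fam.complex_star_algebra_axioms P.st.complex_star_algebra_axioms P.incl_hom, symmetric])
       (use W in \<open>auto simp: P.incl_star\<close>)
  finally show ?thesis unfolding W_def[abs_def] .
qed

lemma cross_mem_left_coset_algebra:
  fixes \<rho> :: "'n::finite au \<Rightarrow> 'n cu"
  assumes C: "spatial_contraction (Au :: 'n au cstar_algebra) Au Au CU id \<rho>" and \<Phi>: "Au_comult \<Phi>"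
    and coord: "\<And>i j. \<rho> (Au_gen i j) = coord i j"
  shows "cross Au Au_gen p q \<in> left_coset_algebra Au \<Phi> CU \<rho>"
proof -
  interpret C: spatial_contraction "Au :: 'n au cstar_algebra" Au Au CU id \<rho> by (rule C)
  define W where "W i j = (\<Oplus>\<^bsub>formal_tensors Au Au\<^esub>m\<in>UNIV. monomial (Au_gen i m, Au_gen m j))" for i j :: 'n
  have W: "W i j \<in> carrier (formal_tensors Au Au)" for i j
    unfolding W_def by (intro C.src.fam.finsum_closed) auto
  have a: "cross Au Au_gen p q \<in> carrier Au" by (intro C.src.A.cross_closed Au_gen_closed)
  \<comment> \<open>On the image of \<open>incl\<close>, id \<otimes> \<rho> is given by this
    homomorphism of the formal tensors, which can be applied to \<open>cross\<close>
    directly.\<close>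
  let ?h = "\<lambda>t. C.tgt.incl (formal_map id \<rho> t)"
  have h: "?h \<in> ring_hom (formal_tensors Au Au) (spatial_tensor Au CU)"
    using ring_hom_trans[OF C.formal_map_hom C.tgt.incl_hom] by (simp add: o_def)
  have "tensor_map Au CU id \<rho> (\<Phi> (cross Au Au_gen p q)) = ?h (cross (formal_tensors Au Au) W p q)"
    unfolding Au_comult_cross[OF C.src.spatial_pair_axioms \<Phi>] W_def[abs_def, symmetric]
    by (intro C.tensor_map_incl C.src.fam.cross_closed W)
  also have "\<dots> = cross (spatial_tensor Au CU) (\<lambda>i j. ?h (W i j)) p q"
    by (rule hom_cross[OF C.src.fam.complex_star_algebra_axioms C.tgt.st.complex_star_algebra_axioms h])
       (use W in \<open>auto simp: C.formal_map_star C.formal_map_closed C.tgt.incl_star\<close>)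
  also have "(\<lambda>i j. ?h (W i j)) =
      (\<lambda>i j. \<Oplus>\<^bsub>spatial_tensor Au CU\<^esub>m\<in>UNIV. elem_tensor Au CU (Au_gen i m) (coord m j))"
  proof (intro ext)
    fix i j
    have "?h (W i j) = (\<Oplus>\<^bsub>spatial_tensor Au CU\<^esub>m\<in>UNIV. ?h (monomial (Au_gen i m, Au_gen m j)))"
      unfolding W_def
      by (rule hom_finsum[OF C.src.fam.ring_axioms C.tgt.st.ring_axioms h]) auto
    then show "?h (W i j) = (\<Oplus>\<^bsub>spatial_tensor Au CU\<^esub>m\<in>UNIV. elem_tensor Au CU (Au_gen i m) (coord m j))"
      by (simp add: C.formal_map_monomial coord C.tgt.elem_tensor_eq)
  qed
  also have "cross (spatial_tensor Au CU) \<dots> p q = elem_tensor Au CU (cross Au Au_gen p q) \<one>\<^bsub>CU\<^esub>"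
    by (rule C.tgt.cross_contract) (auto simp: coord_rows CU_comm)
  finally show ?thesis
    using a unfolding left_coset_algebra_def by blast
qed

lemma right_coset_algebra_state_cross:
  fixes \<rho> :: "'n::finite au \<Rightarrow> 'n cu"
  assumes C: "spatial_contraction Au (Au :: 'n au cstar_algebra) CU Au \<rho> id" and \<Phi>: "Au_comult \<Phi>"
    and coord: "\<And>i j. \<rho> (Au_gen i j) = coord i j" and "p \<noteq> q" and \<psi>: "is_state Au \<psi>"
    and mem: "cross Au Au_gen p q \<in> right_coset_algebra Au \<Phi> CU \<rho>"
  shows "\<psi> (cross Au Au_gen p q) = 0"
proof -
  interpret C: spatial_contraction Au "Au :: 'n au cstar_algebra" CU Au \<rho> id by (rule C)
  define W where "W i j = (\<Oplus>\<^bsub>formal_tensors Au Au\<^esub>m\<in>UNIV. monomial (Au_gen i m, Au_gen m j))"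
    for i j :: 'n
  have W: "W i j \<in> carrier (formal_tensors Au Au)" for i j
    unfolding W_def by (intro C.src.fam.finsum_closed) auto
  define t where "t = cross (formal_tensors Au Au) W p q"
  have t: "t \<in> carrier (formal_tensors Au Au)" unfolding t_def by (intro C.src.fam.cross_closed W)
  define a where "a = cross Au Au_gen p q"
  have a: "a \<in> carrier Au" unfolding a_def by (intro C.src.A.cross_closed) auto
  have "C.tgt.incl (formal_map \<rho> id t) = tensor_map CU Au \<rho> id (\<Phi> a)"
    unfolding a_def Au_comult_cross[OF C.src.spatial_pair_axioms \<Phi>] W_def[abs_def, symmetric] t_def[symmetric]
    using t by (rule C.tensor_map_incl[symmetric])
  also have "\<dots> = C.tgt.incl (monomial (\<one>\<^bsub>CU\<^esub>, a))"
    using mem unfolding right_coset_algebra_def a_def by (simp add: C.tgt.elem_tensor_eq)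
  finally have eq: "C.tgt.incl (formal_map \<rho> id t) = C.tgt.incl (monomial (\<one>\<^bsub>CU\<^esub>, a))" .
  \<comment> \<open>Row q occurs once in the crossing sum, so this diagonal matrix changes its
    sign.\<close>
  define c :: "'n \<Rightarrow> complex" where "c i = (if i = q then -1 else 1)" for i
  define g :: "complex ^ 'n ^ 'n" where "g = (\<chi> i j. if i = j then c i else 0)"
  have g: "g \<in> unitary_group"
  proof -
    have "(\<Sum>k\<in>UNIV. (if i = k then c i else 0) * cnj (if j = k then c j else 0)) = (if i = j then 1 else 0)" for i j
    proof -
      have "(\<Sum>k\<in>UNIV. (if i = k then c i else 0) * cnj (if j = k then c j else 0)) =
          (\<Sum>k\<in>UNIV. if i = k then (if i = j then c i * cnj (c j) else 0) else 0)"
        by (intro sum.cong) auto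
      then show ?thesis by (simp add: c_def)
    qed
    moreover have "(\<Sum>k\<in>UNIV. cnj (if k = i then c k else 0) * (if k = j then c k else 0)) = (if i = j then 1 else 0)" for i j
    proof -
      have "(\<Sum>k\<in>UNIV. cnj (if k = i then c k else 0) * (if k = j then c k else 0)) =
          (\<Sum>k\<in>UNIV. if k = i then (if i = j then cnj (c i) * c j else 0) else 0)"
        by (intro sum.cong) auto
      then show ?thesis by (simp add: c_def)
    qed
    ultimately show ?thesis
      unfolding unitary_group_def g_def by (simp add: matrix_matrix_mult_def mat_def vec_eq_iff)
  qed
  have eval: "is_state CU (\<lambda>f. f g)" using g by (rule point_evaluation_state)
  have "product_functional (\<lambda>f. f g) \<psi> (formal_map \<rho> id t) = lin (\<lambda>z. \<rho> (fst z) g * \<psi> (snd z)) t"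
    using t by (simp add: C.tgt.product_functional_eq_lin C.lin_map o_def)
  also have "\<dots> = c p * c p * cnj (c p) * cnj (c q) * \<psi> a"
    unfolding t_def W_def[abs_def] a_def
    by (rule C.src.lin_cross[where \<theta> = "\<lambda>a. \<rho> a g"])
       (use g \<psi> in \<open>auto simp: star_homD[OF C.f] coord CU_ops coord_def g_def\<close>)
  also have "\<dots> = - \<psi> a" using \<open>p \<noteq> q\<close> by (simp add: c_def)
  finally have "product_functional (\<lambda>f. f g) \<psi> (formal_map \<rho> id t) = - \<psi> a" .
  moreover have "product_functional (\<lambda>f. f g) \<psi> (monomial (\<one>\<^bsub>CU\<^esub>, a)) = \<psi> a"
    using g by (simp add: C.tgt.product_functional_eq_lin CU_ops)
  \<comment> \<open>The invariance equation in the tensor product is tested on evaluation at g times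
    \<psi>, which turns it into -\<psi> a = \<psi> a.\<close>
  moreover have "product_functional (\<lambda>f. f g) \<psi> (formal_map \<rho> id t) = product_functional (\<lambda>f. f g) \<psi> (monomial (\<one>\<^bsub>CU\<^esub>, a))"
    by (rule C.tgt.product_functional_cong[OF eval \<psi> _ _ eq]) (use t a C.formal_map_closed in auto)
  ultimately show ?thesis unfolding a_def by simp
qed

lemma (in plane_rep) cross_state_nonzero:
  obtains \<psi> where "is_state (Au :: 'n au cstar_algebra) \<psi>" "\<psi> (cross Au Au_gen p q) \<noteq> 0"
proof -
  obtain \<psi> where \<psi>: "is_state (Au :: 'n au cstar_algebra) \<psi>"
    "\<And>a. a \<in> carrier free_star_algebra \<Longrightarrow>
      \<psi> (seq_class free_star_algebra (universal_seminorm Au_relators) (\<lambda>_. a)) = lin vec a"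
    using Au_state by blast
  let ?G = "\<lambda>i j :: 'n. gen (i, j)" and ?F = "free_star_algebra :: ((('n \<times> 'n) \<times> bool) list \<Rightarrow> complex) star_algebra"
  have cl: "cross ?F ?G p q \<in> carrier ?F" by (intro free_alg.cross_closed) auto
  have "cross Au Au_gen p q = seq_class ?F (universal_seminorm Au_relators) (\<lambda>_. cross ?F ?G p q)"
    unfolding Au_gen_def Au_eq
    by (rule hom_cross[OF free_alg.complex_star_algebra_axioms univ.complex_star_algebra_completion
          univ.const_ring_hom, symmetric]) (auto simp: univ.completion_star)
  then have "\<psi> (cross Au Au_gen p q) = lin vec (cross ?F ?G p q)"
    using \<psi>(2)[OF cl] by simp
  also have "\<dots> = (\<Sum>k\<in>UNIV. \<Sum>l\<in>UNIV. vec [((p, k), False), ((p, l), False), ((p, k), True), ((q, l), True)])"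
  proof -
    have "gen (p, k) \<otimes>\<^bsub>?F\<^esub> gen (p, l) \<otimes>\<^bsub>?F\<^esub> star ?F (gen (p, k)) \<otimes>\<^bsub>?F\<^esub> star ?F (gen (q, l)) =
        monomial [((p, k), False), ((p, l), False), ((p, k), True), ((q, l), True)]" for k l
      unfolding star_gen by (simp add: gen_def free.monomial_mult)
    then show ?thesis
      unfolding cross_def by (simp add: free.lin_finsum free.monomial_closed free_alg.finsum_closed Pi_def)
  qed
  also have "\<dots> = 168 / 625" by (rule vec_cross)
  finally have eq: "\<psi> (cross Au Au_gen p q) = 168 / 625" .
  have "\<psi> (cross Au Au_gen p q) \<noteq> 0" unfolding eq by simp
  with \<psi>(1) show thesis by (rule that)
qed

theorem theorem5p8:
  fixes \<Phi> :: "'n::finite au \<Rightarrow> ('n au, 'n au) tensor"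
    and \<Psi> :: "'n cu \<Rightarrow> ('n cu, 'n cu) tensor"
    and \<rho> :: "'n au \<Rightarrow> 'n cu"
  assumes "2 \<le> CARD('n)"
    and "Au_comult \<Phi>"
    and "CU_comult \<Psi>"
    and "quantum_subgroup Au \<Phi> CU \<Psi> \<rho>"
    and "\<forall>i j. \<rho> (Au_gen i j) = coord i j"
  shows "\<not> normal_quantum_subgroup Au \<Phi> CU \<rho>"
proof
  assume normal: "normal_quantum_subgroup Au \<Phi> CU \<rho>"
  obtain p q :: 'n where pq: "p \<noteq> q"
    using assms(1) card_le_Suc0_iff_eq[of "UNIV :: 'n set"] by fastforce
  interpret plane_rep p q by unfold_locales (rule pq)
  obtain \<psi> where \<psi>: "is_state (Au :: 'n au cstar_algebra) \<psi>" "\<psi> (cross Au Au_gen p q) \<noteq> 0"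
    by (rule cross_state_nonzero)
  have \<rho>: "star_hom Au CU \<rho>" "\<rho> ` carrier Au = carrier CU"
    using assms(4) by (auto simp: quantum_subgroup_def)
  \<comment> \<open>The state that detects the crossing sum also supplies the state on
    \<open>Au\<close> needed for the tensor products; on \<open>CU\<close>, evaluation at the
    identity matrix serves.\<close>
  have states: "\<exists>\<phi>. is_state (Au :: 'n au cstar_algebra) \<phi>" "\<exists>\<phi>. is_state (CU :: 'n cu cstar_algebra) \<phi>"
    using \<psi> point_evaluation_state[OF mat_one_unitary] by blast+
  have pair: "spatial_pair (Au :: 'n au cstar_algebra) (Au :: 'n au cstar_algebra)"
    "spatial_pair (Au :: 'n au cstar_algebra) (CU :: 'n cu cstar_algebra)"
    "spatial_pair (CU :: 'n cu cstar_algebra) (Au :: 'n au cstar_algebra)"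
    by (intro spatial_pair.intro spatial_pair_axioms.intro normed_Au normed_CU states)+
  have "spatial_contraction (Au :: 'n au cstar_algebra) Au Au CU id \<rho>"
    by (intro spatial_contraction.intro spatial_contraction_axioms.intro pair star_hom_id \<rho>
        star_hom_CU_contractive) auto
  then have "cross Au Au_gen p q \<in> left_coset_algebra Au \<Phi> CU \<rho>"
    using assms(2,5) by (intro cross_mem_left_coset_algebra) auto
  then have "cross Au Au_gen p q \<in> right_coset_algebra Au \<Phi> CU \<rho>"
    using normal by (simp add: normal_quantum_subgroup_def)
  moreover have "spatial_contraction Au (Au :: 'n au cstar_algebra) CU Au \<rho> id"
    by (intro spatial_contraction.intro spatial_contraction_axioms.intro pair star_hom_id \<rho>
        star_hom_CU_contractive) auto
  ultimately have "\<psi> (cross Au Au_gen p q) = 0"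
    using assms(2,5) pq \<psi>(1) by (intro right_coset_algebra_state_cross) auto
  then show False using \<psi>(2) by contradiction
qed

end
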